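(* Let $(E,E')$ be a pair of elliptic curves over $\mathbb{Q}$ of type $T$ (one of the types $\mathbf{I}$–$\mathbf{XX}$ listed in the context, with parameters $p$ and, where applicable, $k$), and let $r=\operatorname{rank}_{\mathbb{Z}}E(\mathbb{Q})=\operatorname{rank}_{\mathbb{Z}}E'(\mathbb{Q})$. Then $r\le 1$ in each of the following cases: (1) $T\in\{\mathbf{I},\mathbf{II},\mathbf{III},\mathbf{IV},\mathbf{V},\mathbf{VI},\mathbf{VII},\mathbf{XI},\mathbf{XIII},\mathbf{XV}\}$; (2) $T=\mathbf{VIII}$ and $k=2$; (3) $T=\mathbf{X}$; (4) $T=\mathbf{XII}$ with $k=2$, and $-64$ is not a fourth power modulo $p$; (5) $T=\mathbf{XVI}$; (6) $T=\mathbf{XVII}$ with $k=1$ and $p\equiv 3\pmod 8$; (7) $T=\mathbf{XVIII}$ with $k=1$; (8) $T=\mathbf{XIX}$ and $p\not\equiv 1\pmod 8$. Moreover, in case (6) one always has $r=0$.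
   Context: Convention: for a perfect square $n\in\mathbb{Z}$, $\sqrt n$ denotes the square root with $\sqrt n\equiv 1\pmod 4$ if $n$ is odd, and $\sqrt n\ge 0$ if $n$ is even. Let $f(n)=18+2\log_2 n$ if $n<2^{96}$ and $f(n)=435+10\log_2 n$ if $n\ge 2^{96}$. Let $p\ge 29$ be a prime. A pair $(E,E')$ of elliptic curves over $\mathbb{Q}$ is of type $T$ if $E: y^2=x^3+ax^2+bx$ and $E': y^2=x^3-2ax^2+(a^2-4b)x$ (these are $2$-isogenous), where $\beta\in\mathbb{Z}$ is a perfect square, $\alpha=\sqrt\beta$, the integers $\beta,a,b,k$ are as in the list below for $T$, $E(\mathbb{Q})[2]\simeq E'(\mathbb{Q})[2]\simeq\mathbb{Z}/2$, and $E,E'$ have conductor $2^mp$ with $m$ one of the listed values. I: $\beta=p-2^k$, $b=-2^{k-2}$, and either $a=\alpha$ with $k\in\{2,4,5\}$ or $a=-\alpha$ with $k\in\{2,3\}$; $m\in\{2,3,4,5\}$. II: $\beta=p+2^k$, $b=2^{k-2}$, and either $a=\alpha$ with $k\in\{3,5\}$ or $a=-\alpha$ with $k=3$; $m\in\{3,5\}$. III: $\beta=p-2^k$, $a=-\alpha$, $b=-2^{k-2}$, $4\le k\le f(p)$; $m=4$. IV: $\beta=p+2^k$, $a=-\alpha$, $b=2^{k-2}$, $4\le k\le f(p)$; $m=4$. V: $\beta=2^k-p$, $a=-\alpha$, $b=2^{k-2}$, $4\le k\le f(p)$; $m=4$. VI: $\beta=p-1$, $a=\pm2\alpha$, $b=-1$;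 $m=5$. VII: $\beta=p-1$, $a=\pm2\alpha$, $b=p$; $m=6$. VIII: $\beta=p-2^k$, $a=\pm2\alpha$, $b=-2^k$, $2\le k\le f(p)$; $m=6$. IX: $\beta=p+2^k$, $a=\pm2\alpha$, $b=2^k$, $2\le k\le f(p)$; $m=6$. X: $\beta=2^k-p$, $a=\pm2\alpha$, $b=2^k$, $2\le k\le f(p)$; $m=6$. XI: $\beta=2p^k-1$, $a=\pm2\alpha$, $b=-1$, $k\in\{1,2\}$; $m=7$. XII: $\beta=2p^k-1$, $a=\pm2\alpha$, $b=2p^k$, $k\in\{1,2\}$; $m=7$. XIII: $\beta=p^k+2$, $a=\pm2\alpha$, $b=p^k$, $1\le k\le164969$; $m=7$. XIV: $\beta=p^k+2$, $a=\pm2\alpha$, $b=2$, $1\le k\le164969$; $m=7$. XV: $\beta=p-2$, $a=\pm2\alpha$, $b=p$; $m=7$. XVI: $\beta=p-2$, $a=\pm2\alpha$, $b=-2$; $m=7$. XVII: $\beta=(p^k-1)/2$, $a=\pm4\alpha$, $b=-2$, $k\in\{1,2\}$; $m=8$. XVIII: $\beta=(p^k-1)/2$, $a=\pm4\alpha$, $b=2p^k$, $k\in\{1,2\}$; $m=8$. XIX: $\beta=(p^k+1)/2$, $a=\pm4\alpha$, $b=2$, $k\in\{1,2\}$; $m=8$. XX: $\beta=(p^k+1)/2$, $a=\pm4\alpha$, $b=2p^k$, $k\in\{1,2\}$; $m=8$. *)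

theory Defs
  imports
    "HOL-Algebra.Elementary_Groups"
    "HOL-Algebra.Ideal_Product"
    "HOL-Algebra.Generated_Fields"
    "HOL-Algebra.Algebraic_Closure_Type"
    "HOL-Number_Theory.Cong"
    "HOL-Library.Extended_Nat"
    Complex_Main
begin

section \<open>Elliptic curves and their groups of points\<close>

text \<open>\<open>Weierstrass a1 a2 a3 a4 a6\<close> is the equation
  \<open>y^2 + a1 x y + a3 y = x^3 + a2 x^2 + a4 x + a6\<close>.  Since it is a datatype, base change along a
  map of fields is \<open>map_weierstrass\<close>.\<close>

datatype 'a weierstrass =
  Weierstrass (wa1: 'a) (wa2: 'a) (wa3: 'a) (wa4: 'a) (wa6: 'a)

datatype 'a point = Infinity | Affine 'a 'a

definition wb2 :: "'a::field weierstrass \<Rightarrow> 'a" where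
  "wb2 W = wa1 W ^ 2 + 4 * wa2 W"

definition wb4 :: "'a::field weierstrass \<Rightarrow> 'a" where
  "wb4 W = 2 * wa4 W + wa1 W * wa3 W"

definition wb6 :: "'a::field weierstrass \<Rightarrow> 'a" where
  "wb6 W = wa3 W ^ 2 + 4 * wa6 W"

definition wb8 :: "'a::field weierstrass \<Rightarrow> 'a" where
  "wb8 W = wa1 W ^ 2 * wa6 W + 4 * wa2 W * wa6 W - wa1 W * wa3 W * wa4 W
         + wa2 W * wa3 W ^ 2 - wa4 W ^ 2"

definition wc4 :: "'a::field weierstrass \<Rightarrow> 'a" where
  "wc4 W = wb2 W ^ 2 - 24 * wb4 W"

definition wdisc :: "'a::field weierstrass \<Rightarrow> 'a" where
  "wdisc W = - (wb2 W ^ 2 * wb8 W) - 8 * wb4 W ^ 3 - 27 * wb6 W ^ 2 + 9 * wb2 W * wb4 W * wb6 W"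

definition elliptic_curve :: "'a::field weierstrass \<Rightarrow> bool" where
  "elliptic_curve W \<longleftrightarrow> wdisc W \<noteq> 0"

fun on_curve :: "'a::field weierstrass \<Rightarrow> 'a point \<Rightarrow> bool" where
  "on_curve W Infinity \<longleftrightarrow> True"
| "on_curve W (Affine x y) \<longleftrightarrow>
     y ^ 2 + wa1 W * x * y + wa3 W * y = x ^ 3 + wa2 W * x ^ 2 + wa4 W * x + wa6 W"

text \<open>The chord--tangent law; \<open>l\<close> is the slope of the chord or of the tangent.\<close>

fun point_add :: "'a::field weierstrass \<Rightarrow> 'a point \<Rightarrow> 'a point \<Rightarrow> 'a point" where
  "point_add W Infinity Q = Q"
| "point_add W P Infinity = P"
| "point_add W (Affine x1 y1) (Affine x2 y2) =
     (if x1 = x2 \<and> y1 + y2 + wa1 W * x2 + wa3 W = 0 then Infinity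
      else
        let l = (if x1 = x2
                 then (3 * x1 ^ 2 + 2 * wa2 W * x1 + wa4 W - wa1 W * y1)
                        / (2 * y1 + wa1 W * x1 + wa3 W)
                 else (y2 - y1) / (x2 - x1));
            x3 = l ^ 2 + wa1 W * l - wa2 W - x1 - x2;
            y3 = - (l * (x3 - x1) + y1) - wa1 W * x3 - wa3 W
        in Affine x3 y3)"

definition point_group :: "'a::field weierstrass \<Rightarrow> 'a point monoid" where
  "point_group W = \<lparr>carrier = {P. on_curve W P}, monoid.mult = point_add W, one = Infinity\<rparr>"

definition torsion_points :: "nat \<Rightarrow> 'a::field weierstrass \<Rightarrow> 'a point set" where
  "torsion_points n W =
     {P \<in> carrier (point_group W). P [^]\<^bsub>point_group W\<^esub> n = \<one>\<^bsub>point_group W\<^esub>}"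

section \<open>The rank of an abelian group\<close>

text \<open>The rank is the dimension of the tensor product with the rationals, i.e. the largest number of
  elements that are linearly independent over the integers (infinite if there is no bound).\<close>

definition int_independent :: "('a, 'b) monoid_scheme \<Rightarrow> 'a set \<Rightarrow> bool" where
  "int_independent G S \<longleftrightarrow>
     (\<forall>c :: 'a \<Rightarrow> int. (\<Otimes>\<^bsub>G\<^esub>x\<in>S. x [^]\<^bsub>G\<^esub> c x) = \<one>\<^bsub>G\<^esub> \<longrightarrow> (\<forall>x\<in>S. c x = 0))"

definition group_rank :: "('a, 'b) monoid_scheme \<Rightarrow> enat" where
  "group_rank G =
     (SUP S \<in> {S. finite S \<and> S \<subseteq> carrier G \<and> int_independent G S}. enat (card S))"

section \<open>The conductor of an elliptic curve over the rationals\<close>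

text \<open>The exponent of the conductor at a prime \<open>q\<close> is \<open>\<epsilon> + \<delta>\<close> (Silverman, Advanced Topics in the
  Arithmetic of Elliptic Curves, IV.10): the tame part \<open>\<epsilon>\<close> is 0, 1 or 2 according as the reduction
  at \<open>q\<close> is good, multiplicative or additive, and the wild part \<open>\<delta>\<close> is computed from the action
  of the higher ramification groups on the \<open>l\<close>-torsion for an auxiliary prime \<open>l \<noteq> q\<close>.\<close>

subsection \<open>Minimal models and reduction\<close>

text \<open>The substitution \<open>x = u^2 x' + r\<close>, \<open>y = u^3 y' + u^2 s x' + t\<close>.\<close>

definition change_variables :: "'a::field \<Rightarrow> 'a \<Rightarrow> 'a \<Rightarrow> 'a \<Rightarrow> 'a weierstrass \<Rightarrow> 'a weierstrass" where
  "change_variables u r s t W =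
     Weierstrass
       ((wa1 W + 2 * s) / u)
       ((wa2 W - s * wa1 W + 3 * r - s ^ 2) / u ^ 2)
       ((wa3 W + r * wa1 W + 2 * t) / u ^ 3)
       ((wa4 W - s * wa3 W + 2 * r * wa2 W - (t + r * s) * wa1 W + 3 * r ^ 2 - 2 * s * t) / u ^ 4)
       ((wa6 W + r * wa4 W + r ^ 2 * wa2 W + r ^ 3 - t * wa3 W - t ^ 2 - r * t * wa1 W) / u ^ 6)"

definition isomorphic_curves :: "'a::field weierstrass \<Rightarrow> 'a weierstrass \<Rightarrow> bool" where
  "isomorphic_curves W W' \<longleftrightarrow> (\<exists>u r s t. u \<noteq> 0 \<and> W' = change_variables u r s t W)"

definition integral_at :: "nat \<Rightarrow> rat weierstrass \<Rightarrow> bool" where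
  "integral_at q W \<longleftrightarrow> (\<forall>c \<in> set_weierstrass W. \<not> int q dvd snd (quotient_of c))"

text \<open>For a \<open>q\<close>-integral rational number, its \<open>q\<close>-adic valuation is that of its numerator.\<close>

definition disc_valuation :: "nat \<Rightarrow> rat weierstrass \<Rightarrow> nat" where
  "disc_valuation q W = multiplicity (int q) (fst (quotient_of (wdisc W)))"

definition minimal_model_at :: "nat \<Rightarrow> rat weierstrass \<Rightarrow> rat weierstrass \<Rightarrow> bool" where
  "minimal_model_at q W M \<longleftrightarrow>
     isomorphic_curves W M \<and> integral_at q M \<and>
     (\<forall>W'. isomorphic_curves W W' \<and> integral_at q W' \<longrightarrow> disc_valuation q M \<le> disc_valuation q W')"

definition good_reduction :: "nat \<Rightarrow> rat weierstrass \<Rightarrow> bool" where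
  "good_reduction q W \<longleftrightarrow>
     (\<exists>M. minimal_model_at q W M \<and> \<not> int q dvd fst (quotient_of (wdisc M)))"

text \<open>The reduced equation has a node iff its discriminant vanishes and its \<open>c4\<close> does not; this is
  valid in every characteristic.\<close>

definition multiplicative_reduction :: "nat \<Rightarrow> rat weierstrass \<Rightarrow> bool" where
  "multiplicative_reduction q W \<longleftrightarrow>
     (\<exists>M. minimal_model_at q W M \<and> int q dvd fst (quotient_of (wdisc M)) \<and>
          \<not> int q dvd fst (quotient_of (wc4 M)))"

definition tame_exponent :: "nat \<Rightarrow> rat weierstrass \<Rightarrow> nat" where
  "tame_exponent q W =
     (if good_reduction q W then 0 else if multiplicative_reduction q W then 1 else 2)"

subsection \<open>Ramification groups of the \<open>l\<close>-torsion field\<close>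

abbreviation complex_ring :: "complex ring" where
  "complex_ring \<equiv> ring_of_type_algebra"

definition complex_torsion :: "nat \<Rightarrow> rat weierstrass \<Rightarrow> complex point set" where
  "complex_torsion l W = torsion_points l (map_weierstrass of_rat W)"

definition torsion_field :: "nat \<Rightarrow> rat weierstrass \<Rightarrow> complex set" where
  "torsion_field l W = generate_field complex_ring (\<Union>P \<in> complex_torsion l W. set_point P)"

definition integer_ring :: "complex set \<Rightarrow> complex ring" where
  "integer_ring L = complex_ring\<lparr>carrier := {x \<in> L. algebraic_int x}\<rparr>"

text \<open>Extensionality makes an automorphism of \<open>L\<close> a single HOL function, so that groups of
  automorphisms have the right cardinality.\<close>

definition field_automorphisms :: "complex set \<Rightarrow> (complex \<Rightarrow> complex) set" where
  "field_automorphisms L =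
     ring_iso (complex_ring\<lparr>carrier := L\<rparr>) (complex_ring\<lparr>carrier := L\<rparr>) \<inter> extensional L"

text \<open>The \<open>i\<close>-th ramification group (lower numbering) at the prime ideal \<open>P\<close>; the power
  \<open>P^(i+1)\<close> is taken in the monoid of ideals.  For \<open>i = 0\<close> this is the inertia group.\<close>

definition ramification_group ::
    "complex set \<Rightarrow> complex set \<Rightarrow> nat \<Rightarrow> (complex \<Rightarrow> complex) set" where
  "ramification_group L P i =
     {\<sigma> \<in> field_automorphisms L. \<forall>x \<in> carrier (integer_ring L).
        \<sigma> x - x \<in> P [^]\<^bsub>ideals_set (integer_ring L)\<^esub> Suc i}"

text \<open>All prime ideals over \<open>q\<close> are conjugate, so the choice does not matter below.\<close>

definition prime_over :: "nat \<Rightarrow> complex set \<Rightarrow> complex set" where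
  "prime_over q L = (SOME P. primeideal P (integer_ring L) \<and> of_nat q \<in> P)"

definition torsion_inertia :: "nat \<Rightarrow> nat \<Rightarrow> rat weierstrass \<Rightarrow> nat \<Rightarrow> (complex \<Rightarrow> complex) set" where
  "torsion_inertia q l W i =
     ramification_group (torsion_field l W) (prime_over q (torsion_field l W)) i"

definition fixed_torsion :: "nat \<Rightarrow> nat \<Rightarrow> rat weierstrass \<Rightarrow> nat \<Rightarrow> complex point set" where
  "fixed_torsion q l W i =
     {P \<in> complex_torsion l W. \<forall>\<sigma> \<in> torsion_inertia q l W i. map_point \<sigma> P = P}"

text \<open>This is \<open>\<delta> = \<Sum>i\<ge>1. (g_i / g_0) * dim (E[l] / E[l]^(G_i))\<close>, where \<open>g_i\<close> is the order of the
  \<open>i\<close>-th ramification group \<open>G_i\<close> and the dimension is over the field with \<open>l\<close> elements, read off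
  as the exponent of \<open>l\<close> in the order of the quotient.  Only the indices whose \<open>G_i\<close> acts
  nontrivially contribute; there are finitely many of them.  As \<open>\<delta>\<close> is an integer, the division
  by \<open>g_0\<close> is exact.\<close>

definition wild_exponent :: "nat \<Rightarrow> nat \<Rightarrow> rat weierstrass \<Rightarrow> nat" where
  "wild_exponent q l W =
     (\<Sum>i | 1 \<le> i \<and> fixed_torsion q l W i \<noteq> complex_torsion l W.
        card (torsion_inertia q l W i) *
        multiplicity l (card (complex_torsion l W) div card (fixed_torsion q l W i)))
     div card (torsion_inertia q l W 0)"

text \<open>The value of \<open>\<delta>\<close> is the same for every prime \<open>l \<noteq> q\<close>; we take the smallest one.\<close>

definition conductor_exponent :: "nat \<Rightarrow> rat weierstrass \<Rightarrow> nat" where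
  "conductor_exponent q W = tame_exponent q W + wild_exponent q (if q = 2 then 3 else 2) W"

definition conductor :: "rat weierstrass \<Rightarrow> nat" where
  "conductor W =
     (\<Prod>q | Factorial_Ring.prime q \<and> \<not> good_reduction q W. q ^ conductor_exponent q W)"

section \<open>The pairs of curves of types I to XX\<close>

text \<open>For a perfect square \<open>n\<close>: the root congruent to 1 modulo 4 if \<open>n\<close> is odd, the nonnegative
  root if \<open>n\<close> is even.\<close>

definition signed_sqrt :: "int \<Rightarrow> int" where
  "signed_sqrt n = (THE s. s ^ 2 = n \<and> (if odd n then [s = 1] (mod 4) else 0 \<le> s))"

definition exponent_bound :: "nat \<Rightarrow> real" where
  "exponent_bound n = (if n < 2 ^ 96 then 18 + 2 * log 2 n else 435 + 10 * log 2 n)"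

datatype pair_type =
    Type_I | Type_II | Type_III | Type_IV | Type_V | Type_VI | Type_VII | Type_VIII | Type_IX | Type_X
  | Type_XI | Type_XII | Type_XIII | Type_XIV | Type_XV | Type_XVI | Type_XVII | Type_XVIII
  | Type_XIX | Type_XX

text \<open>The parameter \<open>k\<close> is irrelevant for the types VI, VII, XV and XVI.\<close>

fun type_square :: "pair_type \<Rightarrow> nat \<Rightarrow> nat \<Rightarrow> int" where
  "type_square Type_I p k = int p - 2 ^ k"
| "type_square Type_II p k = int p + 2 ^ k"
| "type_square Type_III p k = int p - 2 ^ k"
| "type_square Type_IV p k = int p + 2 ^ k"
| "type_square Type_V p k = 2 ^ k - int p"
| "type_square Type_VI p k = int p - 1"
| "type_square Type_VII p k = int p - 1"
| "type_square Type_VIII p k = int p - 2 ^ k"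
| "type_square Type_IX p k = int p + 2 ^ k"
| "type_square Type_X p k = 2 ^ k - int p"
| "type_square Type_XI p k = 2 * int p ^ k - 1"
| "type_square Type_XII p k = 2 * int p ^ k - 1"
| "type_square Type_XIII p k = int p ^ k + 2"
| "type_square Type_XIV p k = int p ^ k + 2"
| "type_square Type_XV p k = int p - 2"
| "type_square Type_XVI p k = int p - 2"
| "type_square Type_XVII p k = (int p ^ k - 1) div 2"
| "type_square Type_XVIII p k = (int p ^ k - 1) div 2"
| "type_square Type_XIX p k = (int p ^ k + 1) div 2"
| "type_square Type_XX p k = (int p ^ k + 1) div 2"

text \<open>The divisions by 2 above are exact, because \<open>p\<close> is odd, and the subtractions \<open>k - 2\<close> below do
  not truncate, because \<open>k \<ge> 2\<close> is imposed there.\<close>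

fun type_params :: "pair_type \<Rightarrow> nat \<Rightarrow> nat \<Rightarrow> int \<Rightarrow> int \<Rightarrow> int \<Rightarrow> bool" where
  "type_params Type_I p k \<alpha> a b \<longleftrightarrow>
     b = - (2 ^ (k - 2)) \<and> (a = \<alpha> \<and> k \<in> {2, 4, 5} \<or> a = - \<alpha> \<and> k \<in> {2, 3})"
| "type_params Type_II p k \<alpha> a b \<longleftrightarrow>
     b = 2 ^ (k - 2) \<and> (a = \<alpha> \<and> k \<in> {3, 5} \<or> a = - \<alpha> \<and> k = 3)"
| "type_params Type_III p k \<alpha> a b \<longleftrightarrow>
     a = - \<alpha> \<and> b = - (2 ^ (k - 2)) \<and> 4 \<le> k \<and> k \<le> exponent_bound p"
| "type_params Type_IV p k \<alpha> a b \<longleftrightarrow>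
     a = - \<alpha> \<and> b = 2 ^ (k - 2) \<and> 4 \<le> k \<and> k \<le> exponent_bound p"
| "type_params Type_V p k \<alpha> a b \<longleftrightarrow>
     a = - \<alpha> \<and> b = 2 ^ (k - 2) \<and> 4 \<le> k \<and> k \<le> exponent_bound p"
| "type_params Type_VI p k \<alpha> a b \<longleftrightarrow> a \<in> {2 * \<alpha>, - 2 * \<alpha>} \<and> b = - 1"
| "type_params Type_VII p k \<alpha> a b \<longleftrightarrow> a \<in> {2 * \<alpha>, - 2 * \<alpha>} \<and> b = int p"
| "type_params Type_VIII p k \<alpha> a b \<longleftrightarrow>
     a \<in> {2 * \<alpha>, - 2 * \<alpha>} \<and> b = - (2 ^ k) \<and> 2 \<le> k \<and> k \<le> exponent_bound p"
| "type_params Type_IX p k \<alpha> a b \<longleftrightarrow>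
     a \<in> {2 * \<alpha>, - 2 * \<alpha>} \<and> b = 2 ^ k \<and> 2 \<le> k \<and> k \<le> exponent_bound p"
| "type_params Type_X p k \<alpha> a b \<longleftrightarrow>
     a \<in> {2 * \<alpha>, - 2 * \<alpha>} \<and> b = 2 ^ k \<and> 2 \<le> k \<and> k \<le> exponent_bound p"
| "type_params Type_XI p k \<alpha> a b \<longleftrightarrow> a \<in> {2 * \<alpha>, - 2 * \<alpha>} \<and> b = - 1 \<and> k \<in> {1, 2}"
| "type_params Type_XII p k \<alpha> a b \<longleftrightarrow> a \<in> {2 * \<alpha>, - 2 * \<alpha>} \<and> b = 2 * int p ^ k \<and> k \<in> {1, 2}"
| "type_params Type_XIII p k \<alpha> a b \<longleftrightarrow>
     a \<in> {2 * \<alpha>, - 2 * \<alpha>} \<and> b = int p ^ k \<and> 1 \<le> k \<and> k \<le> 164969"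
| "type_params Type_XIV p k \<alpha> a b \<longleftrightarrow> a \<in> {2 * \<alpha>, - 2 * \<alpha>} \<and> b = 2 \<and> 1 \<le> k \<and> k \<le> 164969"
| "type_params Type_XV p k \<alpha> a b \<longleftrightarrow> a \<in> {2 * \<alpha>, - 2 * \<alpha>} \<and> b = int p"
| "type_params Type_XVI p k \<alpha> a b \<longleftrightarrow> a \<in> {2 * \<alpha>, - 2 * \<alpha>} \<and> b = - 2"
| "type_params Type_XVII p k \<alpha> a b \<longleftrightarrow> a \<in> {4 * \<alpha>, - 4 * \<alpha>} \<and> b = - 2 \<and> k \<in> {1, 2}"
| "type_params Type_XVIII p k \<alpha> a b \<longleftrightarrow> a \<in> {4 * \<alpha>, - 4 * \<alpha>} \<and> b = 2 * int p ^ k \<and> k \<in> {1, 2}"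
| "type_params Type_XIX p k \<alpha> a b \<longleftrightarrow> a \<in> {4 * \<alpha>, - 4 * \<alpha>} \<and> b = 2 \<and> k \<in> {1, 2}"
| "type_params Type_XX p k \<alpha> a b \<longleftrightarrow> a \<in> {4 * \<alpha>, - 4 * \<alpha>} \<and> b = 2 * int p ^ k \<and> k \<in> {1, 2}"

fun type_exponents :: "pair_type \<Rightarrow> nat set" where
  "type_exponents Type_I = {2, 3, 4, 5}"
| "type_exponents Type_II = {3, 5}"
| "type_exponents Type_III = {4}"
| "type_exponents Type_IV = {4}"
| "type_exponents Type_V = {4}"
| "type_exponents Type_VI = {5}"
| "type_exponents Type_VII = {6}"
| "type_exponents Type_VIII = {6}"
| "type_exponents Type_IX = {6}"
| "type_exponents Type_X = {6}"
| "type_exponents Type_XI = {7}"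
| "type_exponents Type_XII = {7}"
| "type_exponents Type_XIII = {7}"
| "type_exponents Type_XIV = {7}"
| "type_exponents Type_XV = {7}"
| "type_exponents Type_XVI = {7}"
| "type_exponents Type_XVII = {8}"
| "type_exponents Type_XVIII = {8}"
| "type_exponents Type_XIX = {8}"
| "type_exponents Type_XX = {8}"

definition two_torsion_curve :: "int \<Rightarrow> int \<Rightarrow> rat weierstrass" where
  "two_torsion_curve a b = Weierstrass 0 (of_int a) 0 (of_int b) 0"

definition pair_of_type ::
    "pair_type \<Rightarrow> nat \<Rightarrow> nat \<Rightarrow> rat weierstrass \<Rightarrow> rat weierstrass \<Rightarrow> bool" where
  "pair_of_type T p k E E' \<longleftrightarrow>
     (\<exists>a b. (\<exists>s. type_square T p k = s ^ 2) \<and>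
        type_params T p k (signed_sqrt (type_square T p k)) a b \<and>
        E = two_torsion_curve a b \<and> E' = two_torsion_curve (- 2 * a) (a ^ 2 - 4 * b)) \<and>
     elliptic_curve E \<and> elliptic_curve E' \<and>
     (point_group E)\<lparr>carrier := torsion_points 2 E\<rparr> \<cong> integer_mod_group 2 \<and>
     (point_group E')\<lparr>carrier := torsion_points 2 E'\<rparr> \<cong> integer_mod_group 2 \<and>
     (\<exists>m \<in> type_exponents T. conductor E = 2 ^ m * p \<and> conductor E' = 2 ^ m * p)"

end

theory Submission
  imports Defs "HOL-Computational_Algebra.Squarefree"
begin

text \<open>Descent via the isogeny \<open>\<phi> : E \<rightarrow> E'\<close> with kernel \<open>{O, (0, 0)}\<close> and its dual \<open>\<psi>\<close>. The abscissa modulo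
  squares embeds \<open>E(\<rat>) / \<psi>(E'(\<rat>))\<close> and \<open>E'(\<rat>) / \<phi>(E(\<rat>))\<close> into \<open>\<rat>\<^sup>* / (\<rat>\<^sup>*)^2\<close>; if their images have
  \<open>n\<close> and \<open>n'\<close> elements, then \<open>2^(r + 2) \<le> n n'\<close>. The classes that occur are products of \<open>-1\<close> and primes
  dividing \<open>b\<close>, respectively \<open>b' = a^2 - 4 b\<close>, so only \<open>-1\<close>, \<open>2\<close> and \<open>p\<close> matter. One of the two images is positive
  because one of the curves has only points with nonnegative abscissa. In the types where this does not yet
  suffice, one more class is excluded since its quartic \<open>d N^2 = d^2 M^4 + a d M^2 e^2 + b e^4\<close> has
  no solution modulo a power of 2.\<close>

section \<open>The group law\<close>

text \<open>Finite images of the abscissa maps do not by themselves bound a rank defined as a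
  supremum over finite independent sets: the additive group of the rationals has rank 1, although
  doubling is surjective on it. Finite generation is therefore proved as well, by infinite descent
  on the height of the abscissa, the two isogenies supplying the estimate for doubling. Once an
  independent set is enlarged to one that spans a subgroup of finite index, only finite groups have
  to be counted. The exponent r + 2 comes from kernels: those of the two induced maps have at least
  2^(r + 1) and 2 elements, the latter because (0, 0) on E' is not in the image of \<phi> when E has
  a single point of order 2. An excluded class halves an image because the classes that occur form a
  group; n n' \<le> 8 yields r \<le> 1 and n n' \<le> 4 yields r = 0. All this presupposes that the
  points form an abelian group; associativity is deduced from the uniqueness of a parabola through
  given points.\<close>

lemmas ring_simps = algebra_simps power2_eq_square power3_eq_cube

abbreviation curve :: "'a::field \<Rightarrow> 'a \<Rightarrow> 'a weierstrass" where
  "curve a b \<equiv> Weierstrass 0 a 0 b 0"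

fun opposite :: "'a::field point \<Rightarrow> 'a point" where
  "opposite Infinity = Infinity"
| "opposite (Affine x y) = Affine x (- y)"

text \<open>The Vieta relations of x^3 + a x^2 + b x - (l x + n)^2 = (x - x1) (x - x2) (x - x3): the
  line y = l x + n meets the cubic at these abscissas, counted with multiplicity. Tangents and
  coinciding points are thus included, and no quotient occurs.\<close>

definition secant :: "'a::field \<Rightarrow> 'a \<Rightarrow> 'a \<Rightarrow> 'a \<Rightarrow> 'a \<Rightarrow> 'a \<Rightarrow> 'a \<Rightarrow> bool" where
  "secant a b l n x1 x2 x3 \<longleftrightarrow>
     l ^ 2 = a + x1 + x2 + x3 \<and> b - 2 * l * n = x1 * x2 + x1 * x3 + x2 * x3 \<and> n ^ 2 = x1 * x2 * x3"

section \<open>Lines meeting the cubic, and sums of points\<close>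

locale nonsingular_cubic =
  fixes a b :: "'a::field_char_0"
  assumes b_nonzero: "b \<noteq> 0" and disc_nonzero: "a ^ 2 - 4 * b \<noteq> 0"
begin

abbreviation pt where "pt \<equiv> on_curve (curve a b)"
abbreviation padd (infixl "\<boxplus>" 65) where "P \<boxplus> Q \<equiv> point_add (curve a b) P Q"
abbreviation sec where "sec \<equiv> secant a b"

lemma on_curve_opposite [simp]: "pt (opposite P) \<longleftrightarrow> pt P"
  by (cases P) auto

lemma opposite_opposite [simp]: "opposite (opposite P) = (P :: 'a point)"
  by (cases P) auto

text \<open>0 is a simple root because \<open>b\<close> is nonzero; a nonzero double root would be a
  double root of the factor x^2 + a x + b, whose discriminant is nonzero.\<close>

lemma root_simple:
  assumes "x ^ 3 + a * x ^ 2 + b * x = 0" "3 * x ^ 2 + 2 * a * x + b = 0"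
  shows False
proof -
  have "x \<noteq> 0" using assms(2) b_nonzero by auto
  moreover have "x * (x ^ 2 + a * x + b) = 0" using assms(1) by (simp add: ring_simps)
  ultimately have q: "x ^ 2 + a * x + b = 0" by simp
  have "x * (2 * x + a) = (3 * x ^ 2 + 2 * a * x + b) - (x ^ 2 + a * x + b)"
    by (simp add: ring_simps)
  then have "x * (2 * x + a) = 0" using assms(2) q by simp
  with \<open>x \<noteq> 0\<close> have a: "a = - 2 * x" by (simp add: eq_neg_iff_add_eq_0 add.commute)
  have "b = x ^ 2" using q a by (simp add: ring_simps)
  with a have "a ^ 2 - 4 * b = 0" by (simp add: ring_simps)
  with disc_nonzero show False ..
qed

lemma sec_cubic:
  assumes "sec l n x1 x2 x3"
  shows "(l * x + n) ^ 2 - (x ^ 3 + a * x ^ 2 + b * x) = - (x - x1) * (x - x2) * (x - x3)"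
proof -
  have "(l * x + n) ^ 2 - (x ^ 3 + a * x ^ 2 + b * x) =
      l ^ 2 * x ^ 2 - (b - 2 * l * n) * x + n ^ 2 - x ^ 3 - a * x ^ 2"
    by (simp add: ring_simps)
  also have "\<dots> = - (x - x1) * (x - x2) * (x - x3)"
    using assms unfolding secant_def by (simp add: ring_simps)
  finally show ?thesis .
qed

lemma sec_on_curve:
  assumes "sec l n x1 x2 x3"
  shows "(l * x1 + n) ^ 2 = x1 ^ 3 + a * x1 ^ 2 + b * x1"
    "(l * x2 + n) ^ 2 = x2 ^ 3 + a * x2 ^ 2 + b * x2"
    "(l * x3 + n) ^ 2 = x3 ^ 3 + a * x3 ^ 2 + b * x3"
  using sec_cubic[OF assms, of x1] sec_cubic[OF assms, of x2] sec_cubic[OF assms, of x3] by simp_all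

lemma sec_perm:
  assumes "sec l n x1 x2 x3"
  shows "sec l n x1 x3 x2" "sec l n x2 x1 x3" "sec l n x3 x2 x1"
  using assms unfolding secant_def by (simp_all add: ac_simps)

lemma sec_neg: "sec l n x1 x2 x3 \<Longrightarrow> sec (- l) (- n) x1 x2 x3"
  unfolding secant_def by simp

text \<open>A double intersection means tangency. The relation is implicit differentiation of the
  curve equation, obtained here from the first two Vieta relations.\<close>

lemma sec_tangent:
  assumes "sec l n x x x3"
  shows "2 * l * (l * x + n) = 3 * x ^ 2 + 2 * a * x + b"
proof -
  have "2 * l * (l * x + n) - (3 * x ^ 2 + 2 * a * x + b) =
      2 * x * (l ^ 2 - (a + x + x + x3)) - (b - 2 * l * n - (x * x + x * x3 + x * x3))"
    by (simp add: ring_simps)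
  then show ?thesis using assms unfolding secant_def by simp
qed

text \<open>A vanishing ordinate at a double abscissa would make it a common zero of the cubic and
  its derivative. This fact excludes the degenerate cases both in cancellation and in the additivity
  of the isogeny.\<close>

lemma sec_double_nonzero:
  assumes "sec l n x x x3"
  shows "l * x + n \<noteq> 0"
proof
  assume 0: "l * x + n = 0"
  show False
    using root_simple[of x] sec_tangent[OF assms] sec_on_curve(1)[OF assms] 0 by simp
qed

text \<open>Translates the chord and tangent formula into the Vieta relations, through which later
  arguments handle the sum of two points that are not opposite.\<close>

lemma add_secantE:
  assumes "pt (Affine x1 y1)" "pt (Affine x2 y2)"
    and "\<not> (x1 = x2 \<and> y1 + y2 = 0)"
  obtains l n x3 where "sec l n x1 x2 x3" "y1 = l * x1 + n" "y2 = l * x2 + n"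
    "Affine x1 y1 \<boxplus> Affine x2 y2 = Affine x3 (- (l * x3 + n))"
proof -
  have c1: "y1 ^ 2 = x1 ^ 3 + a * x1 ^ 2 + b * x1" and c2: "y2 ^ 2 = x2 ^ 3 + a * x2 ^ 2 + b * x2"
    using assms by auto
  define l where "l = (if x1 = x2 then (3 * x1 ^ 2 + 2 * a * x1 + b) / (2 * y1)
                 else (y2 - y1) / (x2 - x1))"
  define n where "n = y1 - l * x1"
  define x3 where "x3 = l ^ 2 - a - x1 - x2"
  have y1: "y1 = l * x1 + n" by (simp add: n_def)
  have y2: "y2 = l * x2 + n"
  proof (cases "x1 = x2")
    case True
    have "(y1 - y2) * (y1 + y2) = 0" using c1 c2 True by (simp add: algebra_simps power2_eq_square)
    with assms(3) True have "y1 = y2" by auto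
    with True y1 show ?thesis by simp
  next
    case False
    then show ?thesis by (simp add: n_def l_def divide_simps) (simp add: algebra_simps)
  qed
  have s: "sec l n x1 x2 x3"
  proof (cases "x1 = x2")
    case True
    then have "y1 = y2" using y1 y2 by simp
    then have "y1 \<noteq> 0" using assms(3) True by auto
    then have "2 * l * y1 = 3 * x1 ^ 2 + 2 * a * x1 + b" using True by (simp add: l_def)
    then have t: "2 * l * y1 - (3 * x1 ^ 2 + 2 * a * x1 + b) = 0" by simp
    have "b - 2 * l * n - (x1 * x1 + x1 * x3 + x1 * x3) =
        - (2 * l * y1 - (3 * x1 ^ 2 + 2 * a * x1 + b))"
      by (simp add: ring_simps n_def x3_def True[symmetric])
    moreover have "n ^ 2 - x1 * x1 * x3 =
        (y1 ^ 2 - (x1 ^ 3 + a * x1 ^ 2 + b * x1)) - x1 * (2 * l * y1 - (3 * x1 ^ 2 + 2 * a * x1 + b))"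
      by (simp add: ring_simps n_def x3_def True[symmetric])
    ultimately have "b - 2 * l * n = x1 * x1 + x1 * x3 + x1 * x3" "n ^ 2 = x1 * x1 * x3"
      using c1 t by simp_all
    then show ?thesis unfolding secant_def using True by (simp add: x3_def)
  next
    case False
    \<comment> \<open>The difference of the two curve equations is x2 - x1 times the second Vieta
      relation.\<close>
    have "(x2 - x1) * (b - 2 * l * n - (x1 * x2 + x1 * x3 + x2 * x3)) =
       ((l * x1 + n) ^ 2 - (x1 ^ 3 + a * x1 ^ 2 + b * x1)) - ((l * x2 + n) ^ 2 - (x2 ^ 3 + a * x2 ^ 2 + b * x2))"
      unfolding x3_def by (simp add: ring_simps)
    then have e2: "b - 2 * l * n - (x1 * x2 + x1 * x3 + x2 * x3) = 0"
      using False c1 c2 y1 y2 by simp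
    have "n ^ 2 - x1 * x2 * x3 = ((l * x1 + n) ^ 2 - (x1 ^ 3 + a * x1 ^ 2 + b * x1))
        + x1 * (b - 2 * l * n - (x1 * x2 + x1 * x3 + x2 * x3))"
      unfolding x3_def by (simp add: ring_simps)
    then have "n ^ 2 - x1 * x2 * x3 = 0" using e2 c1 y1 by simp
    with e2 show ?thesis unfolding secant_def by (simp add: x3_def)
  qed
  have "Affine x1 y1 \<boxplus> Affine x2 y2 = Affine x3 (- (l * x3 + n))"
  proof -
    let ?W = "curve a b"
    have slope: "(if x1 = x2 then (3 * x1 ^ 2 + 2 * wa2 ?W * x1 + wa4 ?W - wa1 ?W * y1)
        / (2 * y1 + wa1 ?W * x1 + wa3 ?W) else (y2 - y1) / (x2 - x1)) = l"
      by (simp add: l_def)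
    have "\<not> (x1 = x2 \<and> y1 + y2 + wa1 ?W * x2 + wa3 ?W = 0)" using assms(3) by simp
    then show ?thesis unfolding point_add.simps slope Let_def
      by (simp add: x3_def n_def algebra_simps)
  qed
  with s y1 y2 show ?thesis by (rule that)
qed

text \<open>A line with the Vieta relations is the one used by the addition formula: its slope is
  determined, by the chord if the abscissas differ and by tangency at a point of nonzero ordinate
  otherwise.\<close>

lemma add_secant:
  assumes s: "sec l n x1 x2 x3" and y: "y1 = l * x1 + n" "y2 = l * x2 + n"
    and no: "\<not> (x1 = x2 \<and> y1 + y2 = 0)"
  shows "Affine x1 y1 \<boxplus> Affine x2 y2 = Affine x3 (- (l * x3 + n))"
proof -
  have "pt (Affine x1 y1)" "pt (Affine x2 y2)"
    using sec_on_curve[OF s] y by auto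
  then obtain l' n' x3' where *: "sec l' n' x1 x2 x3'" "y1 = l' * x1 + n'" "y2 = l' * x2 + n'"
    "Affine x1 y1 \<boxplus> Affine x2 y2 = Affine x3' (- (l' * x3' + n'))"
    using no by (rule add_secantE)
  have "l' = l"
  proof (cases "x1 = x2")
    case True
    then have "2 * y1 \<noteq> 0" using no y by auto
    moreover have "2 * l' * y1 = 2 * l * y1"
      using sec_tangent[of l n x1 x3] sec_tangent[of l' n' x1 x3'] s *(1) True *(2) y(1) by simp
    ultimately show ?thesis by simp
  next
    case False
    have "l' * (x1 - x2) = y1 - y2" using *(2,3) by (simp add: algebra_simps)
    also have "\<dots> = l * (x1 - x2)" using y by (simp add: algebra_simps)
    finally show ?thesis using False by simp
  qed
  moreover have "n' = n" using * y \<open>l' = l\<close> by simp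
  moreover have "x3' = x3" using *(1) s \<open>l' = l\<close> unfolding secant_def by simp
  ultimately show ?thesis using * by simp
qed

lemma add_Infinity [simp]: "Infinity \<boxplus> P = P" "P \<boxplus> Infinity = P"
  by (cases P; simp)+

lemma add_closed:
  assumes "pt P" "pt Q"
  shows "pt (P \<boxplus> Q)"
proof -
  consider "P = Infinity \<or> Q = Infinity" | x1 y1 x2 y2 where "P = Affine x1 y1" "Q = Affine x2 y2"
    by (cases P; cases Q) auto
  then show ?thesis
  proof cases
    case 1
    then show ?thesis using assms by auto
  next
    case 2
    show ?thesis
    proof (cases "x1 = x2 \<and> y1 + y2 = 0")
      case True
      then show ?thesis using 2 by simp
    next
      case False
      from assms False obtain l n x3 where *: "sec l n x1 x2 x3" "P \<boxplus> Q = Affine x3 (- (l * x3 + n))"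
        unfolding 2 by (rule add_secantE)
      then show ?thesis using sec_on_curve(3)[OF *(1)] unfolding *(2)
        by (simp only: power2_minus on_curve.simps weierstrass.sel mult_zero_left add_0_right)
    qed
  qed
qed

lemma add_opposite [simp]: "P \<boxplus> opposite P = Infinity" "opposite P \<boxplus> P = Infinity"
  by (cases P; simp)+

lemma add_commute:
  assumes "pt P" "pt Q"
  shows "P \<boxplus> Q = Q \<boxplus> P"
proof -
  consider "P = Infinity \<or> Q = Infinity" | x1 y1 x2 y2 where "P = Affine x1 y1" "Q = Affine x2 y2"
    by (cases P; cases Q) auto
  then show ?thesis
  proof cases
    case 1
    then show ?thesis using assms by auto
  next
    case 2
    show ?thesis
    proof (cases "x1 = x2 \<and> y1 + y2 = 0")
      case True
      then show ?thesis using 2 by (simp add: add.commute)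
    next
      case False
      from assms False obtain l n x3 where *: "sec l n x1 x2 x3" "y1 = l * x1 + n" "y2 = l * x2 + n"
          "P \<boxplus> Q = Affine x3 (- (l * x3 + n))"
        unfolding 2 by (rule add_secantE)
      have "Q \<boxplus> P = Affine x3 (- (l * x3 + n))" unfolding 2
        by (rule add_secant[OF sec_perm(2)[OF *(1)] *(3,2)]) (use False in \<open>auto simp: add.commute\<close>)
      then show ?thesis using *(4) by simp
    qed
  qed
qed

lemma opposite_add:
  assumes "pt P" "pt Q"
  shows "opposite (P \<boxplus> Q) = opposite P \<boxplus> opposite Q"
proof -
  consider "P = Infinity \<or> Q = Infinity" | x1 y1 x2 y2 where "P = Affine x1 y1" "Q = Affine x2 y2"
    by (cases P; cases Q) auto
  then show ?thesis
  proof cases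
    case 1
    then show ?thesis using assms by auto
  next
    case 2
    show ?thesis
    proof (cases "x1 = x2 \<and> y1 + y2 = 0")
      case True
      then show ?thesis using 2 by (simp add: minus_unique)
    next
      case False
      from assms False obtain l n x3 where *: "sec l n x1 x2 x3" "y1 = l * x1 + n" "y2 = l * x2 + n"
          "P \<boxplus> Q = Affine x3 (- (l * x3 + n))"
        unfolding 2 by (rule add_secantE)
      have "opposite P \<boxplus> opposite Q = Affine x3 (- (- l * x3 + - n))" unfolding 2 opposite.simps
        by (rule add_secant[OF sec_neg[OF *(1)]]) (use False *(2,3) in \<open>auto simp: add_eq_0_iff\<close>)
      then show ?thesis using *(4) by simp
    qed
  qed
qed

section \<open>Cancellation and associativity\<close>

lemma add_cancel:
  assumes P: "pt P" and Q: "pt Q"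
  shows "opposite P \<boxplus> (P \<boxplus> Q) = Q"
proof -
  consider "P = Infinity \<or> Q = Infinity" | "Q = opposite P"
    | x1 y1 x2 y2 where "P = Affine x1 y1" "Q = Affine x2 y2" "\<not> (x1 = x2 \<and> y1 + y2 = 0)"
    by (cases P; cases Q) (auto simp: eq_neg_iff_add_eq_0 add.commute)
  then show ?thesis
  proof cases
    case 3
    obtain l n x3 where *: "sec l n x1 x2 x3" "y1 = l * x1 + n" "y2 = l * x2 + n"
          "P \<boxplus> Q = Affine x3 (- (l * x3 + n))"
      using P Q 3(3) unfolding 3(1,2) by (rule add_secantE)
    \<comment> \<open>The line through P, Q and -(P + Q), reflected in the axis, passes through -P,
      -Q and P + Q.\<close>
    have "Affine x1 (- y1) \<boxplus> Affine x3 (- (l * x3 + n)) = Affine x2 (- (- l * x2 + - n))"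
    proof (rule add_secant[OF sec_neg[OF sec_perm(1)[OF *(1)]]])
      \<comment> \<open>P + Q = P would make x1 a double abscissa of the line with ordinate
        0.\<close>
      show "\<not> (x1 = x3 \<and> - y1 + - (l * x3 + n) = 0)"
      proof
        assume "x1 = x3 \<and> - y1 + - (l * x3 + n) = 0"
        then have x: "x1 = x3" and "- y1 + - (l * x3 + n) = 0" by auto
        then have "2 * (l * x1 + n) = 0" using *(2) unfolding x by (simp add: add_eq_0_iff)
        then have "l * x1 + n = 0" by (metis mult_eq_0_iff zero_neq_numeral)
        with x show False using sec_double_nonzero[of l n x1 x2] sec_perm(1)[OF *(1)] by simp
      qed
    qed (use * in auto)
    then show ?thesis using * 3 by simp
  qed auto
qed

text \<open>The coefficients come from a division: multiply Y - l X - n by Y - m X - k, replace Y^2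
  by the cubic, and divide by X - x0. The condition on \<open>k\<close> says that the second line
  passes through the reflection of (x0, l x0 + n), which makes the division exact. Here the quotient
  is restricted to the first line.\<close>

lemma parabola_aux:
  assumes "sec l n u v x0" "k = - (l + m) * x0 - n"
  shows "T ^ 2 - (l + m) * (l * T + n) + (a + l * m + x0) * T
      + (b + l * k + m * n + x0 * (a + l * m + x0)) = (T - u) * (T - v)"
proof -
  have "T ^ 2 - (l + m) * (l * T + n) + (a + l * m + x0) * T
      + (b + l * k + m * n + x0 * (a + l * m + x0)) - (T - u) * (T - v) =
    (b - 2 * l * n - (u * v + u * x0 + v * x0)) - (T + x0) * (l ^ 2 - (a + u + v + x0))"
    unfolding assms(2) by (simp add: ring_simps)
  then show ?thesis using assms(1) unfolding secant_def by simp
qed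

text \<open>The product of the lines through \<open>P1, P2\<close> and through \<open>P1 + P2, P3\<close>, divided by the vertical
  line through \<open>P1 + P2\<close>, is a parabola \<open>X^2 + \<beta> Y + \<gamma> X + \<delta>\<close> that meets the cubic in \<open>P1, P2, P3\<close>
  and \<open>-(P1 + P2 + P3)\<close>. Associativity holds because this parabola is determined by \<open>P1, P2, P3\<close>.\<close>

lemma parabola:
  assumes s: "sec l n u v x0" and t: "sec m k x0 w z" and y: "m * x0 + k = - (l * x0 + n)"
  obtains \<beta> \<gamma> \<delta> where
    "\<And>T. T ^ 2 + \<beta> * (l * T + n) + \<gamma> * T + \<delta> = (T - u) * (T - v)"
    "\<And>T. T ^ 2 + \<beta> * (m * T + k) + \<gamma> * T + \<delta> = (T - w) * (T - z)"
    "\<beta> = - (l + m)" "\<gamma> = a + l * m + x0" "\<beta> ^ 2 - 2 * \<gamma> = u + v + w + z"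
proof
  define \<beta> \<gamma> \<delta> where "\<beta> = - (l + m)" and "\<gamma> = a + l * m + x0"
    and "\<delta> = b + l * k + m * n + x0 * (a + l * m + x0)"
  have k: "k = - (l + m) * x0 - n" and n: "n = - (m + l) * x0 - k"
    using y by (simp_all add: algebra_simps eq_neg_iff_add_eq_0)
  show "T ^ 2 + - (l + m) * (l * T + n) + (a + l * m + x0) * T + \<delta> = (T - u) * (T - v)" for T
    using parabola_aux[OF s k, of T] unfolding \<delta>_def by (simp only: mult_minus_left diff_conv_add_uminus)
  show "T ^ 2 + - (l + m) * (m * T + k) + (a + l * m + x0) * T + \<delta> = (T - w) * (T - z)" for T
    using parabola_aux[OF sec_perm(1)[OF sec_perm(2)[OF t]] n, of T] unfolding \<delta>_def
    by (simp only: mult_minus_left diff_conv_add_uminus ac_simps)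
  have "(- (l + m)) ^ 2 - 2 * (a + l * m + x0) - (u + v + w + z) =
      (l ^ 2 - (a + u + v + x0)) + (m ^ 2 - (a + x0 + w + z))"
    by (simp add: ring_simps)
  then show "(- (l + m)) ^ 2 - 2 * (a + l * m + x0) = u + v + w + z"
    using s t unfolding secant_def by simp
qed simp_all

text \<open>A line meets the cubic in three points only. This provides the noncollinearity that
  makes the parabola unique.\<close>

lemma on_third_point:
  assumes s: "sec l n x1 x2 x0" and 3: "pt (Affine x3 y3)"
    and "x3 \<noteq> x1" "x3 \<noteq> x2" and "Affine x3 y3 \<noteq> Affine x0 (l * x0 + n)"
  shows "y3 \<noteq> l * x3 + n"
proof
  assume y: "y3 = l * x3 + n"
  have "(l * x3 + n) ^ 2 - (x3 ^ 3 + a * x3 ^ 2 + b * x3) = 0" using 3 y by simp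
  then have "- (x3 - x1) * (x3 - x2) * (x3 - x0) = 0" unfolding sec_cubic[OF s, of x3] .
  moreover have "- (x3 - x1) * (x3 - x2) \<noteq> 0" using assms(3,4) by simp
  ultimately have "x3 = x0" by (metis mult_eq_0_iff right_minus_eq)
  with assms(5) y show False by simp
qed

text \<open>The right-hand side is the left-hand side with the points permuted cyclically, so the
  two parabolas pass through the same three points and coincide. Their fourth intersection with the
  curve is the negative of either sum.\<close>

lemma add_assoc_distinct:
  assumes P: "pt (Affine x1 y1)" and Q: "pt (Affine x2 y2)"
    and R: "pt (Affine x3 y3)"
    and x: "x1 \<noteq> x2" "x1 \<noteq> x3" "x2 \<noteq> x3"
    and PQ: "Affine x1 y1 \<boxplus> Affine x2 y2 \<noteq> opposite (Affine x3 y3)"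
    and QR: "Affine x2 y2 \<boxplus> Affine x3 y3 \<noteq> opposite (Affine x1 y1)"
  shows "(Affine x1 y1 \<boxplus> Affine x2 y2) \<boxplus> Affine x3 y3 = (Affine x2 y2 \<boxplus> Affine x3 y3) \<boxplus> Affine x1 y1"
proof -
  obtain l n x0 where 1: "sec l n x1 x2 x0" "y1 = l * x1 + n" "y2 = l * x2 + n"
      "Affine x1 y1 \<boxplus> Affine x2 y2 = Affine x0 (- (l * x0 + n))"
    using add_secantE[OF P Q] x by blast
  have o1: "pt (Affine x0 (- (l * x0 + n)))" using add_closed[OF P Q] 1(4) by simp
  have "\<not> (x0 = x3 \<and> - (l * x0 + n) + y3 = 0)" using PQ 1(4) by (auto simp: add_eq_0_iff)
  then obtain m k x4 where 2: "sec m k x0 x3 x4" "- (l * x0 + n) = m * x0 + k" "y3 = m * x3 + k"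
    "(Affine x1 y1 \<boxplus> Affine x2 y2) \<boxplus> Affine x3 y3 = Affine x4 (- (m * x4 + k))"
    using add_secantE[OF o1 R] 1(4) by metis
  obtain l' n' x0' where q1: "sec l' n' x2 x3 x0'" "y2 = l' * x2 + n'" "y3 = l' * x3 + n'"
      "Affine x2 y2 \<boxplus> Affine x3 y3 = Affine x0' (- (l' * x0' + n'))"
    using add_secantE[OF Q R] x by blast
  have o1': "pt (Affine x0' (- (l' * x0' + n')))" using add_closed[OF Q R] q1(4) by simp
  have "\<not> (x0' = x1 \<and> - (l' * x0' + n') + y1 = 0)" using QR q1(4) by (auto simp: add_eq_0_iff)
  then obtain m' k' x4' where q2: "sec m' k' x0' x1 x4'" "- (l' * x0' + n') = m' * x0' + k'"
      "y1 = m' * x1 + k'"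
      "(Affine x2 y2 \<boxplus> Affine x3 y3) \<boxplus> Affine x1 y1 = Affine x4' (- (m' * x4' + k'))"
    using add_secantE[OF o1' P] q1(4) by metis
  obtain \<beta> \<gamma> \<delta> where f: "\<And>T. T ^ 2 + \<beta> * (l * T + n) + \<gamma> * T + \<delta> = (T - x1) * (T - x2)"
    "\<And>T. T ^ 2 + \<beta> * (m * T + k) + \<gamma> * T + \<delta> = (T - x3) * (T - x4)" 
    "\<beta> ^ 2 - 2 * \<gamma> = x1 + x2 + x3 + x4"
    using parabola[OF 1(1) 2(1) 2(2)[symmetric]] by metis
  obtain \<beta>' \<gamma>' \<delta>' where f': "\<And>T. T ^ 2 + \<beta>' * (l' * T + n') + \<gamma>' * T + \<delta>' = (T - x2) * (T - x3)"
    "\<And>T. T ^ 2 + \<beta>' * (m' * T + k') + \<gamma>' * T + \<delta>' = (T - x1) * (T - x4')" 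
    "\<beta>' ^ 2 - 2 * \<gamma>' = x2 + x3 + x1 + x4'"
    using parabola[OF q1(1) q2(1) q2(2)[symmetric]] by metis
  have v: "x1 ^ 2 + \<beta> * y1 + \<gamma> * x1 + \<delta> = 0" "x2 ^ 2 + \<beta> * y2 + \<gamma> * x2 + \<delta> = 0"
    "x3 ^ 2 + \<beta> * y3 + \<gamma> * x3 + \<delta> = 0"
    using f(1)[of x1] f(1)[of x2] f(2)[of x3] 1(2,3) 2(3) by simp_all
  have v': "x1 ^ 2 + \<beta>' * y1 + \<gamma>' * x1 + \<delta>' = 0" "x2 ^ 2 + \<beta>' * y2 + \<gamma>' * x2 + \<delta>' = 0"
    "x3 ^ 2 + \<beta>' * y3 + \<gamma>' * x3 + \<delta>' = 0"
    using f'(2)[of x1] f'(1)[of x2] f'(1)[of x3] q1(2,3) q2(3) by simp_all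
  \<comment> \<open>The difference B Y + C X + D of the two parabolas is linear and vanishes at
    three noncollinear points.\<close>
  define B C D where "B = \<beta> - \<beta>'" and "C = \<gamma> - \<gamma>'" and "D = \<delta> - \<delta>'"
  have d: "B * y1 + C * x1 + D = 0" "B * y2 + C * x2 + D = 0" "B * y3 + C * x3 + D = 0"
  proof -
    have lin: "B * Y + C * T + D =
      (T ^ 2 + \<beta> * Y + \<gamma> * T + \<delta>) - (T ^ 2 + \<beta>' * Y + \<gamma>' * T + \<delta>')" for T Y
      by (simp add: B_def C_def D_def algebra_simps)
    show "B * y1 + C * x1 + D = 0" "B * y2 + C * x2 + D = 0" "B * y3 + C * x3 + D = 0"
      by (simp_all only: lin v v' diff_self)
  qed
  have nl: "y3 \<noteq> l * x3 + n"
    by (rule on_third_point[OF 1(1) R]) (use x PQ 1(4) in auto)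
  have e: "(x1 - x2) * (B * l + C) = (B * (l * x1 + n) + C * x1 + D) - (B * (l * x2 + n) + C * x2 + D)"
    by (simp add: algebra_simps)
  have "(x1 - x2) * (B * l + C) = 0" by (simp only: e d(1,2)[unfolded 1(2,3)] diff_self)
  then have C: "B * l + C = 0" using x by simp
  have e': "B * (y3 - (l * x3 + n)) =
      (B * y3 + C * x3 + D) - (B * (l * x1 + n) + C * x1 + D) - (B * l + C) * (x3 - x1)"
    by (simp add: algebra_simps)
  have "B * (y3 - (l * x3 + n)) = 0"
    by (simp only: e' d(3) d(1)[unfolded 1(2)] C diff_self mult_zero_left)
  then have "B = 0" using nl by simp
  moreover from this C have "C = 0" by simp
  ultimately have eq: "\<beta>' = \<beta>" "\<gamma>' = \<gamma>" "\<delta>' = \<delta>" using d(1) by (auto simp: B_def C_def D_def)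
  \<comment> \<open>The fourth abscissa is read off from the sum of all four, which depends on
    \<beta> and \<gamma> only.\<close>
  have x4: "x4' = x4" using f(3) f'(3) eq by (simp add: ac_simps)
  \<comment> \<open>With \<beta> = 0 the parabola would be a quadratic polynomial in X with three
    distinct roots. A nonzero \<beta> allows the ordinate of the fourth point to be
    recovered.\<close>
  have "\<beta> \<noteq> 0"
  proof
    assume "\<beta> = 0"
    with f(2)[of x1] f(2)[of x2] f(2)[of x3] v have e: "(x1 - x3) * (x1 - x4) = 0" "(x2 - x3) * (x2 - x4) = 0"
      by simp_all
    with x show False by auto
  qed
  moreover have "\<beta> * (m * x4 + k) = \<beta> * (m' * x4 + k')"
  proof -
    have "x4 ^ 2 + \<beta> * (m * x4 + k) + \<gamma> * x4 + \<delta> = x4 ^ 2 + \<beta> * (m' * x4 + k') + \<gamma> * x4 + \<delta>"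
      using f(2)[of x4] f'(2)[of x4] unfolding x4 eq by simp
    then show ?thesis by simp
  qed
  ultimately show ?thesis using 2(4) q2(4) x4 by simp
qed

text \<open>Two of the three points coincide, so one vanishing condition on the parabolas is
  replaced by tangency to the curve at that point.\<close>

lemma add_assoc_double:
  assumes P: "pt (Affine x1 y1)" and R: "pt (Affine x3 y3)"
    and y1: "y1 \<noteq> 0" and x: "x1 \<noteq> x3"
    and PP: "Affine x1 y1 \<boxplus> Affine x1 y1 \<noteq> opposite (Affine x3 y3)"
    and PR: "Affine x1 y1 \<boxplus> Affine x3 y3 \<noteq> opposite (Affine x1 y1)"
  shows "(Affine x1 y1 \<boxplus> Affine x1 y1) \<boxplus> Affine x3 y3 = (Affine x1 y1 \<boxplus> Affine x3 y3) \<boxplus> Affine x1 y1"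
proof -
  have "\<not> (x1 = x1 \<and> y1 + y1 = 0)" using y1 by (simp flip: mult_2)
  then obtain l n x0 where 1: "sec l n x1 x1 x0" "y1 = l * x1 + n"
      "Affine x1 y1 \<boxplus> Affine x1 y1 = Affine x0 (- (l * x0 + n))"
    using add_secantE[OF P P] by blast
  have o1: "pt (Affine x0 (- (l * x0 + n)))" using add_closed[OF P P] 1(3) by simp
  have "\<not> (x0 = x3 \<and> - (l * x0 + n) + y3 = 0)" using PP 1(3) by (auto simp: add_eq_0_iff)
  then obtain m k x4 where 2: "sec m k x0 x3 x4" "- (l * x0 + n) = m * x0 + k" "y3 = m * x3 + k"
    "(Affine x1 y1 \<boxplus> Affine x1 y1) \<boxplus> Affine x3 y3 = Affine x4 (- (m * x4 + k))"
    using add_secantE[OF o1 R] 1(3) by metis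
  obtain l' n' x0' where q1: "sec l' n' x1 x3 x0'" "y1 = l' * x1 + n'" "y3 = l' * x3 + n'"
      "Affine x1 y1 \<boxplus> Affine x3 y3 = Affine x0' (- (l' * x0' + n'))"
    using add_secantE[OF P R] x by blast
  have o1': "pt (Affine x0' (- (l' * x0' + n')))" using add_closed[OF P R] q1(4) by simp
  have x0': "x0' \<noteq> x1" using PR q1(2,4) by auto
  then have "\<not> (x0' = x1 \<and> - (l' * x0' + n') + y1 = 0)" by simp
  then obtain m' k' x4' where q2: "sec m' k' x0' x1 x4'" "- (l' * x0' + n') = m' * x0' + k'"
      "y1 = m' * x1 + k'"
      "(Affine x1 y1 \<boxplus> Affine x3 y3) \<boxplus> Affine x1 y1 = Affine x4' (- (m' * x4' + k'))"
    using add_secantE[OF o1' P] q1(4) by metis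
  obtain \<beta> \<gamma> \<delta> where f: "\<And>T. T ^ 2 + \<beta> * (l * T + n) + \<gamma> * T + \<delta> = (T - x1) * (T - x1)"
    "\<And>T. T ^ 2 + \<beta> * (m * T + k) + \<gamma> * T + \<delta> = (T - x3) * (T - x4)" 
    "\<beta> ^ 2 - 2 * \<gamma> = x1 + x1 + x3 + x4"
    using parabola[OF 1(1) 2(1) 2(2)[symmetric]] by metis
  obtain \<beta>' \<gamma>' \<delta>' where f': "\<And>T. T ^ 2 + \<beta>' * (l' * T + n') + \<gamma>' * T + \<delta>' = (T - x1) * (T - x3)"
    "\<And>T. T ^ 2 + \<beta>' * (m' * T + k') + \<gamma>' * T + \<delta>' = (T - x1) * (T - x4')" 
    "\<beta>' ^ 2 - 2 * \<gamma>' = x1 + x3 + x1 + x4'" "\<beta>' = - (l' + m')" "\<gamma>' = a + l' * m' + x0'"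
    using parabola[OF q1(1) q2(1) q2(2)[symmetric]] by metis
  \<comment> \<open>The second parabola is built from two chords through (x1, y1), so its tangency
    there is not visible and has to be computed. Multiplication by d^2 turns the slopes into
    differences of ordinates.\<close>
  have tangent: "2 * x1 + \<beta>' * l + \<gamma>' = 0"
  proof -
    define d where "d = x0' - x1"
    define y0 where "y0 = - (l' * x0' + n')"
    have y0: "l' * x0' + n' = - y0" "m' * x0' + k' = y0"
      by (simp_all only: y0_def q2(2)[symmetric] minus_minus)
    have l': "l' * d = - y0 - y1"
      unfolding y0(1)[symmetric] q1(2) by (simp add: d_def algebra_simps)
    have m': "m' * d = y0 - y1"
      unfolding y0(2)[symmetric] q2(3) by (simp add: d_def algebra_simps)
    have t: "2 * l * y1 = 3 * x1 ^ 2 + 2 * a * x1 + b" using sec_tangent[OF 1(1)] 1(2) by simp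
    have c1: "y1 ^ 2 = x1 ^ 3 + a * x1 ^ 2 + b * x1" and c0: "y0 ^ 2 = x0' ^ 3 + a * x0' ^ 2 + b * x0'"
      using P o1' unfolding y0_def by simp_all
    have "d ^ 2 * (2 * x1 + \<beta>' * l + \<gamma>') =
        d ^ 2 * (2 * x1 + a + x0') + (l' * d) * (m' * d) - l * d * (l' * d + m' * d)"
      unfolding f'(4,5) by (simp add: ring_simps)
    also have "\<dots> = d ^ 2 * (2 * x1 + a + x0') + y1 ^ 2 - y0 ^ 2 + d * (2 * l * y1)"
      unfolding l' m' by (simp add: ring_simps)
    also have "\<dots> = 0" unfolding t c1 c0 d_def by (simp add: ring_simps)
    finally show ?thesis using x0' by (simp add: d_def)
  qed
  have v': "x1 ^ 2 + \<beta>' * y1 + \<gamma>' * x1 + \<delta>' = 0" "x3 ^ 2 + \<beta>' * y3 + \<gamma>' * x3 + \<delta>' = 0"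
    using f'(1)[of x1] f'(1)[of x3] q1(2,3) by simp_all
  have v: "x3 ^ 2 + \<beta> * y3 + \<gamma> * x3 + \<delta> = 0" "x1 ^ 2 + \<beta> * y1 + \<gamma> * x1 + \<delta> = 0"
     using f(2)[of x3] 2(3) f(1)[of x1] 1(2) by simp_all
  \<comment> \<open>For a monic quadratic polynomial, the derivative at x1 is the increment from x1
    to x1 + 1, minus 1.\<close>
  have t2: "2 * x1 + \<beta> * l + \<gamma> = 0"
  proof -
    have "2 * x1 + \<beta> * l + \<gamma> = ((x1 + 1) ^ 2 + \<beta> * (l * (x1 + 1) + n) + \<gamma> * (x1 + 1) + \<delta>)
        - (x1 ^ 2 + \<beta> * (l * x1 + n) + \<gamma> * x1 + \<delta>) - 1"
      by (simp add: ring_simps)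
    then show ?thesis unfolding f(1) by simp
  qed
  define B C D where "B = \<beta> - \<beta>'" and "C = \<gamma> - \<gamma>'" and "D = \<delta> - \<delta>'"
  have C: "B * l + C = 0"
  proof -
    have e: "B * l + C = (2 * x1 + \<beta> * l + \<gamma>) - (2 * x1 + \<beta>' * l + \<gamma>')"
      by (simp add: B_def C_def algebra_simps)
    show ?thesis by (simp only: e tangent t2 diff_self)
  qed
  have d: "B * y1 + C * x1 + D = 0" "B * y3 + C * x3 + D = 0"
  proof -
    have lin: "B * Y + C * T + D = 
      (T ^ 2 + \<beta> * Y + \<gamma> * T + \<delta>) - (T ^ 2 + \<beta>' * Y + \<gamma>' * T + \<delta>')" for T Y
      by (simp add: B_def C_def D_def algebra_simps)
    show "B * y1 + C * x1 + D = 0" "B * y3 + C * x3 + D = 0" by (simp_all only: lin v v' diff_self)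
  qed
  have nl: "y3 \<noteq> l * x3 + n"
    by (rule on_third_point[OF 1(1) R]) (use x PP 1(3) in auto)
  have e': "B * (y3 - (l * x3 + n)) =
      (B * y3 + C * x3 + D) - (B * (l * x1 + n) + C * x1 + D) - (B * l + C) * (x3 - x1)"
    by (simp add: algebra_simps)
  have "B * (y3 - (l * x3 + n)) = 0"
    by (simp only: e' d(2) d(1)[unfolded 1(2)] C diff_self mult_zero_left)
  then have "B = 0" using nl by simp
  moreover from this C have "C = 0" by simp
  ultimately have eq: "\<beta>' = \<beta>" "\<gamma>' = \<gamma>" "\<delta>' = \<delta>" using d(1) by (auto simp: B_def C_def D_def)
  have x4: "x4' = x4" using f(3) f'(3) eq by (simp add: ac_simps)
  have "\<beta> \<noteq> 0"
  proof
    assume "\<beta> = 0"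
    with f(1)[of x3] v have "(x3 - x1) * (x3 - x1) = 0" by simp
    with x show False by auto
  qed
  moreover have "\<beta> * (m * x4 + k) = \<beta> * (m' * x4 + k')"
  proof -
    have "x4 ^ 2 + \<beta> * (m * x4 + k) + \<gamma> * x4 + \<delta> = x4 ^ 2 + \<beta> * (m' * x4 + k') + \<gamma> * x4 + \<delta>"
      using f(2)[of x4] f'(2)[of x4] unfolding x4 eq by simp
    then show ?thesis by simp
  qed
  ultimately show ?thesis using 2(4) q2(4) x4 by simp
qed

lemma add_cancel_right:
  assumes "pt P" "pt Q"
  shows "(Q \<boxplus> P) \<boxplus> opposite P = Q"
  using add_cancel[OF assms] add_commute[of Q P] add_commute[of "Q \<boxplus> P" "opposite P"] assms
  by (simp add: add_closed)

text \<open>Configurations in which points or partial sums are opposite reduce to cancellation, and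
  R = P reduces to commutativity. What remains is the tangent case, in two symmetric forms, and the
  generic one.\<close>

lemma add_assoc:
  assumes P: "pt P" and Q: "pt Q" and R: "pt R"
  shows "(P \<boxplus> Q) \<boxplus> R = P \<boxplus> (Q \<boxplus> R)"
proof -
  note comm = add_commute and cl = add_closed
  have double: "(S \<boxplus> S) \<boxplus> T = (S \<boxplus> T) \<boxplus> S"
    if S: "pt S" and T: "pt T" and
      h: "S \<noteq> Infinity" "T \<noteq> Infinity" "S \<noteq> opposite S" "S \<noteq> T" "S \<noteq> opposite T"
      "S \<boxplus> S \<noteq> opposite T" "S \<boxplus> T \<noteq> opposite S" for S T
  proof -
    obtain x y x' y' where st: "S = Affine x y" "T = Affine x' y'" using h by (cases S; cases T) auto
    have "x \<noteq> x'"
    proof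
      assume "x = x'"
      then have "y ^ 2 = y' ^ 2" using S T st by simp
      then have "y = y' \<or> y = - y'" by (simp add: power2_eq_iff)
      with \<open>x = x'\<close> h st show False by auto
    qed
    moreover have "y \<noteq> 0" using h(3) st by auto
    ultimately show ?thesis using S T h unfolding st by (intro add_assoc_double) auto
  qed
  consider "P = Infinity \<or> Q = Infinity \<or> R = Infinity" | "Q = opposite P" | "R = opposite Q"
    | "P \<boxplus> Q = opposite R" | "Q \<boxplus> R = opposite P" | "R = P" | "R = opposite P"
    | "P = Q" "Q \<noteq> opposite P" "P \<noteq> Infinity" "R \<noteq> Infinity" "R \<noteq> opposite Q" "R \<noteq> P"
        "P \<boxplus> Q \<noteq> opposite R" "Q \<boxplus> R \<noteq> opposite P"
    | "R = Q" "Q \<noteq> opposite P" "P \<noteq> Infinity" "R \<noteq> Infinity" "R \<noteq> opposite Q" "R \<noteq> P"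
        "P \<boxplus> Q \<noteq> opposite R" "Q \<boxplus> R \<noteq> opposite P"
    | "P \<noteq> Infinity" "Q \<noteq> Infinity" "R \<noteq> Infinity" "Q \<noteq> opposite P" "R \<noteq> opposite Q" "R \<noteq> opposite P"
        "P \<noteq> Q" "R \<noteq> Q" "R \<noteq> P"
        "P \<boxplus> Q \<noteq> opposite R" "Q \<boxplus> R \<noteq> opposite P" by blast
  then show ?thesis
  proof cases
    case 1
    then show ?thesis by auto
  next
    case 2
    then show ?thesis using add_cancel[of "opposite P" R] P R by simp
  next
    case 3
    then show ?thesis using add_cancel_right[OF Q P] by simp
  next
    case 4
    then have "R = opposite P \<boxplus> opposite Q" using opposite_add[OF P Q] by simp
    then have "Q \<boxplus> R = opposite P"
      using comm[of "opposite P" "opposite Q"] add_cancel[of "opposite Q" "opposite P"] P Q by simp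
    then show ?thesis using 4 by simp
  next
    case 5
    then have "P = opposite Q \<boxplus> opposite R" using opposite_add[OF Q R] by simp
    then have "P \<boxplus> Q = opposite R"
      using comm[of "opposite Q" "opposite R"] add_cancel_right[of "opposite Q" "opposite R"] R Q by simp
    then show ?thesis using 5 by simp
  next
    case 6
    then show ?thesis using comm[OF P Q] comm[OF P cl[OF Q P]] by simp
  next
    case 7
    then show ?thesis using comm[OF P Q] comm[of Q "opposite P"] add_cancel_right[OF P Q]
        add_cancel[of "opposite P" Q] P Q by simp
  next
    case 8
    then have "(P \<boxplus> P) \<boxplus> R = (P \<boxplus> R) \<boxplus> P" by (intro double P R) auto
    then show ?thesis using 8 comm[OF P cl[OF P R]] by simp
  next
    case 9
    then have "(Q \<boxplus> Q) \<boxplus> P = (Q \<boxplus> P) \<boxplus> Q" by (intro double P Q) (auto simp: comm[OF Q P])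
    then show ?thesis using 9 comm[OF P cl[OF Q Q]] comm[OF P Q] by simp
  next
    case 10
    obtain x1 y1 x2 y2 x3 y3 where st: "P = Affine x1 y1" "Q = Affine x2 y2" "R = Affine x3 y3"
      using 10 by (cases P; cases Q; cases R) auto
    have ne: "x \<noteq> x'" if "pt (Affine x y)" "pt (Affine x' y')"
        "Affine x y \<noteq> Affine x' y'" "Affine x y \<noteq> opposite (Affine x' y')" for x y x' y'
    proof
      assume "x = x'"
      then have "y ^ 2 = y' ^ 2" using that by simp
      then have "y = y' \<or> y = - y'" by (simp add: power2_eq_iff)
      with \<open>x = x'\<close> that show False by auto
    qed
    have "(P \<boxplus> Q) \<boxplus> R = (Q \<boxplus> R) \<boxplus> P"
      using 10 P Q R unfolding st by (intro add_assoc_distinct ne) auto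
    then show ?thesis using comm[OF P cl[OF Q R]] by simp
  qed
qed

lemma point_group_comm_group: "comm_group (point_group (curve a b))"
proof (rule comm_groupI)
  let ?G = "point_group (curve a b)"
  fix x assume "x \<in> carrier ?G"
  then show "\<exists>y\<in>carrier ?G. y \<otimes>\<^bsub>?G\<^esub> x = \<one>\<^bsub>?G\<^esub>"
    by (intro bexI[of _ "opposite x"]) (auto simp: point_group_def)
qed (auto simp: point_group_def add_closed add_assoc intro: add_commute)

lemma inv_point_group:
  assumes "pt P"
  shows "inv\<^bsub>point_group (curve a b)\<^esub> P = opposite P"
  by (rule group.inv_equality[OF comm_group.axioms(2)[OF point_group_comm_group]])
    (use assms in \<open>simp_all add: point_group_def\<close>)

end

section \<open>The isogeny of degree two\<close>

fun isogeny :: "'a::field \<Rightarrow> 'a point \<Rightarrow> 'a point" where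
  "isogeny b Infinity = Infinity"
| "isogeny b (Affine x y) = (if x = 0 then Infinity else Affine (y ^ 2 / x ^ 2) (y * (b - x ^ 2) / x ^ 2))"

text \<open>Applying the construction of the isogeny twice leads to the curve with coefficients 4 a
  and 16 b. This map identifies it with the original curve, so that the composite becomes
  doubling.\<close>

fun halve_scale :: "'a::field point \<Rightarrow> 'a point" where
  "halve_scale Infinity = Infinity"
| "halve_scale (Affine x y) = Affine (x / 4) (y / 8)"

text \<open>The value at (0, 0), where the abscissa vanishes, is the one that makes the map
  multiplicative modulo squares: translation by (0, 0) sends the abscissa x to b / x.\<close>

fun two_descent :: "'a::field \<Rightarrow> 'a point \<Rightarrow> 'a" where
  "two_descent b Infinity = 1"
| "two_descent b (Affine x y) = (if x = 0 then b else x)"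

lemma isogeny_affine:
  "x \<noteq> 0 \<Longrightarrow> isogeny b (Affine x y) = Affine ((y / x) ^ 2) (y / x * (b / x - x))"
  by (simp add: power_divide divide_simps power2_eq_square)

context nonsingular_cubic
begin

abbreviation (input) a' where "a' \<equiv> - 2 * a"
abbreviation (input) b' where "b' \<equiv> a ^ 2 - 4 * b"

lemma dual: "nonsingular_cubic a' b'"
  by unfold_locales (use b_nonzero disc_nonzero in \<open>simp_all add: power2_eq_square\<close>)

lemma scaled: "nonsingular_cubic (4 * a) (16 * b)"
proof
  have "(4 * a) ^ 2 - 4 * (16 * b) = 16 * (a ^ 2 - 4 * b)" by (simp add: power2_eq_square)
  then show "(4 * a) ^ 2 - 4 * (16 * b) \<noteq> 0" using disc_nonzero by simp
qed (use b_nonzero in simp)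

lemma affine_param:
  assumes "pt (Affine x y)" "x \<noteq> 0"
  shows "(y / x) ^ 2 = x + a + b / x"
proof -
  have "(y / x) ^ 2 = (x ^ 3 + a * x ^ 2 + b * x) / x ^ 2" using assms by (simp add: power_divide)
  also have "\<dots> = x + a + b / x" using assms(2) by (simp add: field_simps power2_eq_square power3_eq_cube)
  finally show ?thesis .
qed

lemma isogeny_on_curve:
  assumes "pt P"
  shows "on_curve (curve a' b') (isogeny b P)"
proof (cases P)
  case (Affine x y)
  show ?thesis
  proof (cases "x = 0")
    case False
    define w t where "w = y / x" and "t = b / x"
    have w: "w ^ 2 = x + a + t" using affine_param assms Affine False by (simp add: w_def t_def)
    have b: "b = x * t" using False by (simp add: t_def)
    have "(w * (t - x)) ^ 2 = w ^ 2 * (t - x) ^ 2" by (simp add: power_mult_distrib)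
    also have "\<dots> = w ^ 2 * ((w ^ 2) ^ 2 + a' * w ^ 2 + b')"
      unfolding w b by (simp add: ring_simps)
    also have "\<dots> = (w ^ 2) ^ 3 + a' * (w ^ 2) ^ 2 + b' * w ^ 2"
      by (simp add: ring_simps)
    finally show ?thesis unfolding Affine isogeny_affine[OF False] w_def t_def by simp
  qed (simp add: Affine)
qed simp

lemma add_origin:
  assumes "pt (Affine x y)" "x \<noteq> 0"
  shows "Affine 0 0 \<boxplus> Affine x y = Affine (b / x) (- (y / x * (b / x)))"
proof -
  have "sec (y / x) 0 0 x (b / x)"
    unfolding secant_def using affine_param[OF assms] assms(2) by (simp add: ac_simps)
  from add_secant[OF this, of 0 y] show ?thesis using assms(2) by simp
qed

text \<open>Translation by (0, 0) exchanges x with b / x and changes the sign of w = y / x; the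
  image (w^2, w (b / x - x)) is invariant under this.\<close>

lemma isogeny_add_origin:
  assumes "pt Q"
  shows "isogeny b (Affine 0 0 \<boxplus> Q) = isogeny b Q"
proof (cases Q)
  case (Affine x y)
  show ?thesis
  proof (cases "x = 0")
    case True
    then have "y = 0" using assms Affine by simp
    then show ?thesis using True Affine by simp
  next
    case False
    have bx: "b / x \<noteq> 0" using False b_nonzero by simp
    have e: "- (y / x * (b / x)) / (b / x) = - (y / x)" "b / (b / x) = x"
      using False b_nonzero by simp_all
    have "pt (Affine x y)" using assms Affine by simp
    from add_origin[OF this False] show ?thesis
      unfolding Affine isogeny_affine[OF False] by (simp only: isogeny_affine[OF bx] e) (simp add: algebra_simps)
  qed
qed simp

text \<open>If the line \<open>y = l x + n\<close> meets the cubic at the abscissas \<open>x1, x2, x3\<close> and \<open>ui = n / xi\<close>, then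
  \<open>n = u1 u2 u3\<close>, each \<open>xi\<close> is the product of the other two \<open>uj\<close>, and \<open>(l + ui)^2\<close> is the abscissa of
  the image point. In these coordinates the image line has polynomial coefficients.\<close>

lemma isogeny_line:
  fixes u1 u2 u3 l :: 'a
  assumes a: "a = l ^ 2 - (u1 * u2 + u1 * u3 + u2 * u3)"
    and b: "b = (u1 + u2 + u3 + 2 * l) * (u1 * u2 * u3)"
  defines "L \<equiv> u1 + u2 + u3 + l" and "N \<equiv> - ((l + u1) * (l + u2) * (l + u3))"
  shows "secant a' b' L N ((l + u1) ^ 2) ((l + u2) ^ 2) ((l + u3) ^ 2)"
    and "(l + u1) * ((u1 + u2 + u3 + 2 * l) * u1 - u2 * u3) = L * (l + u1) ^ 2 + N"
  unfolding secant_def a b L_def N_def by (simp_all add: ring_simps)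

lemma isogeny_opposite: "isogeny b (opposite P) = opposite (isogeny b P)"
  by (cases P) auto

text \<open>Collinear points have collinear images. If the line avoids (0, 0), this is a polynomial
  identity in the ratios n / xi; if (0, 0) is its third point, the images of the two summands are
  opposite.\<close>

lemma isogeny_add:
  assumes P: "pt P" and Q: "pt Q"
  shows "isogeny b (P \<boxplus> Q) = point_add (curve a' b') (isogeny b P) (isogeny b Q)"
proof -
  interpret D: nonsingular_cubic a' b' by (rule dual)
  have origin: "y = 0" if "pt (Affine 0 y)" for y using that by simp
  consider "P = Infinity \<or> Q = Infinity" | "Q = opposite P" | "P = Affine 0 0" | "Q = Affine 0 0"
    | x1 y1 x2 y2 where "P = Affine x1 y1" "Q = Affine x2 y2" "\<not> (x1 = x2 \<and> y1 + y2 = 0)"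
        "x1 \<noteq> 0" "x2 \<noteq> 0"
  proof (cases P; cases Q)
    fix x1 y1 x2 y2 assume *: "P = Affine x1 y1" "Q = Affine x2 y2"
    have "x1 = 0 \<Longrightarrow> P = Affine 0 0" "x2 = 0 \<Longrightarrow> Q = Affine 0 0" using P Q origin * by auto
    moreover have "x1 = x2 \<and> y1 + y2 = 0 \<Longrightarrow> Q = opposite P" using * by (auto simp: minus_unique)
    ultimately show thesis using that * by blast
  qed (use that in auto)
  then show ?thesis
  proof cases
    case 1
    then show ?thesis using add_Infinity D.add_Infinity isogeny.simps(1) by metis
  next
    case 2
    then show ?thesis using D.add_opposite(1) by (simp only: isogeny_opposite add_opposite isogeny.simps)
  next
    case 3
    then show ?thesis using isogeny_add_origin[OF Q] by simp
  next
    case 4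
    then have "isogeny b (P \<boxplus> Q) = isogeny b P" "isogeny b Q = Infinity"
      using isogeny_add_origin[OF P] add_commute[OF P Q] by simp_all
    then show ?thesis using D.add_Infinity(2) by metis
  next
    case 5
    note x12 = 5(4,5)
    obtain l n x3 where *: "sec l n x1 x2 x3" "y1 = l * x1 + n" "y2 = l * x2 + n"
        "P \<boxplus> Q = Affine x3 (- (l * x3 + n))"
      using P Q 5(3) unfolding 5(1,2) by (rule add_secantE)
    note s = *(1)[unfolded secant_def]
    show ?thesis
    proof (cases "x3 = 0")
      case True
      then have n: "n = 0" and b: "b = x1 * x2" using s by auto
      have "isogeny b P = Affine (l ^ 2) (l * (x2 - x1))" "isogeny b Q = Affine (l ^ 2) (l * (x1 - x2))"
        using x12 unfolding 5(1,2) isogeny_affine[OF x12(1)] isogeny_affine[OF x12(2)] by (simp_all add: *(2,3) n b)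
      then show ?thesis using True *(4) by (simp add: algebra_simps)
    next
      case x3: False
      have n: "n \<noteq> 0" using s x12 x3 by auto
      define u1 u2 u3 c where u: "u1 = n / x1" "u2 = n / x2" "u3 = n / x3" and c: "c = b / n"
      have nn: "n * n = x1 * x2 * x3" using s by (simp add: power2_eq_square)
      have xu: "x1 = u2 * u3" "x2 = u1 * u3" "x3 = u1 * u2" "n = u1 * u2 * u3"
        using x12 x3 n nn unfolding u by (simp_all add: field_simps)
      have u0: "u1 \<noteq> 0" "u2 \<noteq> 0" "u3 \<noteq> 0" using u x12 x3 n by simp_all
      have a: "a = l ^ 2 - (u1 * u2 + u1 * u3 + u2 * u3)" using s unfolding xu by (simp add: algebra_simps)
      have "b - 2 * l * n = (u1 + u2 + u3) * n" using s unfolding xu by (simp add: algebra_simps)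
      then have b: "b = (u1 + u2 + u3 + 2 * l) * (u1 * u2 * u3)" unfolding xu(4) by (simp add: algebra_simps)
      define L N where "L = u1 + u2 + u3 + l" and "N = - ((l + u1) * (l + u2) * (l + u3))"
      have sec': "D.sec L N ((l + u1) ^ 2) ((l + u2) ^ 2) ((l + u3) ^ 2)"
        unfolding L_def N_def by (rule isogeny_line(1)[OF a b])
      have w: "y1 / x1 = l + u1" "y2 / x2 = l + u2" "- (l * x3 + n) / x3 = - (l + u3)"
        using x12 x3 unfolding *(2,3) u by (simp_all add: field_simps)
      have t: "b / x1 = (u1 + u2 + u3 + 2 * l) * u1" "b / x2 = (u1 + u2 + u3 + 2 * l) * u2"
        "b / x3 = (u1 + u2 + u3 + 2 * l) * u3"
        using u0 unfolding xu b by simp_all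
      have iP: "isogeny b P = Affine ((l + u1) ^ 2) (L * (l + u1) ^ 2 + N)"
        unfolding 5(1) isogeny_affine[OF x12(1)] w t unfolding xu L_def N_def by (simp add: ring_simps)
      have iQ: "isogeny b Q = Affine ((l + u2) ^ 2) (L * (l + u2) ^ 2 + N)"
        unfolding 5(2) isogeny_affine[OF x12(2)] w t unfolding xu L_def N_def by (simp add: ring_simps)
      have iPQ: "isogeny b (P \<boxplus> Q) = Affine ((l + u3) ^ 2) (- (L * (l + u3) ^ 2 + N))"
        unfolding *(4) isogeny_affine[OF x3] w t unfolding xu L_def N_def by (simp add: ring_simps)
      \<comment> \<open>Opposite images would give the image line a double abscissa with ordinate 0,
        against the nonsingularity of the target curve.\<close>
      have "\<not> ((l + u1) ^ 2 = (l + u2) ^ 2 \<and> L * (l + u1) ^ 2 + N + (L * (l + u2) ^ 2 + N) = 0)"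
      proof
        assume h: "(l + u1) ^ 2 = (l + u2) ^ 2 \<and> L * (l + u1) ^ 2 + N + (L * (l + u2) ^ 2 + N) = 0"
        then have e: "(l + u1) ^ 2 = (l + u2) ^ 2" by blast
        have "L * (l + u2) ^ 2 + N + (L * (l + u2) ^ 2 + N) = 0" using h unfolding e by (elim conjE)
        then have "2 * (L * (l + u2) ^ 2 + N) = 0" by (simp only: mult_2)
        then have "L * (l + u2) ^ 2 + N = 0" by (metis mult_eq_0_iff zero_neq_numeral)
        moreover have "D.sec L N ((l + u2) ^ 2) ((l + u2) ^ 2) ((l + u3) ^ 2)" using sec' unfolding e .
        ultimately show False using D.sec_double_nonzero by blast
      qed
      from D.add_secant[OF sec' refl refl this] show ?thesis unfolding iP iQ iPQ by simp
    qed
  qed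
qed

lemma scale_on_curve:
  assumes "on_curve (curve (4 * a) (16 * b)) P"
  shows "pt (halve_scale P)"
proof (cases P)
  case (Affine x y)
  then have "y ^ 2 = x ^ 3 + 4 * a * x ^ 2 + 16 * b * x" using assms by simp
  then have "(y / 8) ^ 2 = (x ^ 3 + 4 * a * x ^ 2 + 16 * b * x) / 64" by (simp add: power_divide)
  also have "\<dots> = (x / 4) ^ 3 + a * (x / 4) ^ 2 + b * (x / 4)" 
    by (simp add: field_simps power2_eq_square power3_eq_cube)
  finally show ?thesis using Affine by simp
qed simp

lemma scale_add:
  assumes P: "on_curve (curve (4 * a) (16 * b)) P" and Q: "on_curve (curve (4 * a) (16 * b)) Q"
  shows "halve_scale (point_add (curve (4 * a) (16 * b)) P Q) = halve_scale P \<boxplus> halve_scale Q"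
proof -
  interpret S: nonsingular_cubic "4 * a" "16 * b" by (rule scaled)
  consider "P = Infinity \<or> Q = Infinity" | "Q = opposite P"
    | x1 y1 x2 y2 where "P = Affine x1 y1" "Q = Affine x2 y2" "\<not> (x1 = x2 \<and> y1 + y2 = 0)"
    by (cases P; cases Q) (auto simp: eq_neg_iff_add_eq_0 add.commute)
  then show ?thesis
  proof cases
    case 1
    then show ?thesis by auto
  next
    case 2
    then show ?thesis by (cases P) simp_all
  next
    case 3
    obtain l n x3 where *: "S.sec l n x1 x2 x3" "y1 = l * x1 + n" "y2 = l * x2 + n"
        "point_add (curve (4 * a) (16 * b)) P Q = Affine x3 (- (l * x3 + n))"
      using P Q 3(3) unfolding 3(1,2) by (rule S.add_secantE)
    have s: "sec (l / 2) (n / 8) (x1 / 4) (x2 / 4) (x3 / 4)"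
    proof -
      have "b - 2 * (l / 2) * (n / 8) = (16 * b - 2 * l * n) / 16"
        "(l / 2) ^ 2 = l ^ 2 / 4" "(n / 8) ^ 2 = n ^ 2 / 64"
        by (simp_all add: field_simps power2_eq_square)
      moreover have "l ^ 2 = 4 * a + x1 + x2 + x3" "16 * b - 2 * l * n = x1 * x2 + x1 * x3 + x2 * x3"
        "n ^ 2 = x1 * x2 * x3"
        using *(1) unfolding secant_def by auto
      ultimately show ?thesis unfolding secant_def by (simp only:) (simp add: field_simps)
    qed
    have "\<not> (x1 / 4 = x2 / 4 \<and> y1 / 8 + y2 / 8 = 0)" using 3(3) by (simp flip: add_divide_distrib)
    from add_secant[OF s _ _ this] show ?thesis using *(2,3,4) unfolding 3(1,2)
      by (simp add: field_simps)
  qed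
qed

section \<open>The dual isogeny, its composite with the isogeny, and preimages\<close>

definition dual_isogeny :: "'a point \<Rightarrow> 'a point" where
  "dual_isogeny P = halve_scale (isogeny b' P)"

lemma dual_dual: "- 2 * a' = 4 * a" "a' ^ 2 - 4 * b' = 16 * b"
  by (simp_all add: power2_eq_square)

lemma dual_isogeny_on_curve:
  "on_curve (curve a' b') P \<Longrightarrow> pt (dual_isogeny P)"
  unfolding dual_isogeny_def
  using scale_on_curve nonsingular_cubic.isogeny_on_curve[OF dual] unfolding dual_dual by blast

lemma dual_isogeny_add:
  assumes "on_curve (curve a' b') P" "on_curve (curve a' b') Q"
  shows "dual_isogeny (point_add (curve a' b') P Q) = dual_isogeny P \<boxplus> dual_isogeny Q"
  unfolding dual_isogeny_def
  using nonsingular_cubic.isogeny_add[OF dual assms] nonsingular_cubic.isogeny_on_curve[OF dual assms(1)]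
    nonsingular_cubic.isogeny_on_curve[OF dual assms(2)] scale_add unfolding dual_dual by simp

text \<open>Comparison with the duplication formula, in which the abscissa of the double is the
  square of v = (b - x^2) / (2 y).\<close>

lemma dual_isogeny_isogeny:
  assumes "pt P"
  shows "dual_isogeny (isogeny b P) = P \<boxplus> P"
proof (cases P)
  case (Affine x y)
  show ?thesis
  proof (cases "x = 0 \<or> y = 0")
    case True
    then have "y = 0" using assms Affine by auto
    then show ?thesis using Affine by (simp add: dual_isogeny_def)
  next
    case False
    then have x: "x \<noteq> 0" and "y \<noteq> 0" by auto
    define w v where "w = y / x" and "v = (b / x - x) / (2 * w)"
    have w0: "w \<noteq> 0" using x \<open>y \<noteq> 0\<close> by (simp add: w_def)
    have y: "y = w * x" using x by (simp add: w_def)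
    have t: "b / x = x + 2 * w * v" using w0 by (simp add: v_def)
    then have b: "b = x * (x + 2 * w * v)" using x by (simp add: field_simps)
    have a: "a = w ^ 2 - 2 * x - 2 * w * v"
      using affine_param[of x y] assms Affine x t unfolding w_def[symmetric] by (simp add: algebra_simps)
    \<comment> \<open>In terms of w and v, the tangent at the point has slope w - v and intercept v
      x.\<close>
    have s: "sec (w - v) (v * x) x x (v ^ 2)"
      unfolding secant_def a b by (simp add: ring_simps)
    have "\<not> (x = x \<and> y + y = 0)" using \<open>y \<noteq> 0\<close> by (simp flip: mult_2)
    moreover have l: "y = (w - v) * x + v * x" unfolding y by (simp add: algebra_simps)
    ultimately have dbl: "P \<boxplus> P = Affine (v ^ 2) (- ((w - v) * v ^ 2 + v * x))"
      unfolding Affine by (intro add_secant[OF s l l])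
    have i: "isogeny b P = Affine (w ^ 2) (w * (2 * w * v))"
      unfolding Affine isogeny_affine[OF x] t by (simp add: w_def)
    have w2: "w ^ 2 \<noteq> 0" using w0 by simp
    have bb: "b' = w ^ 2 * (w ^ 2 + 4 * v ^ 2 - 4 * x - 4 * w * v)"
      unfolding a b by (simp add: ring_simps)
    have q: "w * (2 * w * v) / w ^ 2 = 2 * v" "b' / w ^ 2 = w ^ 2 + 4 * v ^ 2 - 4 * x - 4 * w * v"
      using w0 unfolding bb by (simp_all add: power2_eq_square)
    have "dual_isogeny (isogeny b P) = Affine ((2 * v) ^ 2 / 4) (2 * v * (4 * v ^ 2 - 4 * x - 4 * w * v) / 8)"
      unfolding i dual_isogeny_def isogeny_affine[OF w2] q by simp
    moreover have "2 * v * (4 * v ^ 2 - 4 * x - 4 * w * v) = 8 * - ((w - v) * v ^ 2 + v * x)"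
      by (simp add: ring_simps)
    ultimately show ?thesis unfolding dbl by (simp add: power_mult_distrib)
  qed
qed (simp add: dual_isogeny_def)

text \<open>The comparison of ranks uses only that the kernel is killed by 2, a form that both
  isogenies share.\<close>

lemma isogeny_kernel:
  assumes "pt P" "isogeny b P = Infinity"
  shows "P \<boxplus> P = Infinity"
  using assms by (cases P) (auto split: if_splits)

lemma dual_isogeny_kernel:
  assumes "on_curve (curve a' b') P" "dual_isogeny P = Infinity"
  shows "point_add (curve a' b') P P = Infinity"
  using assms unfolding dual_isogeny_def by (cases P) (auto split: if_splits)

text \<open>A preimage of (s^2, Y) with y / x = s must satisfy x + b / x = s^2 - a and b / x - x = Y
  / s, and these equations determine x. Over (0, 0), a square root of b' makes x^2 + a x + b
  split.\<close>

lemma isogeny_surj: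
  assumes P: "on_curve (curve a' b') P" and s: "two_descent b' P = s ^ 2" "s \<noteq> 0"
  shows "\<exists>Q. pt Q \<and> isogeny b Q = P"
proof (cases P)
  case Infinity
  then show ?thesis by (intro exI[of _ Infinity]) simp
next
  case (Affine w2 Y)
  show ?thesis
  proof (cases "w2 = 0")
    case True
    then have Y: "Y = 0" using P Affine by simp
    have b: "b = (a ^ 2 - s ^ 2) / 4" using s True Affine by (simp add: field_simps)
    define x where "x = (s - a) / 2"
    have xx: "x ^ 2 + a * x + b = 0" unfolding x_def b by (simp add: field_simps power2_eq_square)
    then have "x \<noteq> 0" using b_nonzero by auto
    moreover have "x ^ 3 + a * x ^ 2 + b * x = x * (x ^ 2 + a * x + b)" by (simp add: ring_simps)
    ultimately show ?thesis using xx True Y Affine by (intro exI[of _ "Affine x 0"]) simp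
  next
    case False
    then have w2: "w2 = s ^ 2" using s Affine by simp
    define x t where "x = (s ^ 2 - a - Y / s) / 2" and "t = (s ^ 2 - a + Y / s) / 2"
    have "(Y / s) ^ 2 = ((s ^ 2) ^ 3 + a' * (s ^ 2) ^ 2 + b' * s ^ 2) / s ^ 2"
      using P Affine w2 by (simp add: power_divide)
    also have "\<dots> = (s ^ 2 - a) ^ 2 - 4 * b"
      using s(2) by (simp add: field_simps power2_eq_square power3_eq_cube)
    finally have Ys: "(Y / s) ^ 2 = (s ^ 2 - a) ^ 2 - 4 * b" .
    have "x * t = ((s ^ 2 - a) ^ 2 - (Y / s) ^ 2) / 4"
      unfolding x_def t_def by (simp add: algebra_simps power2_eq_square flip: add_divide_distrib)
    then have xt: "x * t = b" unfolding Ys by simp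
    have x0: "x \<noteq> 0" using xt b_nonzero by auto
    have t: "b / x = t" using xt x0 by (simp add: field_simps)
    have sum: "x + a + t = s ^ 2" unfolding x_def t_def by (simp add: field_simps)
    have "(s * x) ^ 2 = (x + a + t) * x ^ 2" unfolding sum by (simp add: power_mult_distrib)
    also have "\<dots> = x ^ 3 + a * x ^ 2 + b * x" unfolding xt[symmetric] by (simp add: ring_simps)
    finally have "pt (Affine x (s * x))" by simp
    moreover have "t - x = Y / s" unfolding x_def t_def by (simp flip: diff_divide_distrib)
    then have "isogeny b (Affine x (s * x)) = P"
      unfolding isogeny_affine[OF x0] t Affine w2 using x0 s(2) by simp
    ultimately show ?thesis by blast
  qed
qed

lemma dual_isogeny_surj:
  assumes P: "pt P" and s: "two_descent b P = s ^ 2" "s \<noteq> 0"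
  shows "\<exists>Q. on_curve (curve a' b') Q \<and> dual_isogeny Q = P"
proof -
  define R where "R = (case P of Infinity \<Rightarrow> Infinity | Affine x y \<Rightarrow> Affine (4 * x) (8 * y))"
  have R: "halve_scale R = P" by (auto simp: R_def split: point.splits)
  have on: "on_curve (curve (4 * a) (16 * b)) R"
  proof (cases P)
    case (Affine x y)
    then have "(8 * y) ^ 2 = 64 * (x ^ 3 + a * x ^ 2 + b * x)" using P by (simp add: power_mult_distrib)
    then show ?thesis using Affine by (simp add: R_def ring_simps)
  qed (simp add: R_def)
  have "\<exists>c. c \<noteq> 0 \<and> two_descent (16 * b) R = c ^ 2"
  proof (cases P)
    case Infinity
    then show ?thesis by (intro exI[of _ 1]) (simp add: R_def)
  next
    case (Affine x y)
    show ?thesis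
      \<comment> \<open>Rescaling multiplies the abscissa by 4 = 2^2, and the substitute value
        \<open>b\<close> at (0, 0) by 16 = 4^2.\<close>
      using s Affine by (intro exI[of _ "if x = 0 then 4 * s else 2 * s"]) (auto simp: R_def power_mult_distrib)
  qed
  then obtain c where "c \<noteq> 0" "two_descent (16 * b) R = c ^ 2" by blast
  then obtain Q where "on_curve (curve a' b') Q" "isogeny b' Q = R"
    using nonsingular_cubic.isogeny_surj[OF dual, of R c] on unfolding dual_dual by blast
  with R show ?thesis by (auto simp: dual_isogeny_def)
qed

section \<open>The descent map modulo squares\<close>

lemma two_descent_nonzero: "two_descent b P \<noteq> 0"
  using b_nonzero by (cases P) auto

lemma two_descent_opposite [simp]: "two_descent b (opposite P) = two_descent b P"
  by (cases P) auto

text \<open>If y = l x + n meets the cubic at x1, x2, x3, then the product of these abscissas is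
  n^2. If one of them is 0, then n = 0 and the other two have product b, the value assigned to (0,
  0).\<close>

lemma two_descent_add:
  assumes P: "pt P" and Q: "pt Q"
  shows "\<exists>s. s \<noteq> 0 \<and> two_descent b P * two_descent b Q * two_descent b (P \<boxplus> Q) = s ^ 2"
proof -
  have origin: "\<exists>s. s \<noteq> 0 \<and> two_descent b (Affine 0 0) * two_descent b S * two_descent b (Affine 0 0 \<boxplus> S) = s ^ 2"
    if S: "pt S" for S
  proof (cases "S = Infinity \<or> S = Affine 0 0")
    case True
    then show ?thesis using b_nonzero by (intro exI[of _ b]) (auto simp: power2_eq_square)
  next
    case False
    then obtain x y where S': "S = Affine x y" by (cases S) auto
    then have "x \<noteq> 0" using S False by auto
    with S S' have "Affine 0 0 \<boxplus> S = Affine (b / x) (- (y / x * (b / x)))"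
      using add_origin[of x y] by simp
    then show ?thesis using b_nonzero \<open>x \<noteq> 0\<close> S'
      by (intro exI[of _ b]) (simp add: power2_eq_square)
  qed
  have zero: "y = 0" if "pt (Affine 0 y)" for y using that by simp
  consider "P = Infinity \<or> Q = Infinity" | "Q = opposite P" | "P = Affine 0 0" | "Q = Affine 0 0"
    | x1 y1 x2 y2 where "P = Affine x1 y1" "Q = Affine x2 y2" "\<not> (x1 = x2 \<and> y1 + y2 = 0)"
        "x1 \<noteq> 0" "x2 \<noteq> 0"
  proof (cases P; cases Q)
    fix x1 y1 x2 y2 assume *: "P = Affine x1 y1" "Q = Affine x2 y2"
    have "x1 = 0 \<Longrightarrow> P = Affine 0 0" "x2 = 0 \<Longrightarrow> Q = Affine 0 0" using P Q zero * by auto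
    moreover have "x1 = x2 \<and> y1 + y2 = 0 \<Longrightarrow> Q = opposite P" using * by (auto simp: minus_unique)
    ultimately show thesis using that * by blast
  qed (use that in auto)
  then show ?thesis
  proof cases
    case 1
    then show ?thesis using two_descent_nonzero
      by (intro exI[of _ "two_descent b P * two_descent b Q"]) (auto simp: power2_eq_square)
  next
    case 2
    then show ?thesis using two_descent_nonzero
      by (intro exI[of _ "two_descent b P"]) (auto simp: power2_eq_square)
  next
    case 3
    then show ?thesis using origin[OF Q] by simp
  next
    case 4
    then show ?thesis using origin[OF P] add_commute[OF P Q] by (simp add: ac_simps)
  next
    case 5
    obtain l n x3 where *: "sec l n x1 x2 x3" "P \<boxplus> Q = Affine x3 (- (l * x3 + n))"
      using P Q 5(3) unfolding 5(1,2) by (rule add_secantE)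
    show ?thesis
    proof (cases "x3 = 0")
      case True
      then have "b = x1 * x2" using *(1) unfolding secant_def by auto
      then show ?thesis using 5 *(2) True b_nonzero
        by (intro exI[of _ b]) (simp add: power2_eq_square)
    next
      case False
      then have "n ^ 2 = x1 * x2 * x3" "n \<noteq> 0" using *(1) 5(4,5) unfolding secant_def by auto
      then show ?thesis using 5 *(2) False by (intro exI[of _ n]) simp
    qed
  qed
qed

end

section \<open>Descent and rank in abelian groups\<close>

lemma hom_finprod:
  assumes "comm_group G" "comm_group H" "h \<in> hom G H" "finite A" "f \<in> A \<rightarrow> carrier G"
  shows "h (finprod G f A) = finprod H (\<lambda>x. h (f x)) A"
  using assms(4,5)
proof (induction A rule: finite_induct)
  case empty
  interpret G: comm_group G by fact
  interpret H: comm_group H by fact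
  show ?case using hom_one[OF assms(3)] G.is_group H.is_group by simp
next
  case (insert x A)
  interpret G: comm_group G by fact
  interpret H: comm_group H by fact
  have "(\<lambda>x. h (f x)) \<in> A \<rightarrow> carrier H" "h (f x) \<in> carrier H"
    using insert.prems assms(3) by (auto simp: hom_def Pi_iff)
  then show ?case using insert assms(3) by (simp add: hom_mult)
qed

section \<open>Integer combinations, finite index and generation in an abelian group\<close>

context comm_group
begin

lemma comb_closed [simp]: "S \<subseteq> carrier G \<Longrightarrow> (\<Otimes>x\<in>S. x [^] (c x :: int)) \<in> carrier G"
  by (rule finprod_closed) auto

lemma comb_mult:
  assumes "S \<subseteq> carrier G"
  shows "(\<Otimes>x\<in>S. x [^] (c x :: int)) \<otimes> (\<Otimes>x\<in>S. x [^] (d x :: int)) = (\<Otimes>x\<in>S. x [^] (c x + d x))"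
proof -
  have "(\<Otimes>x\<in>S. x [^] (c x + d x)) = (\<Otimes>x\<in>S. x [^] c x \<otimes> x [^] d x)"
    by (rule finprod_cong) (use assms in \<open>auto simp: int_pow_mult simp_implies_def\<close>)
  also have "\<dots> = (\<Otimes>x\<in>S. x [^] c x) \<otimes> (\<Otimes>x\<in>S. x [^] d x)"
    by (rule finprod_multf) (use assms in auto)
  finally show ?thesis by simp
qed

lemma comb_zero: "(\<And>x. x \<in> S \<Longrightarrow> c x = 0) \<Longrightarrow> (\<Otimes>x\<in>S. x [^] (c x :: int)) = \<one>"
  by (rule finprod_one_eqI) simp

lemma comb_inv:
  assumes "S \<subseteq> carrier G"
  shows "inv (\<Otimes>x\<in>S. x [^] (c x :: int)) = (\<Otimes>x\<in>S. x [^] (- c x))"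
proof (rule inv_equality)
  show "(\<Otimes>x\<in>S. x [^] (- c x)) \<otimes> (\<Otimes>x\<in>S. x [^] c x) = \<one>"
    unfolding comb_mult[OF assms] by (rule comb_zero) simp
qed (use assms in auto)

lemma comb_diff:
  assumes "S \<subseteq> carrier G"
  shows "(\<Otimes>x\<in>S. x [^] (c x :: int)) \<otimes> inv (\<Otimes>x\<in>S. x [^] (d x :: int)) = (\<Otimes>x\<in>S. x [^] (c x - d x))"
  unfolding comb_inv[OF assms] comb_mult[OF assms] by simp

lemma comb_single:
  assumes "S \<subseteq> carrier G" "finite S" "x \<in> S"
  shows "(\<Otimes>y\<in>S. y [^] (if y = x then 1 else 0 :: int)) = x"
proof -
  have "(\<Otimes>y\<in>S. y [^] (if y = x then 1 else 0 :: int)) = (\<Otimes>y\<in>S. if x = y then y else \<one>)"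
    by (rule finprod_cong) (use assms in \<open>auto simp: simp_implies_def\<close>)
  also have "\<dots> = x" by (rule finprod_singleton) (use assms in auto)
  finally show ?thesis .
qed

lemma finprod_in_subgroup:
  assumes "subgroup H G" "finite A" "f \<in> A \<rightarrow> H"
  shows "finprod G f A \<in> H"
  using assms(2,3)
proof (induction A rule: finite_induct)
  case empty
  then show ?case using assms(1) by (simp add: subgroup.one_closed)
next
  case (insert x A)
  then have "f x \<in> H" "f \<in> A \<rightarrow> H" by auto
  moreover have "H \<subseteq> carrier G" using assms(1) by (rule subgroup.subset)
  ultimately show ?case using insert assms(1) by (subst finprod_insert) (auto intro: subgroup.m_closed)
qed

lemma generate_eq_comb:
  assumes "S \<subseteq> carrier G" "finite S"
  shows "generate G S = (\<lambda>c. \<Otimes>x\<in>S. x [^] (c x :: int)) ` UNIV"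
proof (intro equalityI generate_subgroup_incl)
  show "S \<subseteq> (\<lambda>c. \<Otimes>x\<in>S. x [^] (c x :: int)) ` UNIV"
  proof
    fix x assume "x \<in> S"
    then show "x \<in> (\<lambda>c. \<Otimes>x\<in>S. x [^] (c x :: int)) ` UNIV"
      by (intro image_eqI[where x = "\<lambda>y. if y = x then 1 else 0"]) (simp_all add: comb_single[OF assms])
  qed
  show "subgroup ((\<lambda>c. \<Otimes>x\<in>S. x [^] (c x :: int)) ` UNIV) G"
  proof (rule subgroupI)
    fix a b assume "a \<in> (\<lambda>c. \<Otimes>x\<in>S. x [^] (c x :: int)) ` UNIV" "b \<in> (\<lambda>c. \<Otimes>x\<in>S. x [^] (c x :: int)) ` UNIV"
    then show "a \<otimes> b \<in> (\<lambda>c. \<Otimes>x\<in>S. x [^] (c x :: int)) ` UNIV"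
      by (auto simp: comb_mult[OF assms(1)])
  qed (use assms in \<open>auto simp: comb_inv\<close>)
  have sg: "subgroup (generate G S) G" using assms(1) by (rule generate_is_subgroup)
  have "(\<Otimes>x\<in>S. x [^] (c x :: int)) \<in> generate G S" for c
    by (intro finprod_in_subgroup[OF sg assms(2)] Pi_I subgroup_int_pow_closed[OF sg] generate.incl)
  then show "(\<lambda>c. \<Otimes>x\<in>S. x [^] (c x :: int)) ` UNIV \<subseteq> generate G S" by blast
qed

text \<open>Changing the exponent of k by a multiple of n(k) does not affect the coset, so cosets
  are indexed by finitely many tuples of residues.\<close>

lemma finite_rcosets:
  assumes K: "K \<subseteq> carrier G" "finite K" "generate G K = carrier G" and M: "subgroup M G"
    and pow: "\<And>k. k \<in> K \<Longrightarrow> \<exists>n::nat. n > 0 \<and> k [^] n \<in> M"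
  shows "finite (rcosets M)"
proof -
  from pow obtain n where n: "\<And>k. k \<in> K \<Longrightarrow> n k > 0 \<and> k [^] (n k :: nat) \<in> M" by metis
  define F where "F = (\<lambda>f. M #> (\<Otimes>x\<in>K. x [^] (f x :: int))) ` (PiE K (\<lambda>k. {0..<int (n k)}))"
  have "rcosets M \<subseteq> F"
  proof
    fix C assume "C \<in> rcosets M"
    then obtain g where g: "g \<in> carrier G" "C = M #> g" by (auto simp: RCOSETS_def)
    then have "g \<in> (\<lambda>c. \<Otimes>x\<in>K. x [^] (c x :: int)) ` UNIV"
      using K(3) generate_eq_comb[OF K(1,2)] by simp
    then obtain c where c: "g = (\<Otimes>x\<in>K. x [^] (c x :: int))" by blast
    define r where "r = restrict (\<lambda>x. c x mod int (n x)) K"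
    have r: "r \<in> PiE K (\<lambda>k. {0..<int (n k)})" using n by (auto simp: r_def)
    have "g = (\<Otimes>x\<in>K. x [^] ((int (n x) * (c x div int (n x))) + r x))"
      unfolding c by (rule finprod_cong) (use K in \<open>auto simp: r_def simp_implies_def\<close>)
    then have "g = (\<Otimes>x\<in>K. x [^] (int (n x) * (c x div int (n x)))) \<otimes> (\<Otimes>x\<in>K. x [^] r x)"
      using comb_mult[OF K(1)] by simp
    moreover have "(\<Otimes>x\<in>K. x [^] (int (n x) * (c x div int (n x)))) \<in> M"
    proof (rule finprod_in_subgroup[OF M K(2)], rule)
      fix x assume x: "x \<in> K"
      then have "x [^] (int (n x) * (c x div int (n x))) = (x [^] n x) [^] (c x div int (n x))"
        using K(1) by (simp add: int_pow_pow subsetD flip: int_pow_int)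
      then show "x [^] (int (n x) * (c x div int (n x))) \<in> M"
        using n[OF x] subgroup_int_pow_closed[OF M] by simp
    qed
    ultimately have "g \<in> M #> (\<Otimes>x\<in>K. x [^] r x)" by (auto simp: r_coset_def)
    then have "C = M #> (\<Otimes>x\<in>K. x [^] r x)"
      using repr_independence[OF _ _ M] K(1) g(2) by simp
    then show "C \<in> F" using r by (auto simp: F_def)
  qed
  moreover have "finite F" unfolding F_def using K(2) by (intro finite_imageI finite_PiE) auto
  ultimately show ?thesis by (rule finite_subset)
qed

text \<open>Infinite descent with a multiplicative height: translation at most squares it, and
  doubling raises it at least to the fourth power, up to constants. As 2 < 4, an element of large
  height is a representative times the square of an element of smaller height.\<close>

lemma descent_generators:
  fixes ht :: "'a \<Rightarrow> nat"
  assumes R: "finite R" "R \<subseteq> carrier G"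
    and rep: "\<And>x. x \<in> carrier G \<Longrightarrow> \<exists>r\<in>R. \<exists>z\<in>carrier G. x = r \<otimes> (z \<otimes> z)"
    and fin: "\<And>B. finite {x \<in> carrier G. ht x \<le> B}"
    and trans: "\<And>q. q \<in> carrier G \<Longrightarrow> \<exists>C. \<forall>x\<in>carrier G. ht (x \<otimes> q) \<le> C * ht x ^ 2"
    and dbl: "\<And>x. x \<in> carrier G \<Longrightarrow> ht x ^ 4 \<le> D * ht (x \<otimes> x)"
  obtains K where "finite K" "K \<subseteq> carrier G" "generate G K = carrier G"
proof -
  have "\<exists>C. \<forall>x\<in>carrier G. ht (x \<otimes> inv r) \<le> C * ht x ^ 2" if "r \<in> R" for r
    using trans[of "inv r"] that R(2) by auto
  then obtain C where C: "\<And>r x. r \<in> R \<Longrightarrow> x \<in> carrier G \<Longrightarrow> ht (x \<otimes> inv r) \<le> C r * ht x ^ 2" by metis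
  \<comment> \<open>Above this bound, passing from x to z lowers the height. The inserted 0 keeps
    \<open>Max\<close> away from the empty set.\<close>
  define B where "B = D * Max (insert 0 (C ` R))"
  define K where "K = R \<union> {x \<in> carrier G. ht x \<le> B}"
  have K: "finite K" "K \<subseteq> carrier G" unfolding K_def using R fin by auto
  have "x \<in> generate G K" if "x \<in> carrier G" for x
    using that
  proof (induction "ht x" arbitrary: x rule: less_induct)
    case less
    show ?case
    proof (cases "ht x \<le> B")
      case True
      then show ?thesis using less.prems by (auto intro: generate.incl simp: K_def)
    next
      case False
      from rep[OF less.prems] obtain r z where rz: "r \<in> R" "z \<in> carrier G" "x = r \<otimes> (z \<otimes> z)" by blast
      then have r: "r \<in> carrier G" using R by auto
      have "x = (z \<otimes> z) \<otimes> r" using rz r by (simp add: m_comm)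
      then have zz: "z \<otimes> z = x \<otimes> inv r" using rz(2) r by (simp add: m_assoc)
      have "ht z < ht x"
      proof (rule ccontr)
        assume "\<not> ht z < ht x"
        then have "ht x ^ 4 \<le> ht z ^ 4" by (intro power_mono) auto
        also have "\<dots> \<le> D * ht (x \<otimes> inv r)" using dbl[OF rz(2)] zz by simp
        also have "\<dots> \<le> D * (C r * ht x ^ 2)" using C[OF rz(1) less.prems] by simp
        also have "\<dots> \<le> D * (Max (insert 0 (C ` R)) * ht x ^ 2)"
          using R(1) rz(1) by (intro mult_left_mono mult_right_mono Max_ge) auto
        also have "\<dots> = B * ht x ^ 2" by (simp add: B_def)
        finally have "ht x ^ 2 * ht x ^ 2 \<le> B * ht x ^ 2" by (simp flip: power_add)
        then have "ht x ^ 2 \<le> B" using False unfolding mult_le_cancel2 by auto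
        moreover have "ht x \<le> ht x ^ 2" by (simp add: power2_eq_square)
        ultimately show False using False by simp
      qed
      then have "z \<in> generate G K" using less.hyps rz(2) by blast
      moreover have "r \<in> generate G K" using rz(1) by (auto intro: generate.incl simp: K_def)
      ultimately show ?thesis unfolding rz(3) by (intro generate.eng)
    qed
  qed
  moreover have "generate G K \<subseteq> carrier G" using K(2) by (rule generate_incl)
  ultimately show ?thesis using that K by blast
qed

text \<open>Take a largest independent set between S and S \<union> K: adding any further element of
  K creates a relation in which that element has nonzero exponent. For a generating set K this
  yields a subgroup of finite index.\<close>

lemma independent_extension:
  assumes S: "finite S" "S \<subseteq> carrier G" "int_independent G S" and K: "finite K" "K \<subseteq> carrier G"
  obtains T where "finite T" "S \<subseteq> T" "T \<subseteq> carrier G" "int_independent G T"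
    "\<And>k. k \<in> K \<Longrightarrow> \<exists>n::nat. n > 0 \<and> k [^] n \<in> generate G T"
proof -
  define P where "P T \<longleftrightarrow> S \<subseteq> T \<and> T \<subseteq> S \<union> K \<and> int_independent G T" for T
  have PS: "P S" using S by (simp add: P_def)
  have "\<forall>T. P T \<longrightarrow> card T < Suc (card (S \<union> K))"
    unfolding P_def less_Suc_eq_le using card_mono[of "S \<union> K"] S(1) K(1) by blast
  from ex_has_greatest_nat[OF PS this]
  obtain T where T: "P T" "\<And>T'. P T' \<Longrightarrow> card T' \<le> card T" by auto
  have Tf: "finite T" "T \<subseteq> carrier G" 
    using T(1) S K unfolding P_def by (meson finite_UnI finite_subset, blast)
  have "\<exists>n::nat. n > 0 \<and> k [^] n \<in> generate G T" if k: "k \<in> K" for k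
  proof (cases "k \<in> T")
    case True
    then have "k [^] (1 :: nat) = k" using Tf by auto
    then show ?thesis using True by (intro exI[of _ 1]) (simp add: generate.incl)
  next
    case False
    have kc: "k \<in> carrier G" using k K by auto
    have "\<not> P (insert k T)" using T(2)[of "insert k T"] False Tf by auto
    then have "\<not> int_independent G (insert k T)" using T(1) k by (auto simp: P_def)
    then obtain c where c: "(\<Otimes>x\<in>insert k T. x [^] (c x :: int)) = \<one>" "\<exists>x\<in>insert k T. c x \<noteq> 0"
      by (auto simp: int_independent_def)
    have e: "k [^] c k \<otimes> (\<Otimes>x\<in>T. x [^] c x) = \<one>"
      using c(1) False Tf kc by (subst (asm) finprod_insert) auto
    have ck: "c k \<noteq> 0"
    proof
      assume "c k = 0"
      then have "(\<Otimes>x\<in>T. x [^] c x) = \<one>" using e Tf by simp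
      then have "\<forall>x\<in>T. c x = 0" using T(1) by (auto simp: P_def int_independent_def)
      with \<open>c k = 0\<close> c(2) show False by auto
    qed
    have sg: "subgroup (generate G T) G" using Tf(2) by (rule generate_is_subgroup)
    have "k [^] c k = inv (\<Otimes>x\<in>T. x [^] c x)" using e Tf kc by (simp add: inv_equality)
    also have "\<dots> \<in> generate G T" using generate_eq_comb[OF Tf(2,1)] sg by (auto intro!: subgroup.m_inv_closed)
    finally have kg: "k [^] c k \<in> generate G T" .
    have "k [^] (\<bar>c k\<bar>) \<in> generate G T"
    proof (cases "c k \<ge> 0")
      case False
      then have "k [^] \<bar>c k\<bar> = inv (k [^] c k)" using kc by (simp add: int_pow_neg)
      then show ?thesis using kg sg by (simp add: subgroup.m_inv_closed)
    qed (use kg in simp)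
    then have "k [^] (nat \<bar>c k\<bar>) \<in> generate G T" by (simp flip: int_pow_int)
    then show ?thesis using ck by (intro exI[of _ "nat \<bar>c k\<bar>"]) auto
  qed
  then show ?thesis using that[of T] T(1) Tf by (auto simp: P_def)
qed

end

section \<open>Orders of kernels and images, and comparison of ranks\<close>

lemma (in group_hom) card_kernel_image:
  assumes "finite (carrier G)"
  shows "card (carrier G) = card (kernel G H h) * card (h ` carrier G)"
proof -
  have "inj_on (\<lambda>A. the_elem (h ` A)) (carrier (G Mod kernel G H h))" by (rule FactGroup_inj_on)
  moreover have "(\<lambda>A. the_elem (h ` A)) ` carrier (G Mod kernel G H h) = h ` carrier G"
  proof -
    have "the_elem (h ` (kernel G H h #> x)) = h x" if "x \<in> carrier G" for x
    proof -
      have "h ` (kernel G H h #> x) = {h x}"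
        using that G.one_closed by (force simp: r_coset_def kernel_def)
      then show ?thesis by simp
    qed
    then show ?thesis by (simp add: carrier_FactGroup image_image cong: image_cong)
  qed
  ultimately have "card (rcosets kernel G H h) = card (h ` carrier G)"
    by (metis card_image carrier_FactGroup RCOSETS_def FactGroup_def partial_object.simps(1))
  then show ?thesis using G.lagrange[OF subgroup_kernel] by (simp add: Coset.order_def mult.commute)
qed

lemma (in group) coset_eq_iff:
  assumes "subgroup N G" "x \<in> carrier G" "y \<in> carrier G"
  shows "N #> x = N #> y \<longleftrightarrow> x \<otimes> inv y \<in> N"
proof -
  have "x \<in> N #> y \<longleftrightarrow> x \<otimes> inv y \<in> N"
    using subgroup.rcos_module[OF assms(1) is_group assms(3,2)] .
  then show ?thesis using repr_independence[OF _ assms(3,1), of x] rcos_self[OF assms(2,1)] by metis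
qed

lemma int_independentD:
  "int_independent G S \<Longrightarrow> (\<Otimes>\<^bsub>G\<^esub>x\<in>S. x [^]\<^bsub>G\<^esub> (c x :: int)) = \<one>\<^bsub>G\<^esub> \<Longrightarrow> \<forall>x\<in>S. c x = 0"
  unfolding int_independent_def by (drule spec[where x = c]) (erule mp)

text \<open>Elements of the kernel have trivial square, so a relation among the images becomes a
  relation in G once its coefficients are doubled. Hence independence passes to the images;
  injectivity on the set follows in the same way, from the relation between x and y with exponents 1
  and -1.\<close>

lemma group_rank_mono:
  assumes G: "comm_group G" and H: "comm_group H" and f: "f \<in> hom G H"
    and ker: "\<And>x. x \<in> carrier G \<Longrightarrow> f x = \<one>\<^bsub>H\<^esub> \<Longrightarrow> x \<otimes>\<^bsub>G\<^esub> x = \<one>\<^bsub>G\<^esub>"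
  shows "group_rank G \<le> group_rank H"
  unfolding group_rank_def
proof (rule SUP_mono)
  interpret G: comm_group G by fact
  interpret H: comm_group H by fact
  fix S assume "S \<in> {S. finite S \<and> S \<subseteq> carrier G \<and> int_independent G S}"
  then have S: "finite S" "S \<subseteq> carrier G" "int_independent G S" by auto
  have rel: "\<forall>x\<in>S. c x = 0" if "f (\<Otimes>\<^bsub>G\<^esub>x\<in>S. x [^]\<^bsub>G\<^esub> (c x :: int)) = \<one>\<^bsub>H\<^esub>" for c
  proof -
    have "(\<Otimes>\<^bsub>G\<^esub>x\<in>S. x [^]\<^bsub>G\<^esub> (c x + c x)) = \<one>\<^bsub>G\<^esub>"
      using ker[OF _ that] S(2) by (simp add: G.comb_mult)
    then have "\<forall>x\<in>S. c x + c x = 0" by (rule int_independentD[OF S(3)])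
    then show ?thesis by auto
  qed
  have inj: "inj_on f S"
  proof
    fix x y assume xy: "x \<in> S" "y \<in> S" "f x = f y"
    then have xyc: "x \<in> carrier G" "y \<in> carrier G" using S by auto
    show "x = y"
    proof (rule ccontr)
      assume "x \<noteq> y"
      have "f (x \<otimes>\<^bsub>G\<^esub> inv\<^bsub>G\<^esub> y) = \<one>\<^bsub>H\<^esub>"
        using xy xyc f by (metis G.inv_closed G.is_group G.r_inv H.is_group hom_mult hom_one)
      moreover have "x \<otimes>\<^bsub>G\<^esub> inv\<^bsub>G\<^esub> y =
          (\<Otimes>\<^bsub>G\<^esub>z\<in>S. z [^]\<^bsub>G\<^esub> ((if z = x then 1 else 0) - (if z = y then 1 else 0 :: int)))"
        using G.comb_diff[OF S(2), of "\<lambda>z. if z = x then 1 else 0" "\<lambda>z. if z = y then 1 else 0"]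
        by (simp only: G.comb_single[OF S(2,1) xy(1)] G.comb_single[OF S(2,1) xy(2)])
      ultimately have "\<forall>z\<in>S. (if z = x then 1 else 0) - (if z = y then 1 else 0 :: int) = 0"
        by (intro rel) simp
      with xy \<open>x \<noteq> y\<close> show False by auto
    qed
  qed
  have fS: "f ` S \<subseteq> carrier H" using S(2) f by (auto simp: hom_def)
  have "int_independent H (f ` S)"
    unfolding int_independent_def
  proof (intro allI impI)
    fix c :: "'c \<Rightarrow> int"
    assume c: "(\<Otimes>\<^bsub>H\<^esub>x\<in>f ` S. x [^]\<^bsub>H\<^esub> c x) = \<one>\<^bsub>H\<^esub>"
    have "f (\<Otimes>\<^bsub>G\<^esub>x\<in>S. x [^]\<^bsub>G\<^esub> c (f x)) = (\<Otimes>\<^bsub>H\<^esub>x\<in>S. f (x [^]\<^bsub>G\<^esub> c (f x)))"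
      by (rule hom_finprod[OF G H f S(1)]) (use S(2) in auto)
    also have "\<dots> = (\<Otimes>\<^bsub>H\<^esub>x\<in>S. f x [^]\<^bsub>H\<^esub> c (f x))"
      by (rule H.finprod_cong) (use S(2) f fS G.is_group H.is_group in
          \<open>auto simp: hom_int_pow simp_implies_def intro: hom_in_carrier[OF f]\<close>)
    also have "\<dots> = (\<Otimes>\<^bsub>H\<^esub>x\<in>f ` S. x [^]\<^bsub>H\<^esub> c x)"
      by (rule H.finprod_reindex[symmetric]) (use fS inj in auto)
    finally have "\<forall>x\<in>S. c (f x) = 0" using c by (intro rel) simp
    then show "\<forall>y\<in>f ` S. c y = 0" by simp
  qed
  then show "\<exists>T\<in>{S. finite S \<and> S \<subseteq> carrier H \<and> int_independent H S}. enat (card S) \<le> enat (card T)"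
    using S fS inj by (intro bexI[of _ "f ` S"]) (auto simp: card_image)
qed

text \<open>Separates the group theory from the curves. \<open>c\<close> and \<open>c'\<close> are
  labels with finitely many values rather than homomorphisms: equal labels only have to put a
  quotient into the image of the other map. Since t' lies outside the image of
  \<open>\<phi>\<close>, it remains nontrivial modulo the image of any subgroup of G.\<close>

locale two_isogeny_descent = G: comm_group G + H: comm_group H
  for G :: "('a, 'm) monoid_scheme" (structure) and H :: "('b, 'n) monoid_scheme" +
  fixes \<phi> :: "'a \<Rightarrow> 'b" and \<psi> :: "'b \<Rightarrow> 'a" and t :: 'a and t' :: 'b
    and c :: "'a \<Rightarrow> 'c" and c' :: "'b \<Rightarrow> 'd" and ht :: "'a \<Rightarrow> nat" and D :: nat
  assumes \<phi>: "\<phi> \<in> hom G H" and \<psi>: "\<psi> \<in> hom H G"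
    and \<psi>\<phi>: "\<And>x. x \<in> carrier G \<Longrightarrow> \<psi> (\<phi> x) = x \<otimes> x"
    and t: "t \<in> carrier G" "t \<noteq> \<one>" "\<phi> t = \<one>\<^bsub>H\<^esub>"
    and t': "t' \<in> carrier H" "t' \<notin> \<phi> ` carrier G" "\<psi> t' = \<one>"
    and finite_c: "finite (c ` carrier G)" and finite_c': "finite (c' ` carrier H)"
    and c: "\<And>x y. x \<in> carrier G \<Longrightarrow> y \<in> carrier G \<Longrightarrow> c x = c y \<Longrightarrow> x \<otimes> inv y \<in> \<psi> ` carrier H"
    and c': "\<And>x y. x \<in> carrier H \<Longrightarrow> y \<in> carrier H \<Longrightarrow> c' x = c' y
      \<Longrightarrow> x \<otimes>\<^bsub>H\<^esub> inv\<^bsub>H\<^esub> y \<in> \<phi> ` carrier G"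
    and northcott: "\<And>B. finite {x \<in> carrier G. ht x \<le> B}"
    and ht_translate: "\<And>q. q \<in> carrier G \<Longrightarrow> \<exists>C. \<forall>x\<in>carrier G. ht (x \<otimes> q) \<le> C * ht x ^ 2"
    and ht_double: "\<And>x. x \<in> carrier G \<Longrightarrow> ht x ^ 4 \<le> D * ht (x \<otimes> x)"
begin

sublocale \<phi>: group_hom G H \<phi> using \<phi> by unfold_locales
sublocale \<psi>: group_hom H G \<psi> using \<psi> by unfold_locales

definition rep where "rep = inv_into (carrier G) c"
definition rep' where "rep' = inv_into (carrier H) c'"

lemma rep: "x \<in> carrier G \<Longrightarrow> rep (c x) \<in> carrier G \<and> x \<otimes> inv (rep (c x)) \<in> \<psi> ` carrier H"
  using inv_into_into[of "c x" c "carrier G"] f_inv_into_f[of "c x" c "carrier G"] c[of x "rep (c x)"]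
  unfolding rep_def by auto

lemma rep': "y \<in> carrier H \<Longrightarrow> rep' (c' y) \<in> carrier H \<and> y \<otimes>\<^bsub>H\<^esub> inv\<^bsub>H\<^esub> (rep' (c' y)) \<in> \<phi> ` carrier G"
  using inv_into_into[of "c' y" c' "carrier H"] f_inv_into_f[of "c' y" c' "carrier H"] c'[of y "rep' (c' y)"]
  unfolding rep'_def by auto

text \<open>x is \<psi> y times a representative, and y is \<phi> z times a representative. So up to
  finitely many factors x is \<psi> (\<phi> z) = z \<otimes> z, which is the weak Mordell-Weil
  property; the height then produces generators.\<close>

lemma finitely_generated:
  obtains K where "finite K" "K \<subseteq> carrier G" "generate G K = carrier G"
proof -
  define R where "R = (\<lambda>(l, l'). rep l \<otimes> \<psi> (rep' l')) ` (c ` carrier G \<times> c' ` carrier H)"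
  show thesis
  proof (rule G.descent_generators[of R ht D])
    show "finite R" unfolding R_def using finite_c finite_c' by blast
    show "R \<subseteq> carrier G" unfolding R_def using rep rep' by auto
    fix x assume x: "x \<in> carrier G"
    obtain y where y: "y \<in> carrier H" "x \<otimes> inv (rep (c x)) = \<psi> y" using rep[OF x] by auto
    obtain z where z: "z \<in> carrier G" "y \<otimes>\<^bsub>H\<^esub> inv\<^bsub>H\<^esub> (rep' (c' y)) = \<phi> z" using rep'[OF y(1)] by auto
    have "x = \<psi> y \<otimes> rep (c x)" using x rep[OF x] y by (simp add: G.inv_solve_right')
    moreover have "y = \<phi> z \<otimes>\<^bsub>H\<^esub> rep' (c' y)" using y(1) rep'[OF y(1)] z by (simp add: H.inv_solve_right')
    then have "\<psi> y = (z \<otimes> z) \<otimes> \<psi> (rep' (c' y))"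
      using z rep'[OF y(1)] \<psi>\<phi>[OF z(1)] by (metis \<psi>.hom_mult \<phi>.hom_closed)
    ultimately have "x = (rep (c x) \<otimes> \<psi> (rep' (c' y))) \<otimes> (z \<otimes> z)"
      using rep[OF x] rep'[OF y(1)] z by (simp add: G.m_ac)
    then show "\<exists>r\<in>R. \<exists>z\<in>carrier G. x = r \<otimes> (z \<otimes> z)"
      using x y z by (intro bexI[of _ "rep (c x) \<otimes> \<psi> (rep' (c' y))"] bexI[of _ z]) (auto simp: R_def)
  qed (use northcott ht_translate ht_double that in auto)
qed

text \<open>Since \<open>\<langle>T\<rangle>\<close> has finite index, one may consider the finite groups \<open>Q\<close> and \<open>Q'\<close>
  obtained from \<open>G\<close> and \<open>H\<close> by dividing out the squares of \<open>\<langle>T\<rangle>\<close> and its image under \<open>\<phi>\<close>. As they are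
  finite, the cokernels of \<open>\<phi> : Q \<rightarrow> Q'\<close> and \<open>\<psi> : Q' \<rightarrow> Q\<close> have together as many elements as
  the kernels, and the kernels contain \<open>\<langle>T, t\<rangle>\<close> and \<open>t'\<close>.\<close>

lemma independent_bound_finite_index:
  assumes T: "finite T" "T \<subseteq> carrier G" "int_independent G T"
    and K: "finite K" "K \<subseteq> carrier G" "generate G K = carrier G"
    and pow: "\<And>k. k \<in> K \<Longrightarrow> \<exists>n::nat. n > 0 \<and> k [^] n \<in> generate G T"
  shows "2 ^ card T * 4 \<le> card (c ` carrier G) * card (c' ` carrier H)"
proof -
  define N where "N = generate G T"
  define N2 where "N2 = (\<lambda>x. x \<otimes> x) ` N"
  define M where "M = \<phi> ` N"
  have N: "subgroup N G" unfolding N_def using T(2) by (rule G.generate_is_subgroup)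
  have Nc: "N \<subseteq> carrier G" using N by (rule subgroup.subset)
  have N2: "subgroup N2 G"
  proof (rule G.subgroupI)
    fix a b assume "a \<in> N2" "b \<in> N2"
    then obtain u v where uv: "u \<in> N" "a = u \<otimes> u" "v \<in> N" "b = v \<otimes> v" by (auto simp: N2_def)
    then have "a \<otimes> b = (u \<otimes> v) \<otimes> (u \<otimes> v)" using Nc by (simp add: G.m_ac subsetD)
    then show "a \<otimes> b \<in> N2" using uv N by (auto simp: N2_def intro: subgroup.m_closed)
  next
    fix a assume "a \<in> N2"
    then obtain u where u: "u \<in> N" "a = u \<otimes> u" by (auto simp: N2_def)
    then have "inv a = inv u \<otimes> inv u" using Nc by (simp add: G.inv_mult subsetD)
    then show "inv a \<in> N2" using u N by (auto simp: N2_def intro: subgroup.m_inv_closed)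
  qed (use Nc subgroup.one_closed[OF N] in \<open>auto simp: N2_def\<close>)
  have M: "subgroup M H" unfolding M_def using N by (rule \<phi>.subgroup_img_is_subgroup)
  have nN2: "N2 \<lhd> G" using N2 by (simp add: G.subgroup_imp_normal)
  have nM: "M \<lhd> H" using M by (simp add: H.subgroup_imp_normal)
  define Q where "Q = G Mod N2"
  define Q' where "Q' = H Mod M"
  interpret Q: comm_group Q unfolding Q_def using N2 by (rule G.abelian_FactGroup)
  interpret Q': comm_group Q' unfolding Q'_def using M by (rule H.abelian_FactGroup)
  have Qc: "carrier Q = (\<lambda>x. N2 #> x) ` carrier G" by (simp add: Q_def carrier_FactGroup)
  have Q'c: "carrier Q' = (\<lambda>y. M #>\<^bsub>H\<^esub> y) ` carrier H" by (simp add: Q'_def carrier_FactGroup)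
  have pi: "(\<lambda>x. N2 #> x) \<in> hom G Q" unfolding Q_def by (rule normal.r_coset_hom_Mod[OF nN2])
  have pi': "(\<lambda>y. M #>\<^bsub>H\<^esub> y) \<in> hom H Q'" unfolding Q'_def by (rule normal.r_coset_hom_Mod[OF nM])
  have oneQ: "\<one>\<^bsub>Q\<^esub> = N2" "\<one>\<^bsub>Q'\<^esub> = M" by (simp_all add: Q_def Q'_def)
  have coset_G: "x \<otimes> inv y \<in> N2 \<longleftrightarrow> N2 #> x = N2 #> y" if "x \<in> carrier G" "y \<in> carrier G" for x y
    using G.coset_eq_iff[OF N2] that by simp
  have coset_H: "x \<otimes>\<^bsub>H\<^esub> inv\<^bsub>H\<^esub> y \<in> M \<longleftrightarrow> M #>\<^bsub>H\<^esub> x = M #>\<^bsub>H\<^esub> y" if "x \<in> carrier H" "y \<in> carrier H" for x y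
    using H.coset_eq_iff[OF M] that by simp
  obtain f where f: "f \<in> hom Q Q'" "\<And>x. x \<in> carrier G \<Longrightarrow> f (N2 #> x) = M #>\<^bsub>H\<^esub> \<phi> x"
  proof -
    have h: "(\<lambda>y. M #>\<^bsub>H\<^esub> y) \<circ> \<phi> \<in> hom G Q'" using pi' \<phi> by (rule hom_compose[rotated])
    show thesis
    proof (rule FactGroup_universal[OF h nN2])
      fix x y assume xy: "x \<in> carrier G" "y \<in> carrier G" "N2 #> x = N2 #> y"
      obtain u where u: "u \<in> N" "x \<otimes> inv y = u \<otimes> u" using coset_G[OF xy(1,2)] xy(3) by (auto simp: N2_def)
      have "\<phi> x \<otimes>\<^bsub>H\<^esub> inv\<^bsub>H\<^esub> \<phi> y = \<phi> (x \<otimes> inv y)" using xy by simp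
      also have "\<dots> = \<phi> (u \<otimes> u)" by (simp only: u(2))
      also have "\<dots> \<in> M" using u(1) N by (auto simp: M_def intro: subgroup.m_closed)
      finally show "((\<lambda>y. M #>\<^bsub>H\<^esub> y) \<circ> \<phi>) x = ((\<lambda>y. M #>\<^bsub>H\<^esub> y) \<circ> \<phi>) y" using coset_H xy by simp
    next
      fix h assume "h \<in> hom (G Mod N2) Q'" "\<And>x. x \<in> carrier G \<Longrightarrow> h (N2 #> x) = ((\<lambda>y. M #>\<^bsub>H\<^esub> y) \<circ> \<phi>) x"
      then show thesis by (intro that[of h]) (simp_all add: Q_def)
    qed
  qed
  obtain g where g: "g \<in> hom Q' Q" "\<And>y. y \<in> carrier H \<Longrightarrow> g (M #>\<^bsub>H\<^esub> y) = N2 #> \<psi> y"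
  proof -
    have h: "(\<lambda>y. N2 #> y) \<circ> \<psi> \<in> hom H Q" using pi \<psi> by (rule hom_compose[rotated])
    show thesis
    proof (rule FactGroup_universal[OF h nM])
      fix x y assume xy: "x \<in> carrier H" "y \<in> carrier H" "M #>\<^bsub>H\<^esub> x = M #>\<^bsub>H\<^esub> y"
      obtain u where u: "u \<in> N" "x \<otimes>\<^bsub>H\<^esub> inv\<^bsub>H\<^esub> y = \<phi> u" using coset_H[OF xy(1,2)] xy(3) by (auto simp: M_def)
      have "\<psi> x \<otimes> inv \<psi> y = \<psi> (x \<otimes>\<^bsub>H\<^esub> inv\<^bsub>H\<^esub> y)" using xy by simp
      also have "\<dots> = u \<otimes> u" using u Nc by (simp add: \<psi>\<phi> subsetD)
      also have "\<dots> \<in> N2" using u(1) by (simp add: N2_def)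
      finally show "((\<lambda>y. N2 #> y) \<circ> \<psi>) x = ((\<lambda>y. N2 #> y) \<circ> \<psi>) y" using coset_G xy by simp
    next
      fix h assume "h \<in> hom (H Mod M) Q" "\<And>x. x \<in> carrier H \<Longrightarrow> h (M #>\<^bsub>H\<^esub> x) = ((\<lambda>y. N2 #> y) \<circ> \<psi>) x"
      then show thesis by (intro that[of h]) (simp_all add: Q'_def)
    qed
  qed
  interpret f: group_hom Q Q' f using f(1) by unfold_locales
  interpret g: group_hom Q' Q g using g(1) by unfold_locales
  have finQ: "finite (carrier Q)"
  proof -
    have "finite (rcosets N2)"
    proof (rule G.finite_rcosets[OF K(2,1,3) N2])
      fix k assume k: "k \<in> K"
      then obtain n :: nat where n: "n > 0" "k [^] n \<in> N" using pow by (auto simp: N_def)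
      have "k [^] (n + n) = k [^] n \<otimes> k [^] n" using k K(2) by (simp add: G.nat_pow_mult subsetD)
      then show "\<exists>n::nat. n > 0 \<and> k [^] n \<in> N2" using n by (intro exI[of _ "n + n"]) (auto simp: N2_def)
    qed
    then show ?thesis by (simp add: Q_def FactGroup_def)
  qed
  \<comment> \<open>Every class in the cokernel is that of the chosen representative of some label,
    so the number of labels bounds its order.\<close>
  have decomp': "M #>\<^bsub>H\<^esub> y \<in> (f ` carrier Q) #>\<^bsub>Q'\<^esub> (M #>\<^bsub>H\<^esub> rep' (c' y))" if y: "y \<in> carrier H" for y
  proof -
    obtain z where z: "z \<in> carrier G" "y \<otimes>\<^bsub>H\<^esub> inv\<^bsub>H\<^esub> (rep' (c' y)) = \<phi> z" using rep'[OF y] by auto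
    then have "y = \<phi> z \<otimes>\<^bsub>H\<^esub> rep' (c' y)" using y rep'[OF y] by (simp add: H.inv_solve_right')
    then have "M #>\<^bsub>H\<^esub> y = (M #>\<^bsub>H\<^esub> \<phi> z) \<otimes>\<^bsub>Q'\<^esub> (M #>\<^bsub>H\<^esub> rep' (c' y))"
      using hom_mult[OF pi', of "\<phi> z" "rep' (c' y)"] z rep'[OF y] by simp
    also have "M #>\<^bsub>H\<^esub> \<phi> z = f (N2 #> z)" using f(2) z by simp
    finally show ?thesis using z(1) by (auto simp: r_coset_def Qc)
  qed
  have decomp: "N2 #> x \<in> (g ` carrier Q') #>\<^bsub>Q\<^esub> (N2 #> rep (c x))" if x: "x \<in> carrier G" for x
  proof -
    obtain z where z: "z \<in> carrier H" "x \<otimes> inv (rep (c x)) = \<psi> z" using rep[OF x] by auto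
    then have "x = \<psi> z \<otimes> rep (c x)" using x rep[OF x] by (simp add: G.inv_solve_right')
    then have "N2 #> x = (N2 #> \<psi> z) \<otimes>\<^bsub>Q\<^esub> (N2 #> rep (c x))"
      using hom_mult[OF pi, of "\<psi> z" "rep (c x)"] z rep[OF x] by simp
    also have "N2 #> \<psi> z = g (M #>\<^bsub>H\<^esub> z)" using g(2) z by simp
    finally show ?thesis using z(1) by (auto simp: r_coset_def Q'c)
  qed
  have fi: "subgroup (f ` carrier Q) Q'" by (rule f.img_is_subgroup)
  have gi: "subgroup (g ` carrier Q') Q" by (rule g.img_is_subgroup)
  have cok': "rcosets\<^bsub>Q'\<^esub> (f ` carrier Q) \<subseteq> (\<lambda>l. (f ` carrier Q) #>\<^bsub>Q'\<^esub> (M #>\<^bsub>H\<^esub> rep' l)) ` c' ` carrier H"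
  proof
    fix C assume "C \<in> rcosets\<^bsub>Q'\<^esub> (f ` carrier Q)"
    then obtain y where y: "y \<in> carrier H" "C = (f ` carrier Q) #>\<^bsub>Q'\<^esub> (M #>\<^bsub>H\<^esub> y)"
      by (auto simp: RCOSETS_def Q'c)
    have "(f ` carrier Q) #>\<^bsub>Q'\<^esub> (M #>\<^bsub>H\<^esub> rep' (c' y)) = C"
      unfolding y(2) by (rule Q'.repr_independence[OF decomp'[OF y(1)] _ fi]) (use rep'[OF y(1)] in \<open>auto simp: Q'c\<close>)
    then show "C \<in> (\<lambda>l. (f ` carrier Q) #>\<^bsub>Q'\<^esub> (M #>\<^bsub>H\<^esub> rep' l)) ` c' ` carrier H" using y(1) by blast
  qed
  have cok: "rcosets\<^bsub>Q\<^esub> (g ` carrier Q') \<subseteq> (\<lambda>l. (g ` carrier Q') #>\<^bsub>Q\<^esub> (N2 #> rep l)) ` c ` carrier G"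
  proof
    fix C assume "C \<in> rcosets\<^bsub>Q\<^esub> (g ` carrier Q')"
    then obtain y where y: "y \<in> carrier G" "C = (g ` carrier Q') #>\<^bsub>Q\<^esub> (N2 #> y)"
      by (auto simp: RCOSETS_def Qc)
    have "(g ` carrier Q') #>\<^bsub>Q\<^esub> (N2 #> rep (c y)) = C"
      unfolding y(2) by (rule Q.repr_independence[OF decomp[OF y(1)] _ gi]) (use rep[OF y(1)] in \<open>auto simp: Qc\<close>)
    then show "C \<in> (\<lambda>l. (g ` carrier Q') #>\<^bsub>Q\<^esub> (N2 #> rep l)) ` c ` carrier G" using y(1) by blast
  qed
  have card_cok': "card (rcosets\<^bsub>Q'\<^esub> (f ` carrier Q)) \<le> card (c' ` carrier H)"
    using card_mono[OF finite_imageI[OF finite_c'] cok'] card_image_le[OF finite_c'] by (rule le_trans)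
  have card_cok: "card (rcosets\<^bsub>Q\<^esub> (g ` carrier Q')) \<le> card (c ` carrier G)"
    using card_mono[OF finite_imageI[OF finite_c] cok] card_image_le[OF finite_c] by (rule le_trans)
  have finQ': "finite (carrier Q')"
  proof -
    have "finite (\<Union>(rcosets\<^bsub>Q'\<^esub> (f ` carrier Q)))"
      using finite_subset[OF cok'] finite_c' finQ
      by (intro finite_Union) (auto simp: RCOSETS_def r_coset_def)
    then show ?thesis using Q'.rcosets_part_G[OF fi] by simp
  qed
  have "2 ^ card T * 2 \<le> card (kernel Q Q' f)"
  proof -
    \<comment> \<open>These are the 2^(card T + 1) elements whose classes lie in the kernel of
      \<open>f\<close>: the product over a subset A of T, possibly times t. Their images under
      \<phi> lie in M because \<phi> t is trivial.\<close>
    define z where "z A e = (\<Otimes>x\<in>T. x [^] (if x \<in> A then 1 else 0 :: int)) \<otimes> (if e then t else \<one>)" for A e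
    have zc: "z A e \<in> carrier G" for A e using T(2) t(1) by (simp add: z_def)
    have comb_N: "(\<Otimes>x\<in>T. x [^] (a x :: int)) \<in> N" for a
      using G.generate_eq_comb[OF T(2,1)] by (auto simp: N_def)
    have tt: "t \<otimes> t = \<one>" using \<psi>\<phi>[OF t(1)] t(3) by simp
    \<comment> \<open>Independence makes N torsion-free, whereas t has order 2.\<close>
    have tN: "t \<notin> N"
    proof
      assume "t \<in> N"
      then obtain a where a: "t = (\<Otimes>x\<in>T. x [^] (a x :: int))" using G.generate_eq_comb[OF T(2,1)] by (auto simp: N_def)
      then have "(\<Otimes>x\<in>T. x [^] (a x + a x)) = \<one>" using tt by (simp add: G.comb_mult[OF T(2)])
      then have "\<forall>x\<in>T. a x + a x = 0" by (rule int_independentD[OF T(3)])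
      then have "t = \<one>" unfolding a by (intro G.comb_zero) auto
      with t(2) show False ..
    qed
    have inj: "inj_on (\<lambda>(A, e). N2 #> z A e) (Pow T \<times> UNIV)"
    proof (rule inj_onI, clarify)
      fix A e B d assume AB: "A \<subseteq> T" "B \<subseteq> T" "N2 #> z A e = N2 #> z B d"
      define w where "w = (\<Otimes>x\<in>T. x [^] ((if x \<in> A then 1 else 0) - (if x \<in> B then 1 else 0 :: int)))"
      have wN: "w \<in> N" unfolding w_def by (rule comb_N)
      have "z A e \<otimes> inv z B d \<in> N2" using AB(3) coset_G zc by simp
      then obtain u where u: "u \<in> N" "z A e \<otimes> inv z B d = u \<otimes> u" by (auto simp: N2_def)
      have "z A e \<otimes> inv z B d = w \<otimes> ((if e then t else \<one>) \<otimes> inv (if d then t else \<one>))"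
        unfolding w_def z_def G.comb_diff[OF T(2), symmetric] using T(2) t(1)
        by (simp add: G.inv_mult G.m_ac)
      then have eq: "u \<otimes> u = w \<otimes> ((if e then t else \<one>) \<otimes> inv (if d then t else \<one>))" using u(2) by simp
      have ed: "e = d"
      proof (rule ccontr)
        assume "e \<noteq> d"
        moreover have "inv t = t" using tt t(1) by (simp add: G.inv_equality)
        ultimately have "(if e then t else \<one>) \<otimes> inv (if d then t else \<one>) = t" using t(1) by auto
        then have "t = inv w \<otimes> (u \<otimes> u)" using eq wN u(1) Nc t(1)
          by (simp add: G.inv_solve_left subsetD)
        also have "\<dots> \<in> N" using wN u(1) N by (intro subgroup.m_closed subgroup.m_inv_closed)
        finally show False using tN by simp
      qed
      then have "u \<otimes> u = w" using eq wN Nc t(1) by (auto simp: subsetD)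
      moreover obtain a where a: "u = (\<Otimes>x\<in>T. x [^] (a x :: int))"
        using u(1) G.generate_eq_comb[OF T(2,1)] by (auto simp: N_def)
      ultimately have "(\<Otimes>x\<in>T. x [^] (a x + a x)) \<otimes> inv w = \<one>"
        using wN Nc by (auto simp: G.comb_mult[OF T(2)])
      then have "(\<Otimes>x\<in>T. x [^] ((a x + a x) - ((if x \<in> A then 1 else 0) - (if x \<in> B then 1 else 0)))) = \<one>"
        unfolding w_def G.comb_diff[OF T(2)] .
      then have "\<forall>x\<in>T. (a x + a x) - ((if x \<in> A then 1 else 0) - (if x \<in> B then 1 else 0)) = 0"
        by (rule int_independentD[OF T(3)])
      then have *: "(if x \<in> A then 1 else 0) - (if x \<in> B then 1 else 0) = 2 * a x" if "x \<in> T" for x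
        using that by (simp del: diff_eq_eq)
      \<comment> \<open>Modulo squares of N only the parity of exponents counts, and exponents 0 or
        1 with even difference are equal.\<close>
      have "x \<in> A \<longleftrightarrow> x \<in> B" if "x \<in> T" for x
      proof -
        have "even ((if x \<in> A then 1 else 0) - (if x \<in> B then 1 else 0 :: int))"
          unfolding *[OF that] by simp
        then show ?thesis by (auto split: if_splits)
      qed
      then show "A = B \<and> e = d" using AB ed by blast
    qed
    have "(\<lambda>(A, e). N2 #> z A e) ` (Pow T \<times> UNIV) \<subseteq> kernel Q Q' f"
    proof clarify
      fix A e
      have "\<phi> (z A e) \<in> M"
        unfolding z_def using t comb_N T(2) by (auto simp: M_def \<phi>.hom_mult)
      then have "M #>\<^bsub>H\<^esub> \<phi> (z A e) = M" using M zc by (simp add: H.coset_join2)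
      then show "N2 #> z A e \<in> kernel Q Q' f" using zc f(2) oneQ by (auto simp: kernel_def Qc)
    qed
    moreover have "finite (kernel Q Q' f)" using finQ by (simp add: kernel_def)
    ultimately have "card (Pow T \<times> (UNIV :: bool set)) \<le> card (kernel Q Q' f)"
      using inj by (metis card_image card_mono)
    then show ?thesis using T(1) by (simp add: card_cartesian_product card_Pow)
  qed
  moreover have "2 \<le> card (kernel Q' Q g)"
  proof -
    have "M #>\<^bsub>H\<^esub> t' \<noteq> M"
    proof
      assume "M #>\<^bsub>H\<^esub> t' = M"
      then have "t' \<in> M" using H.coset_join1[OF _ t'(1) M] by simp
      then show False using t'(2) Nc by (auto simp: M_def)
    qed
    have "g (M #>\<^bsub>H\<^esub> t') = N2"
      using g(2)[OF t'(1)] t'(3) G.coset_join2[OF G.one_closed N2 subgroup.one_closed[OF N2]] by simp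
    then have "M #>\<^bsub>H\<^esub> t' \<in> kernel Q' Q g"
      unfolding kernel_def Q'c oneQ(1) using t'(1) by blast
    moreover have "M \<in> kernel Q' Q g"
      using oneQ Q'.one_closed g.hom_one by (simp add: kernel_def)
    ultimately have "card {M, M #>\<^bsub>H\<^esub> t'} \<le> card (kernel Q' Q g)"
      using finQ' by (intro card_mono) (auto simp: kernel_def)
    then show ?thesis using \<open>M #>\<^bsub>H\<^esub> t' \<noteq> M\<close> by simp
  qed
  ultimately have "2 ^ card T * 2 * 2 \<le> card (kernel Q Q' f) * card (kernel Q' Q g)"
    by (rule mult_le_mono)
  \<comment> \<open>For maps in both directions between two finite groups, computing the product of
    the two orders once from kernels and images, once by Lagrange, shows that kernels and cokernels
    have the same product of orders.\<close>
  also have "\<dots> = card (rcosets\<^bsub>Q\<^esub> (g ` carrier Q')) * card (rcosets\<^bsub>Q'\<^esub> (f ` carrier Q))"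
  proof -
    define x y where "x = card (f ` carrier Q)" and "y = card (g ` carrier Q')"
    have xy: "x > 0" "y > 0" unfolding x_def y_def using finQ finQ' Q.one_closed Q'.one_closed
      by (auto simp: card_gt_0_iff)
    have 1: "card (carrier Q) = card (kernel Q Q' f) * x" unfolding x_def by (rule f.card_kernel_image[OF finQ])
    have 2: "card (carrier Q') = card (kernel Q' Q g) * y" unfolding y_def by (rule g.card_kernel_image[OF finQ'])
    have 3: "card (rcosets\<^bsub>Q'\<^esub> (f ` carrier Q)) * x = card (carrier Q')"
      using Q'.lagrange[OF fi] by (simp add: x_def Coset.order_def)
    have 4: "card (rcosets\<^bsub>Q\<^esub> (g ` carrier Q')) * y = card (carrier Q)"
      using Q.lagrange[OF gi] by (simp add: y_def Coset.order_def)
    have "(card (kernel Q Q' f) * card (kernel Q' Q g)) * (x * y) = card (carrier Q) * card (carrier Q')"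
      by (simp add: 1 2)
    also have "\<dots> = (card (rcosets\<^bsub>Q\<^esub> (g ` carrier Q')) * card (rcosets\<^bsub>Q'\<^esub> (f ` carrier Q))) * (x * y)"
      by (simp add: 3[symmetric] 4[symmetric])
    finally show ?thesis using xy by simp
  qed
  also have "\<dots> \<le> card (c ` carrier G) * card (c' ` carrier H)"
    using card_cok card_cok' by (rule mult_le_mono)
  finally show ?thesis by simp
qed

text \<open>An independent set may span a subgroup of infinite index, so it is enlarged to one whose
  span contains a positive power of every generator; the inequality for the larger set implies the
  one for the smaller.\<close>

theorem rank_bound:
  assumes "finite S" "S \<subseteq> carrier G" "int_independent G S"
  shows "2 ^ card S * 4 \<le> card (c ` carrier G) * card (c' ` carrier H)"
proof -
  obtain K where K: "finite K" "K \<subseteq> carrier G" "generate G K = carrier G" by (rule finitely_generated)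
  obtain T where T: "finite T" "S \<subseteq> T" "T \<subseteq> carrier G" "int_independent G T"
    "\<And>k. k \<in> K \<Longrightarrow> \<exists>n::nat. n > 0 \<and> k [^] n \<in> generate G T"
    using G.independent_extension[OF assms K(1,2)] by metis
  have "2 ^ card S * 4 \<le> 2 ^ card T * (4 :: nat)" using card_mono[OF T(1,2)] by simp
  also have "\<dots> \<le> card (c ` carrier G) * card (c' ` carrier H)"
    by (rule independent_bound_finite_index[OF T(1,3,4) K T(5)])
  finally show ?thesis .
qed

end

section \<open>Heights\<close>

definition rat_height :: "rat \<Rightarrow> nat" where
  "rat_height q = nat (max \<bar>fst (quotient_of q)\<bar> \<bar>snd (quotient_of q)\<bar>)"

fun point_height :: "rat point \<Rightarrow> nat" where
  "point_height Infinity = 1"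
| "point_height (Affine x y) = rat_height x"

lemma rat_reduced:
  obtains m n :: int where "q = of_int m / of_int n" "n > 0" "coprime m n" "int (rat_height q) = max \<bar>m\<bar> \<bar>n\<bar>"
proof -
  obtain m n where mn: "quotient_of q = (m, n)" by (cases "quotient_of q")
  show thesis
  proof (rule that)
    show "q = of_int m / of_int n" "n > 0" "coprime m n"
      using quotient_of_div[OF mn] quotient_of_denom_pos[OF mn] quotient_of_coprime[OF mn] by simp_all
    show "int (rat_height q) = max \<bar>m\<bar> \<bar>n\<bar>" by (simp add: rat_height_def mn)
  qed
qed

lemma rat_height_pos: "rat_height q \<ge> 1"
proof -
  obtain m n :: int where "n > 0" "int (rat_height q) = max \<bar>m\<bar> \<bar>n\<bar>" using rat_reduced[of q] by metis
  then show ?thesis by linarith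
qed

lemma rat_fraction:
  fixes q :: rat and u v :: int
  assumes q: "q = of_int u / of_int v" "v \<noteq> 0" and mn: "q = of_int m / of_int n" "n > 0" "coprime m n"
  obtains k where "u = m * k" "v = n * k" "k \<noteq> 0"
proof -
  have "of_int u = q * of_int v" using q by simp
  moreover have "of_int m = q * of_int n" using mn by simp
  ultimately have "(of_int (u * n) :: rat) = of_int (m * v)" by simp
  then have e: "u * n = m * v" by (simp only: of_int_eq_iff)
  have "n dvd m * v" unfolding e[symmetric] by simp
  then have "n dvd v" using mn(3) by (simp add: coprime_dvd_mult_right_iff coprime_commute)
  then obtain k where k: "v = n * k" by blast
  then have "u = m * k" using e mn(2) by simp
  then show thesis using that k q(2) by auto
qed

lemma rat_height_le:
  assumes "q = of_int u / of_int v" "v \<noteq> 0"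
  shows "int (rat_height q) \<le> max \<bar>u\<bar> \<bar>v\<bar>"
proof -
  obtain m n :: int where mn: "q = of_int m / of_int n" "n > 0" "coprime m n"
    and h: "int (rat_height q) = max \<bar>m\<bar> \<bar>n\<bar>" using rat_reduced[of q] by metis
  obtain k where k: "u = m * k" "v = n * k" "k \<noteq> 0" using rat_fraction[OF assms mn] by metis
  have le: "\<bar>z\<bar> \<le> \<bar>z * k\<bar>" for z :: int
    using mult_left_mono[of 1 "\<bar>k\<bar>" "\<bar>z\<bar>"] k(3) by (simp add: abs_mult)
  show ?thesis unfolding h k(1,2) using le[of m] le[of n] by (simp add: max_def)
qed

lemma rat_square_int:
  fixes q :: rat
  assumes "q ^ 2 = of_int z"
  obtains w where "q = of_int w"
proof -
  obtain m n :: int where mn: "q = of_int m / of_int n" "n > 0" "coprime m n" using rat_reduced[of q] by metis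
  have "(of_int (m ^ 2) :: rat) = of_int (z * n ^ 2)"
    using assms mn(1,2) by (simp add: power_divide field_simps)
  then have "m ^ 2 = z * n ^ 2" by (simp only: of_int_eq_iff)
  then have "n dvd m ^ 2" by (simp add: power2_eq_square)
  moreover have "coprime n (m ^ 2)" using mn(3) by (simp add: coprime_commute)
  ultimately have "is_unit n" by (metis coprime_common_divisor dvd_refl)
  then have "n = 1" using mn(2) by simp
  then show thesis using that mn(1) by simp
qed

lemma finite_rat_height: "finite {q. rat_height q \<le> B}"
proof (rule finite_subset)
  show "{q. rat_height q \<le> B} \<subseteq> (\<lambda>(m, n). of_int m / of_int n) ` ({- int B..int B} \<times> {- int B..int B})"
  proof
    fix q assume q: "q \<in> {q. rat_height q \<le> B}"
    obtain m n :: int where mn: "q = of_int m / of_int n" "int (rat_height q) = max \<bar>m\<bar> \<bar>n\<bar>"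
      using rat_reduced[of q] by metis
    then have "\<bar>m\<bar> \<le> int B" "\<bar>n\<bar> \<le> int B" using q by auto
    then show "q \<in> (\<lambda>(m, n). of_int m / of_int n) ` ({- int B..int B} \<times> {- int B..int B})"
      using mn(1) by (intro image_eqI[of _ _ "(m, n)"]) auto
  qed
qed auto

lemma finite_square_roots: "finite {y :: rat. y ^ 2 = c}"
proof (cases "\<exists>z. z ^ 2 = c")
  case True
  then obtain z where "z ^ 2 = c" by blast
  then have "{y. y ^ 2 = c} \<subseteq> {z, - z}" by (auto simp: power2_eq_iff)
  then show ?thesis by (rule finite_subset) simp
qed auto

lemma finite_point_height:
  "finite {P. on_curve (curve a b) P \<and> point_height P \<le> B}"
proof (rule finite_subset)
  show "{P. on_curve (curve a b) P \<and> point_height P \<le> B} \<subseteq>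
    insert Infinity (\<Union>x\<in>{q. rat_height q \<le> B}. Affine x ` {y. y ^ 2 = x ^ 3 + a * x ^ 2 + b * x})"
  proof
    fix P assume "P \<in> {P. on_curve (curve a b) P \<and> point_height P \<le> B}"
    then show "P \<in> insert Infinity (\<Union>x\<in>{q. rat_height q \<le> B}. Affine x ` {y. y ^ 2 = x ^ 3 + a * x ^ 2 + b * x})"
      by (cases P) auto
  qed
qed (use finite_rat_height finite_square_roots in auto)

lemma point_height_pos: "point_height P \<ge> 1"
  using rat_height_pos by (cases P) auto

lemma point_height_halve_scale: "point_height P \<le> 4 * point_height (halve_scale P)"
proof (cases P)
  case (Affine x y)
  obtain m n :: int where mn: "x / 4 = of_int m / of_int n" "n > 0" "int (rat_height (x / 4)) = max \<bar>m\<bar> \<bar>n\<bar>"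
    using rat_reduced[of "x / 4"] by metis
  have "x = of_int (4 * m) / of_int n" using mn(1) by (simp add: field_simps)
  from rat_height_le[OF this] mn have "int (rat_height x) \<le> max \<bar>4 * m\<bar> \<bar>n\<bar>" by simp
  also have "\<dots> \<le> 4 * int (rat_height (x / 4))" unfolding mn(3) by linarith
  finally show ?thesis using Affine by simp
qed simp

section \<open>Height estimates on curves with integral coefficients\<close>

locale integral_cubic =
  fixes a b :: int
  assumes b_nonzero: "b \<noteq> 0" and disc_nonzero: "a ^ 2 - 4 * b \<noteq> 0"
begin

abbreviation W where "W \<equiv> curve (of_int a :: rat) (of_int b)"

sublocale E: nonsingular_cubic "of_int a :: rat" "of_int b"
proof
  have "(of_int (a ^ 2 - 4 * b) :: rat) \<noteq> 0" unfolding of_int_eq_0_iff by (rule disc_nonzero)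
  then show "(of_int a)\<^sup>2 - 4 * of_int b \<noteq> (0 :: rat)" by simp
qed (use b_nonzero in simp)

lemma dual: "integral_cubic (- 2 * a) (a ^ 2 - 4 * b)"
  by unfold_locales (use b_nonzero disc_nonzero in \<open>simp_all add: power2_eq_square\<close>)

text \<open>For x = m / n in lowest terms the image has abscissa (m^2 + a m n + b n^2) / (m n). At
  most a divisor of b cancels, and the numerator together with m n controls both m^2 and
  n^2.\<close>

lemma point_height_isogeny:
  assumes "on_curve W P"
  shows "point_height P ^ 2 \<le> nat ((1 + \<bar>a\<bar> + \<bar>b\<bar>) * \<bar>b\<bar>) * point_height (isogeny (of_int b) P)"
proof -
  have b1: "\<bar>b\<bar> \<ge> 1" using b_nonzero by simp
  have "1 * 1 \<le> (1 + \<bar>a\<bar> + \<bar>b\<bar>) * \<bar>b\<bar>" using b1 by (intro mult_mono) auto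
  then have K1: "nat ((1 + \<bar>a\<bar> + \<bar>b\<bar>) * \<bar>b\<bar>) \<ge> 1" by linarith
  show ?thesis
  proof (cases P)
    case Infinity
    then show ?thesis using K1 by simp
  next
    case (Affine x y)
    show ?thesis
    proof (cases "x = 0")
      case True
      then show ?thesis using K1 Affine by (simp add: rat_height_def)
    next
      case False
      obtain m n :: int where mn: "x = of_int m / of_int n" "n > 0" "coprime m n"
        and h: "int (rat_height x) = max \<bar>m\<bar> \<bar>n\<bar>" using rat_reduced[of x] by metis
      have m0: "m \<noteq> 0" using False mn by auto
      define w where "w = (y / x) ^ 2"
      define s where "s = m ^ 2 + a * m * n + b * n ^ 2"
      have w1: "w = x + of_int a + of_int b / x" unfolding w_def using E.affine_param assms Affine False by simp
      have "w * (of_int m * of_int n) = (x * of_int n) * of_int m + of_int a * of_int m * of_int n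
          + of_int b * (of_int m / x) * of_int n"
        unfolding w1 by (simp add: distrib_right)
      also have "x * of_int n = of_int m" using mn(1,2) by simp
      also have "of_int m / x = of_int n" using mn(1,2) m0 by simp
      also have "of_int m * of_int m + of_int a * of_int m * of_int n + of_int b * of_int n * of_int n = (of_int s :: rat)"
        by (simp add: s_def power2_eq_square)
      finally have w: "w = of_int s / of_int (m * n)" using m0 mn(2) by (simp add: eq_divide_eq)
      obtain u v :: int where uv: "w = of_int u / of_int v" "v > 0" "coprime u v"
        and hw: "int (rat_height w) = max \<bar>u\<bar> \<bar>v\<bar>" using rat_reduced[of w] by metis
      have "m * n \<noteq> 0" using m0 mn(2) by simp
      then obtain k where k: "s = u * k" "m * n = v * k" "k \<noteq> 0"
        using rat_fraction[OF w _ uv] by metis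
      have "k dvd b"
      proof -
        have ks: "k dvd s" "k dvd m * n" using k by auto
        \<comment> \<open>Elimination: a common divisor of s and m n divides b n^3 and m^3. As m and
          n are coprime, it is prime to n and so divides b.\<close>
        have "b * n ^ 3 = n * s - (m * n) * (m + a * n)"
          unfolding s_def by (simp add: algebra_simps power2_eq_square power3_eq_cube)
        then have 1: "k dvd b * n ^ 3" using ks by (metis dvd_diff dvd_mult dvd_mult2)
        have "m ^ 3 = m * s - (m * n) * (a * m + b * n)"
          unfolding s_def by (simp add: algebra_simps power2_eq_square power3_eq_cube)
        then have "k dvd m ^ 3" using ks by (metis dvd_diff dvd_mult dvd_mult2)
        moreover have "coprime (m ^ 3) (n ^ 3)" using mn(3) by simp
        ultimately have "coprime k (n ^ 3)" using coprime_divisors[of k "m ^ 3" "n ^ 3" "n ^ 3"] by simp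
        then show ?thesis using 1 by (simp add: coprime_dvd_mult_left_iff)
      qed
      then have kb: "\<bar>k\<bar> \<le> \<bar>b\<bar>" using b_nonzero by (intro dvd_imp_le_int) auto
      define h' where "h' = max \<bar>s\<bar> \<bar>m * n\<bar>"
      have "h' \<le> max \<bar>u\<bar> \<bar>v\<bar> * \<bar>k\<bar>"
        unfolding h'_def k abs_mult by (simp add: mult_right_mono max_def)
      also have "\<dots> \<le> max \<bar>u\<bar> \<bar>v\<bar> * \<bar>b\<bar>" using kb by (intro mult_left_mono) auto
      finally have h': "h' \<le> int (rat_height w) * \<bar>b\<bar>" unfolding hw .
      have "int (rat_height x) ^ 2 \<le> (1 + \<bar>a\<bar> + \<bar>b\<bar>) * h'"
      proof -
        have sh: "\<bar>s\<bar> \<le> h'" "\<bar>m * n\<bar> \<le> h'" unfolding h'_def by auto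
        have h0: "0 \<le> h'" unfolding h'_def by simp
        have am: "\<bar>a * m * n\<bar> \<le> \<bar>a\<bar> * h'" using mult_left_mono[OF sh(2), of "\<bar>a\<bar>"] by (simp add: abs_mult ac_simps)
        show ?thesis
        \<comment> \<open>The square of the smaller of |m| and |n| is at most |m n|, so s bounds the
          square of the larger one, which is the height.\<close>
        proof (cases "\<bar>n\<bar> \<le> \<bar>m\<bar>")
          case True
          then have "\<bar>n\<bar> * \<bar>n\<bar> \<le> \<bar>m * n\<bar>" unfolding abs_mult by (intro mult_right_mono) auto
          then have "\<bar>b\<bar> * (\<bar>n\<bar> * \<bar>n\<bar>) \<le> \<bar>b\<bar> * h'" using sh(2) by (intro mult_left_mono) auto
          then have bn: "\<bar>b * n ^ 2\<bar> \<le> \<bar>b\<bar> * h'" by (simp add: abs_mult power2_eq_square)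
          have "m ^ 2 = s - a * m * n - b * n ^ 2" unfolding s_def by simp
          then have "m ^ 2 \<le> h' + \<bar>a\<bar> * h' + \<bar>b\<bar> * h'" using sh(1) am bn by linarith
          moreover have "int (rat_height x) ^ 2 = m ^ 2" unfolding h using True by (simp add: max_def)
          ultimately show ?thesis by (simp add: algebra_simps)
        next
          case False
          then have "\<bar>m\<bar> * \<bar>m\<bar> \<le> \<bar>m * n\<bar>" unfolding abs_mult by (intro mult_left_mono) auto
          then have mm: "m ^ 2 \<le> h'" using sh(2) by (simp add: power2_eq_square)
          have "b * n ^ 2 = s - m ^ 2 - a * m * n" unfolding s_def by simp
          then have "\<bar>b * n ^ 2\<bar> \<le> h' + h' + \<bar>a\<bar> * h'" using sh(1) mm am zero_le_power2[of m] by linarith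
          moreover have "1 * n ^ 2 \<le> \<bar>b\<bar> * n ^ 2" using b1 by (intro mult_right_mono) auto
          moreover have "1 * h' \<le> \<bar>b\<bar> * h'" using b1 h0 by (intro mult_right_mono) auto
          ultimately have "n ^ 2 \<le> h' + \<bar>a\<bar> * h' + \<bar>b\<bar> * h'" by (simp add: abs_mult)
          moreover have "int (rat_height x) ^ 2 = n ^ 2" unfolding h using False by (simp add: max_def)
          ultimately show ?thesis by (simp add: algebra_simps)
        qed
      qed
      also have "\<dots> \<le> (1 + \<bar>a\<bar> + \<bar>b\<bar>) * (int (rat_height w) * \<bar>b\<bar>)"
        using h' by (intro mult_left_mono) auto
      finally have fin: "int (rat_height x ^ 2) \<le> int (nat ((1 + \<bar>a\<bar> + \<bar>b\<bar>) * \<bar>b\<bar>) * rat_height w)"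
        by (simp add: ac_simps)
      have "point_height (isogeny (of_int b) P) = rat_height w"
        unfolding Affine isogeny_affine[OF False] by (simp add: w_def)
      then show ?thesis using fin Affine unfolding of_nat_le_iff by simp
    qed
  qed
qed

text \<open>Doubling is the composite of the two isogenies, each of which at least squares the
  height up to a constant; the factor 4 pays for the rescaling.\<close>

lemma point_height_double:
  "\<exists>D. \<forall>P. on_curve W P \<longrightarrow>
    point_height P ^ 4 \<le> D * point_height (point_add W P P)"
proof (intro exI allI impI)
  fix P :: "rat point"
  assume P: "on_curve W P"
  interpret D: integral_cubic "- 2 * a" "a ^ 2 - 4 * b" by (rule dual)
  define K where "K = nat ((1 + \<bar>a\<bar> + \<bar>b\<bar>) * \<bar>b\<bar>)"
  define K' where "K' = nat ((1 + \<bar>- 2 * a\<bar> + \<bar>a ^ 2 - 4 * b\<bar>) * \<bar>a ^ 2 - 4 * b\<bar>)"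
  let ?Q = "isogeny (of_int b) P"
  have Q: "on_curve (curve (of_int (- 2 * a)) (of_int (a ^ 2 - 4 * b))) ?Q"
    using E.isogeny_on_curve[OF P] by simp
  have "point_height P ^ 4 = (point_height P ^ 2) ^ 2" by simp
  also have "\<dots> \<le> (K * point_height ?Q) ^ 2"
    unfolding K_def by (intro power_mono point_height_isogeny P) auto
  also have "\<dots> = K ^ 2 * point_height ?Q ^ 2" by (simp add: power_mult_distrib)
  also have "\<dots> \<le> K ^ 2 * (K' * point_height (isogeny (of_int (a ^ 2 - 4 * b)) ?Q))"
    unfolding K'_def by (intro mult_left_mono D.point_height_isogeny[OF Q]) auto
  also have "\<dots> \<le> K ^ 2 * (K' * (4 * point_height (halve_scale (isogeny (of_int (a ^ 2 - 4 * b)) ?Q))))"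
    by (intro mult_left_mono point_height_halve_scale) auto
  also have "halve_scale (isogeny (of_int (a ^ 2 - 4 * b)) ?Q) = point_add W P P"
    using E.dual_isogeny_isogeny[OF P] unfolding E.dual_isogeny_def by simp
  finally show "point_height P ^ 4 \<le> (K ^ 2 * K' * 4) * point_height (point_add W P P)"
    by (simp add: ac_simps)
qed

text \<open>For a fixed second point the abscissa of the sum is A / B, both quadratic in m and n
  except for a term in the numerator w of the ordinate over n^2; by the curve equation |w| is at
  most a multiple of the squared height.\<close>

lemma point_height_translate_affine:
  assumes Q: "on_curve W (Affine x0 y0)"
  shows "\<exists>C. \<forall>x y. on_curve W (Affine x y) \<longrightarrow> x \<noteq> x0 \<longrightarrow>
    point_height (point_add W (Affine x y) (Affine x0 y0)) \<le> C * rat_height x ^ 2"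
proof -
  obtain p1 d1 :: int where 1: "x0 = of_int p1 / of_int d1" "d1 > 0" using rat_reduced[of x0] by metis
  obtain p2 d2 :: int where 2: "y0 = of_int p2 / of_int d2" "d2 > 0" using rat_reduced[of y0] by metis
  define d u v where "d = d1 * d2" and "u = p1 * d2" and "v = p2 * d1"
  have d: "d > 0" and x0: "x0 = of_int u / of_int d" and y0: "y0 = of_int v / of_int d"
    unfolding d_def u_def v_def using 1 2 by simp_all
  define c where "c = 1 + \<bar>a\<bar> + \<bar>b\<bar>"
  define C where "C = \<bar>u * d\<bar> + \<bar>b * d ^ 2 + 2 * a * u * d + u ^ 2\<bar> + \<bar>b * u * d\<bar> + 2 * \<bar>v * d\<bar> * c + (d + \<bar>u\<bar>) ^ 2"
  have c0: "c \<ge> 1" unfolding c_def by simp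
  show ?thesis
  proof (intro exI allI impI)
    fix x y assume P: "on_curve W (Affine x y)" and ne: "x \<noteq> x0"
    obtain m n :: int where mn: "x = of_int m / of_int n" "n > 0"
      and h: "int (rat_height x) = max \<bar>m\<bar> \<bar>n\<bar>" using rat_reduced[of x] by metis
    define t where "t = int (rat_height x)"
    have mt: "\<bar>m\<bar> \<le> t" "\<bar>n\<bar> \<le> t" "0 \<le> t" unfolding t_def h by auto
    have P': "y ^ 2 = x ^ 3 + of_int a * x ^ 2 + of_int b * x" using P by simp
    \<comment> \<open>The square of y n^2 is integral, hence so is y n^2. This crude denominator
      makes it unnecessary to show that n is a square.\<close>
    have "(y * of_int (n ^ 2)) ^ 2 = (x ^ 3 + of_int a * x ^ 2 + of_int b * x) * of_int (n ^ 2) ^ 2"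
      unfolding P'[symmetric] by (simp add: power_mult_distrib)
    also have "\<dots> = of_int (n * m ^ 3 + a * m ^ 2 * n ^ 2 + b * m * n ^ 3)"
      unfolding mn(1) using mn(2) by (simp add: field_simps power2_eq_square power3_eq_cube)
    finally have w2: "(y * of_int (n ^ 2)) ^ 2 = of_int (n * m ^ 3 + a * m ^ 2 * n ^ 2 + b * m * n ^ 3)" .
    then obtain w where w: "y * of_int (n ^ 2) = of_int w" by (rule rat_square_int)
    have "(of_int (w ^ 2) :: rat) = of_int (n * m ^ 3 + a * m ^ 2 * n ^ 2 + b * m * n ^ 3)"
      using w2 unfolding w by simp
    then have ww: "w ^ 2 = n * m ^ 3 + a * m ^ 2 * n ^ 2 + b * m * n ^ 3" by (simp only: of_int_eq_iff)
    have quart: "\<bar>p * q * r * s\<bar> \<le> t ^ 4" if "\<bar>p\<bar> \<le> t" "\<bar>q\<bar> \<le> t" "\<bar>r\<bar> \<le> t" "\<bar>s\<bar> \<le> t" for p q r s :: int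
    proof -
      have "\<bar>p\<bar> * \<bar>q\<bar> * \<bar>r\<bar> * \<bar>s\<bar> \<le> t * t * t * t" using that mt(3) by (intro mult_mono) auto
      then show ?thesis by (simp add: abs_mult power4_eq_xxxx)
    qed
    have quad: "\<bar>p * q\<bar> \<le> t ^ 2" if "\<bar>p\<bar> \<le> t" "\<bar>q\<bar> \<le> t" for p q :: int
    proof -
      have "\<bar>p\<bar> * \<bar>q\<bar> \<le> t * t" using that mt(3) by (intro mult_mono) auto
      then show ?thesis by (simp add: abs_mult power2_eq_square)
    qed
    have "w ^ 2 = n * m * m * m + a * (m * m * n * n) + b * (m * n * n * n)"
      unfolding ww by (simp add: power2_eq_square power3_eq_cube)
    also have "\<dots> \<le> \<bar>n * m * m * m\<bar> + \<bar>a\<bar> * \<bar>m * m * n * n\<bar> + \<bar>b\<bar> * \<bar>m * n * n * n\<bar>"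
      unfolding abs_mult[of a, symmetric] abs_mult[of b, symmetric] by linarith
    also have "\<dots> \<le> t ^ 4 + \<bar>a\<bar> * t ^ 4 + \<bar>b\<bar> * t ^ 4"
      by (intro add_mono mult_left_mono quart mt) auto
    also have "\<dots> = c * t ^ 4" unfolding c_def by (simp add: algebra_simps)
    also have "\<dots> \<le> c ^ 2 * t ^ 4"
      using c0 by (intro mult_right_mono) (auto simp: power2_eq_square)
    also have "\<dots> = (c * t ^ 2) ^ 2" by (simp add: power_mult_distrib)
    finally have wb: "\<bar>w\<bar> \<le> c * t ^ 2" using c0 by (simp add: power2_le_iff_abs_le)
    define A where "A = u * d * m ^ 2 + (b * d ^ 2 + 2 * a * u * d + u ^ 2) * (m * n) + b * u * d * n ^ 2 - 2 * v * d * w"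
    define B where "B = (d * m - u * n) ^ 2"
    obtain l k x3 where s: "E.sec l k x x0 x3" "y = l * x + k" "y0 = l * x0 + k"
      and sum: "point_add W (Affine x y) (Affine x0 y0) = Affine x3 (- (l * x3 + k))"
      using E.add_secantE[OF P Q] ne by metis
    have lx: "l * (x - x0) = y - y0" unfolding s(2,3) by (simp add: algebra_simps)
    have "x3 * (x - x0) ^ 2 = (l * (x - x0)) ^ 2 - (of_int a + x + x0) * (x - x0) ^ 2"
    proof -
      have e: "x3 = l ^ 2 - of_int a - x - x0" using s(1) unfolding secant_def by simp
      show ?thesis unfolding e power_mult_distrib by (simp add: algebra_simps)
    qed
    also have "\<dots> = y ^ 2 + y0 ^ 2 - 2 * y * y0 - (of_int a + x + x0) * (x - x0) ^ 2"
      unfolding lx by (simp add: power2_diff)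
    \<comment> \<open>By the two curve equations the cubic terms cancel, which leaves degree 2 in x
      besides the term in y.\<close>
    also have "\<dots> = x0 * x ^ 2 + (of_int b + 2 * of_int a * x0 + x0 ^ 2) * x + of_int b * x0 - 2 * y0 * y"
      using Q unfolding P' by (simp add: algebra_simps power2_eq_square power3_eq_cube)
    finally have x3: "x3 * (x - x0) ^ 2 =
       x0 * x ^ 2 + (of_int b + 2 * of_int a * x0 + x0 ^ 2) * x + of_int b * x0 - 2 * y0 * y" .
    have "of_int d * of_int m - of_int u * of_int n = (x - x0) * (of_int d * of_int n)"
      unfolding mn(1) x0 using d mn(2) by (simp add: field_simps)
    then have Bq: "of_int B = (x - x0) ^ 2 * (of_int d * of_int n) ^ 2"
      unfolding B_def by (simp add: power_mult_distrib)
    have "x3 * of_int B = (x0 * x ^ 2 + (of_int b + 2 * of_int a * x0 + x0 ^ 2) * x + of_int b * x0 - 2 * y0 * y)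
        * (of_int d * of_int n) ^ 2"
      unfolding Bq mult.assoc[symmetric] x3 ..
    also have "\<dots> = (x0 * of_int d) * of_int d * (x * of_int n) ^ 2
      + (of_int b * of_int d ^ 2 + 2 * of_int a * (x0 * of_int d) * of_int d + (x0 * of_int d) ^ 2) * ((x * of_int n) * of_int n)
      + of_int b * (x0 * of_int d) * of_int d * of_int n ^ 2 - 2 * (y0 * of_int d) * of_int d * (y * of_int n ^ 2)"
      by (simp add: algebra_simps power2_eq_square)
    also have "\<dots> = of_int A"
    proof -
      have "x0 * of_int d = of_int u" "x * of_int n = of_int m" "y0 * of_int d = of_int v" "y * of_int n ^ 2 = of_int w"
        using x0 y0 mn d w by simp_all
      then show ?thesis unfolding A_def by (simp only: of_int_add of_int_diff of_int_mult of_int_power of_int_numeral)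
    qed
    finally have AB: "x3 * of_int B = of_int A" .
    have "(of_int B :: rat) \<noteq> 0" unfolding Bq using ne d mn(2) by simp
    then have B0: "B \<noteq> 0" and "x3 = of_int A / of_int B" using AB by (auto simp: field_simps)
    then have "int (rat_height x3) \<le> max \<bar>A\<bar> \<bar>B\<bar>" by (intro rat_height_le)
    also have "\<dots> \<le> C * t ^ 2"
    proof -
      have "\<bar>A\<bar> \<le> \<bar>u * d\<bar> * \<bar>m * m\<bar> + \<bar>b * d ^ 2 + 2 * a * u * d + u ^ 2\<bar> * \<bar>m * n\<bar> + \<bar>b * u * d\<bar> * \<bar>n * n\<bar>
        + 2 * (\<bar>v * d\<bar> * \<bar>w\<bar>)"
      proof -
        have tri: "\<bar>x + y + z - 2 * r\<bar> \<le> \<bar>x\<bar> + \<bar>y\<bar> + \<bar>z\<bar> + 2 * \<bar>r\<bar>" for x y z r :: int by linarith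
        have A: "A = (u * d) * (m * m) + (b * d ^ 2 + 2 * a * u * d + u ^ 2) * (m * n) + (b * u * d) * (n * n) - 2 * ((v * d) * w)"
          unfolding A_def by (simp add: power2_eq_square algebra_simps)
        show ?thesis unfolding A abs_mult[symmetric] by (rule tri)
      qed
      also have "\<dots> \<le> \<bar>u * d\<bar> * t ^ 2 + \<bar>b * d ^ 2 + 2 * a * u * d + u ^ 2\<bar> * t ^ 2 + \<bar>b * u * d\<bar> * t ^ 2
        + 2 * (\<bar>v * d\<bar> * (c * t ^ 2))"
        by (intro add_mono mult_left_mono quad mt wb) auto
      also have "\<dots> = (\<bar>u * d\<bar> + \<bar>b * d ^ 2 + 2 * a * u * d + u ^ 2\<bar> + \<bar>b * u * d\<bar> + 2 * \<bar>v * d\<bar> * c) * t ^ 2"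
        by (simp only: distrib_right mult.assoc)
      also have "\<dots> \<le> C * t ^ 2" unfolding C_def by (intro mult_right_mono) auto
      finally have "\<bar>A\<bar> \<le> C * t ^ 2" .
      moreover have "\<bar>B\<bar> \<le> C * t ^ 2"
      proof -
        have "\<bar>d * m - u * n\<bar> \<le> d * \<bar>m\<bar> + \<bar>u\<bar> * \<bar>n\<bar>" using d abs_mult[of d m] abs_mult[of u n] by linarith
        also have "\<dots> \<le> d * t + \<bar>u\<bar> * t" using d by (intro add_mono mult_left_mono mt) auto
        also have "\<dots> = (d + \<bar>u\<bar>) * t" by (simp add: algebra_simps)
        finally have "\<bar>d * m - u * n\<bar> ^ 2 \<le> ((d + \<bar>u\<bar>) * t) ^ 2" by (intro power_mono) auto
        then have "\<bar>B\<bar> \<le> (d + \<bar>u\<bar>) ^ 2 * t ^ 2" unfolding B_def by (simp add: power_mult_distrib)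
        also have "\<dots> \<le> C * t ^ 2" unfolding C_def using c0 by (intro mult_right_mono) auto
        finally show ?thesis .
      qed
      ultimately show ?thesis by simp
    qed
    finally have "int (rat_height x3) \<le> C * t ^ 2" .
    moreover have "0 \<le> C" unfolding C_def using c0 by simp
    ultimately have "int (rat_height x3) \<le> int (nat C * rat_height x ^ 2)" by (simp add: t_def)
    then show "point_height (point_add W (Affine x y) (Affine x0 y0)) \<le> nat C * rat_height x ^ 2"
      unfolding sum of_nat_le_iff by simp
  qed
qed

text \<open>Outside the chord case P is infinity, Q or the opposite of Q; the heights of the three
  possible sums are absorbed in the constant.\<close>

lemma point_height_translate:
  assumes Q: "on_curve W Q"
  shows "\<exists>C. \<forall>P. on_curve W P \<longrightarrow>
    point_height (point_add W P Q) \<le> C * point_height P ^ 2"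
proof (cases Q)
  case Infinity
  have "point_height P \<le> 1 * point_height P ^ 2" for P by (simp add: power2_eq_square)
  then show ?thesis using Infinity by (intro exI[of _ 1]) simp
next
  case (Affine x0 y0)
  obtain C where C: "\<And>x y. on_curve W (Affine x y) \<Longrightarrow> x \<noteq> x0 \<Longrightarrow>
    point_height (point_add W (Affine x y) Q) \<le> C * rat_height x ^ 2"
    using point_height_translate_affine Q unfolding Affine by blast
  define C' where "C' = C + point_height Q + point_height (point_add W Q Q) + 1"
  show ?thesis
  proof (intro exI[of _ C'] allI impI)
    fix P :: "rat point" assume P: "on_curve W P"
    have "C' * 1 \<le> C' * point_height P ^ 2" using point_height_pos[of P] by (intro mult_left_mono) auto
    then have c1: "C' \<le> C' * point_height P ^ 2" by (simp only: mult_1_right)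
    have bound: "point_height (point_add W P Q) \<le> C' * point_height P ^ 2"
      if "point_height (point_add W P Q) \<le> C'"
      using that c1 by (rule order_trans)
    consider "P = Infinity" | "P = Q" | "P = opposite Q" | x y where "P = Affine x y" "x \<noteq> x0"
    proof (cases P)
      case (Affine x y)
      show ?thesis
      proof (cases "x = x0")
        case True
        then have "y ^ 2 = y0 ^ 2" using P Q Affine \<open>Q = Affine x0 y0\<close> by simp
        then have "y = y0 \<or> y = - y0" by (simp add: power2_eq_iff)
        then show ?thesis using that(2,3) True Affine \<open>Q = Affine x0 y0\<close> by auto
      qed (use that(4) Affine in auto)
    qed (use that(1) in auto)
    then show "point_height (point_add W P Q) \<le> C' * point_height P ^ 2"
    proof cases
      case 1
      then show ?thesis by (simp add: C'_def)
    next
      case 2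
      then show ?thesis by (intro bound) (simp add: C'_def)
    next
      case 3
      then show ?thesis by (intro bound) (simp add: C'_def)
    next
      case 4
      then have "point_height (point_add W P Q) \<le> C * point_height P ^ 2"
        using C P by simp
      also have "\<dots> \<le> C' * point_height P ^ 2" unfolding C'_def by (intro mult_right_mono) auto
      finally show ?thesis .
    qed
  qed
qed

end

section \<open>Classes modulo squares\<close>

text \<open>A point with abscissa \<open>d M^2 / e^2\<close> gives a solution; the point at infinity and \<open>(0, 0)\<close> correspond
  to \<open>e = 0\<close> and to \<open>M = 0\<close>.\<close>

definition descent_soluble :: "int \<Rightarrow> int \<Rightarrow> int \<Rightarrow> bool" where
  "descent_soluble a b d \<longleftrightarrow>
     (\<exists>M N e. coprime M e \<and> d * N ^ 2 = d ^ 2 * M ^ 4 + a * d * M ^ 2 * e ^ 2 + b * e ^ 4)"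

section \<open>Squarefree representatives and the quartics attached to them\<close>

lemma squarefree_int_dvd:
  fixes d w :: int
  assumes "squarefree d" "d dvd w ^ 2"
  shows "d dvd w"
proof -
  have d0: "d \<noteq> 0" using assms(1) by auto
  show ?thesis
  proof (cases "w = 0")
    case False
    show ?thesis
    proof (rule multiplicity_le_imp_dvd[OF d0])
      fix q :: int assume q: "prime q"
      show "multiplicity q d \<le> multiplicity q w"
      proof (cases "q dvd d")
        case True
        then have "q dvd w" using assms(2) q prime_dvd_power by (meson dvd_trans)
        then have "multiplicity q w \<ge> 1" using False q not_dvd_imp_multiplicity_0
          by (metis One_nat_def Suc_leI multiplicity_gt_zero_iff not_prime_unit)
        moreover have "multiplicity q d \<le> 1" using assms(1) d0 q by (simp add: squarefree_factorial_semiring'')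
        ultimately show ?thesis by simp
      qed (simp add: not_dvd_imp_multiplicity_0)
    qed
  qed simp
qed

lemma rat_squarefree:
  fixes q :: rat
  assumes "q \<noteq> 0"
  obtains d s where "squarefree d" "s \<noteq> 0" "q = of_int d * s ^ 2"
proof -
  obtain m n :: int where mn: "q = of_int m / of_int n" "n > 0" using rat_reduced[of q] by metis
  define d k where "d = squarefree_part (m * n)" and "k = square_part (m * n)"
  have dk: "m * n = d * k ^ 2" unfolding d_def k_def by (rule squarefree_decompose)
  have k0: "k \<noteq> 0" using assms mn unfolding k_def by simp
  have "q = of_int (m * n) / of_int n ^ 2" using mn by (simp add: power2_eq_square)
  also have "\<dots> = of_int d * (of_int k / of_int n) ^ 2" unfolding dk by (simp add: power_divide)
  finally show thesis
    using that[of d "of_int k / of_int n"] k0 mn(2) by (simp add: d_def)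
qed

abbreviation prod_set :: "int set \<Rightarrow> int" where
  "prod_set A \<equiv> prod (\<lambda>x. x) A"

text \<open>Records d as a set of primes, together with -1 if d is negative. Multiplication modulo
  squares then becomes symmetric difference.\<close>

lemma prod_primes_squarefree:
  fixes d :: int
  assumes "squarefree d"
  shows "d = prod_set (prime_factors d \<union> (if d < 0 then {- 1} else {}))"
proof -
  have d0: "d \<noteq> 0" using assms by auto
  have "(\<Prod>q\<in>prime_factors d. q ^ multiplicity q d) = normalize d"
    by (rule prod_prime_factors[OF d0])
  moreover have "(\<Prod>q\<in>prime_factors d. q ^ multiplicity q d) = prod_set (prime_factors d)"
    using assms d0 by (intro prod.cong) (auto simp: squarefree_factorial_semiring')
  ultimately have a: "prod_set (prime_factors d) = \<bar>d\<bar>" by simp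
  have "\<not> prime (- 1 :: int)" using prime_ge_0_int[of "- 1"] by auto
  then have "- 1 \<notin> prime_factors d" by blast
  then show ?thesis using a by (cases "d < 0") (auto simp: prod.insert)
qed

text \<open>As q divides d exactly once, an equation with b prime to q forces q to divide e, then N,
  then M, against coprimality.\<close>

lemma quartic_no_prime_factor:
  fixes d N M e a b q :: int
  assumes eq: "d * N ^ 2 = d ^ 2 * M ^ 4 + a * d * M ^ 2 * e ^ 2 + b * e ^ 4"
    and M: "coprime M e" and d: "squarefree d" and q: "prime q" "q dvd d"
  shows "q dvd b"
proof (rule ccontr)
  assume b: "\<not> q dvd b"
  obtain d' where d': "d = q * d'" using q(2) by blast
  have q0: "q \<noteq> 0" using q by auto
  have nd': "\<not> q dvd d'"
  proof
    assume "q dvd d'"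
    then have "q ^ 2 dvd d" unfolding d' power2_eq_square by simp
    then have "q dvd 1" by (rule squarefreeD[OF d])
    with q(1) show False by auto
  qed
  have "b * e ^ 4 = q * (d' * N ^ 2 - d' * d * M ^ 4 - a * d' * M ^ 2 * e ^ 2)"
    using eq unfolding d' by (simp add: algebra_simps power2_eq_square)
  then have "q dvd b * e ^ 4" by simp
  then have "q dvd e" using b q(1) prime_dvd_multD prime_dvd_power by blast
  then obtain e' where e': "e = q * e'" by blast
  have nM: "\<not> q dvd M" using M \<open>q dvd e\<close> q(1) by (metis coprime_common_divisor not_prime_unit)
  have "q * (d' * N ^ 2) = q * (q * (d' ^ 2 * M ^ 4 + q * (a * d' * M ^ 2 * e' ^ 2) + q ^ 2 * (b * e' ^ 4)))"
    using eq unfolding d' e' by (simp add: algebra_simps power2_eq_square power4_eq_xxxx)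
  then have 1: "d' * N ^ 2 = q * (d' ^ 2 * M ^ 4 + q * (a * d' * M ^ 2 * e' ^ 2) + q ^ 2 * (b * e' ^ 4))"
    using q0 mult_left_cancel by blast
  then have "q dvd d' * N ^ 2" by simp
  then have "q dvd N" using nd' q(1) prime_dvd_multD prime_dvd_power by blast
  then obtain N' where N': "N = q * N'" by blast
  have "q * (q * (d' * N' ^ 2)) = q * (d' ^ 2 * M ^ 4 + q * (a * d' * M ^ 2 * e' ^ 2) + q ^ 2 * (b * e' ^ 4))"
    using 1 unfolding N' by (simp add: algebra_simps power2_eq_square)
  then have "q * (d' * N' ^ 2) = d' ^ 2 * M ^ 4 + q * (a * d' * M ^ 2 * e' ^ 2) + q ^ 2 * (b * e' ^ 4)"
    using q0 mult_left_cancel by blast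
  then have "d' ^ 2 * M ^ 4 = q * (d' * N' ^ 2 - a * d' * M ^ 2 * e' ^ 2 - q * (b * e' ^ 4))"
    by (simp add: algebra_simps power2_eq_square)
  then have "q dvd d' ^ 2 * M ^ 4" by simp
  then show False using nd' nM q(1) prime_dvd_multD prime_dvd_power by blast
qed

context integral_cubic
begin

abbreviation \<delta> :: "rat point \<Rightarrow> rat" where "\<delta> \<equiv> two_descent (of_int b)"

text \<open>The abscissa d m^2 / n^2 turns the curve equation into a square equal to d F; the
  squarefree d divides the root, which is thus d N. The quartic is kept multiplied by d, so that no
  quotient b / d occurs.\<close>

lemma two_descent_soluble:
  assumes P: "on_curve W P" and d: "squarefree d" and s: "s \<noteq> 0" "\<delta> P = of_int d * s ^ 2"
  shows "\<exists>M N e. coprime M e \<and> d * N ^ 2 = d ^ 2 * M ^ 4 + a * d * M ^ 2 * e ^ 2 + b * e ^ 4"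
proof -
  have d0: "d \<noteq> 0" using d by auto
  obtain m n :: int where mn: "s = of_int m / of_int n" "n > 0" "coprime m n" using rat_reduced[of s] by metis
  have m0: "m \<noteq> 0" using s mn by auto
  have cop2: "coprime (m ^ 2) (n ^ 2)" using mn(3) by simp
  consider "P = Infinity" | y where "P = Affine 0 y" | x y where "P = Affine x y" "x \<noteq> 0"
    by (cases P) auto
  then show ?thesis
  proof cases
    case 1
    then have "(of_int (n ^ 2) :: rat) = of_int (d * m ^ 2)"
      using s mn by (simp add: power_divide field_simps)
    then have e: "n ^ 2 = d * m ^ 2" by (simp only: of_int_eq_iff)
    then have "is_unit (m ^ 2)" using cop2 by (metis coprime_common_divisor dvd_refl dvd_triv_right)
    then have "m ^ 2 = 1" by (simp add: is_unit_power_iff)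
    then have nd: "n ^ 2 = d" using e by simp
    then have "n dvd 1" using squarefreeD[OF d, of n] by simp
    \<comment> \<open>At infinity d is both a square and squarefree.\<close>
    then have "d = 1" using nd by (metis zdvd1_eq power2_abs power_one)
    then show ?thesis by (intro exI[of _ 1] exI[of _ 1] exI[of _ 0]) simp
  next
    case 2
    then have "(of_int (b * n ^ 2) :: rat) = of_int (d * m ^ 2)"
      using s mn by (simp add: power_divide field_simps)
    then have e: "b * n ^ 2 = d * m ^ 2" by (simp only: of_int_eq_iff)
    then have "n ^ 2 dvd d * m ^ 2" by (metis dvd_triv_right)
    then have "n ^ 2 dvd d" using cop2 by (simp add: coprime_dvd_mult_left_iff coprime_commute)
    then have "n dvd 1" by (rule squarefreeD[OF d])
    then have "n = 1" using mn(2) by simp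
    then show ?thesis using e by (intro exI[of _ 0] exI[of _ m] exI[of _ 1]) simp
  next
    case 3
    define F where "F = d ^ 2 * m ^ 4 + a * d * m ^ 2 * n ^ 2 + b * n ^ 4"
    have x: "x = of_int d * s ^ 2" using s 3 by simp
    have y: "y ^ 2 = x ^ 3 + of_int a * x ^ 2 + of_int b * x" using P 3 by simp
    have xn: "x * of_int n ^ 2 = of_int (d * m ^ 2)" unfolding x mn(1) using mn(2) by (simp add: power_divide)
    define w where "w = y * of_int (n ^ 3) / of_int m"
    have "(of_int m * w) ^ 2 = y ^ 2 * of_int n ^ 6"
      unfolding w_def using m0 by (simp add: power_mult_distrib flip: power_mult)
    also have "\<dots> = (x * of_int n ^ 2) * ((x * of_int n ^ 2) ^ 2 + of_int a * (x * of_int n ^ 2) * of_int n ^ 2 + of_int b * of_int n ^ 4)"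
      unfolding y by (simp add: algebra_simps power2_eq_square power3_eq_cube eval_nat_numeral)
    also have "\<dots> = of_int (d * m ^ 2 * F)"
      unfolding xn F_def by (simp add: algebra_simps power2_eq_square power4_eq_xxxx)
    finally have "of_int m ^ 2 * w ^ 2 = of_int m ^ 2 * of_int (d * F)" by (simp add: power_mult_distrib)
    then have "w ^ 2 = of_int (d * F)" using m0 by simp
    then obtain z where z: "w = of_int z" by (rule rat_square_int)
    have "(of_int (z ^ 2) :: rat) = of_int (d * F)" using \<open>w ^ 2 = of_int (d * F)\<close> z by simp
    then have WF: "z ^ 2 = d * F" by (simp only: of_int_eq_iff)
    then have "d dvd z" using squarefree_int_dvd[OF d, of z] by simp
    then obtain N where N: "z = d * N" by blast
    have "d * (d * N ^ 2) = d * F" unfolding WF[symmetric] N by (simp only: power2_eq_square ac_simps)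
    then have "d * N ^ 2 = F" using d0 by simp
    then show ?thesis unfolding F_def using mn(3) by blast
  qed
qed

text \<open>Real insolubility for two reasons: if a^2 - 4 b < 0, completing the square makes the
  right-hand side positive definite; if b > 0 and a \<le> 0, all its terms are nonnegative for
  negative d.\<close>

lemma not_soluble_negative:
  assumes "a ^ 2 - 4 * b < 0 \<or> b > 0 \<and> a \<le> 0" "d < 0"
  shows "\<not> descent_soluble a b d"
proof
  assume "descent_soluble a b d"
  then obtain M N e where c: "coprime M e" and
    eq: "d * N ^ 2 = d ^ 2 * M ^ 4 + a * d * M ^ 2 * e ^ 2 + b * e ^ 4"
    unfolding descent_soluble_def by blast
  have lhs: "d * N ^ 2 \<le> 0" using assms(2) by (simp add: mult_nonpos_nonneg)
  have "e = 0 \<and> M = 0"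
  proof (cases "a ^ 2 - 4 * b < 0")
    case True
    have id: "4 * (d ^ 2 * M ^ 4 + a * d * M ^ 2 * e ^ 2 + b * e ^ 4) =
        (2 * d * M ^ 2 + a * e ^ 2) ^ 2 + (4 * b - a ^ 2) * e ^ 4"
      by (simp add: algebra_simps power2_eq_square power4_eq_xxxx)
    have nn: "(4 * b - a ^ 2) * e ^ 4 \<ge> 0" using True by (intro mult_nonneg_nonneg) auto
    have z: "(2 * d * M ^ 2 + a * e ^ 2) ^ 2 + (4 * b - a ^ 2) * e ^ 4 \<le> 0"
      unfolding id[symmetric] eq[symmetric] using lhs by simp
    then have "(4 * b - a ^ 2) * e ^ 4 = 0" "(2 * d * M ^ 2 + a * e ^ 2) ^ 2 = 0"
      using nn zero_le_power2[of "2 * d * M ^ 2 + a * e ^ 2"] by linarith+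
    then show ?thesis using True assms(2) by auto
  next
    case False
    then have ab: "b > 0" "a \<le> 0" using assms(1) by auto
    have "a * d \<ge> 0" using ab assms(2) by (simp add: mult_nonpos_nonpos)
    then have "a * d * M ^ 2 * e ^ 2 \<ge> 0" by simp
    moreover have "d ^ 2 * M ^ 4 \<ge> 0" "b * e ^ 4 \<ge> 0" using ab by simp_all
    ultimately have "d ^ 2 * M ^ 4 = 0" "b * e ^ 4 = 0" using eq lhs by linarith+
    then show ?thesis using ab assms(2) by auto
  qed
  with c show False by simp
qed

text \<open>\<open>n\<close> bounds the size of the image of the descent map. Labels of points stand
  for its elements, equal labels implying equal values modulo squares, so the quotient by squares is
  never formed.\<close>

definition descent_bound :: "nat \<Rightarrow> bool" where
  "descent_bound n \<longleftrightarrow> (\<exists>c :: rat point \<Rightarrow> int set. finite (c ` {P. on_curve W P}) \<and>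
     card (c ` {P. on_curve W P}) \<le> n \<and>
     (\<forall>P Q. on_curve W P \<longrightarrow> on_curve W Q \<longrightarrow> c P = c Q \<longrightarrow> (\<exists>s. s \<noteq> 0 \<and> \<delta> P * \<delta> Q = s ^ 2)))"

text \<open>The image of the descent map, seen in the vector space over the field with two elements
  with basis \<open>B\<close>; a subset stands for the class of its product.\<close>

definition descent_classes :: "int set \<Rightarrow> int set set" where
  "descent_classes B = {A \<in> Pow B. \<exists>P s. on_curve W P \<and> s \<noteq> 0 \<and> \<delta> P = of_int (prod_set A) * s ^ 2}"

text \<open>The descent map is multiplicative modulo squares, and the factors common to both
  products contribute the square of \<open>prod_set (A1 \<inter> A2)\<close>.\<close>

lemma classes_sym_diff:
  assumes B: "finite B" "0 \<notin> B" and A: "A1 \<in> descent_classes B" "A2 \<in> descent_classes B"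
  shows "sym_diff A1 A2 \<in> descent_classes B"
proof -
  obtain P s where P: "on_curve W P" "s \<noteq> 0" "\<delta> P = of_int (prod_set A1) * s ^ 2" and A1: "A1 \<subseteq> B"
    using A(1) unfolding descent_classes_def by blast
  obtain Q t where Q: "on_curve W Q" "t \<noteq> 0" "\<delta> Q = of_int (prod_set A2) * t ^ 2" and A2: "A2 \<subseteq> B"
    using A(2) unfolding descent_classes_def by blast
  have fin: "finite A1" "finite A2" using A1 A2 B finite_subset by auto
  obtain r where r: "r \<noteq> 0" "\<delta> P * \<delta> Q * \<delta> (point_add W P Q) = r ^ 2"
    using E.two_descent_add[OF P(1) Q(1)] by blast
  define i where "i = prod_set (A1 \<inter> A2)"
  have nz: "prod_set A \<noteq> 0" if "A \<subseteq> B" for A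
    using that B(2) finite_subset[OF that B(1)] by auto
  have "prod_set A1 = prod_set (A1 - A2) * i" "prod_set A2 = prod_set (A2 - A1) * i"
    unfolding i_def using fin by (subst prod.union_disjoint[symmetric]; auto intro!: prod.cong)+
  moreover have "prod_set (sym_diff A1 A2) = prod_set (A1 - A2) * prod_set (A2 - A1)"
    using fin by (intro prod.union_disjoint) auto
  ultimately have prods: "prod_set A1 * prod_set A2 = prod_set (sym_diff A1 A2) * i ^ 2" by (simp add: power2_eq_square)
  define p where "p = prod_set (sym_diff A1 A2)"
  have p0: "p \<noteq> 0" and i0: "i \<noteq> 0" unfolding p_def i_def using A1 A2 by (auto intro!: nz)
  have "of_int p * (of_int i * s * t) ^ 2 * \<delta> (point_add W P Q) = of_int (prod_set A1 * prod_set A2) * s ^ 2 * t ^ 2 * \<delta> (point_add W P Q)"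
    unfolding prods p_def by (simp add: power_mult_distrib)
  also have "\<dots> = r ^ 2" unfolding r(2)[symmetric] P(3) Q(3) by simp
  finally have "\<delta> (point_add W P Q) = r ^ 2 / (of_int p * (of_int i * s * t) ^ 2)"
    using p0 i0 P(2) Q(2) by (simp add: field_simps)
  also have "\<dots> = of_int p * (r / (of_int p * (of_int i * s * t))) ^ 2"
    using p0 by (simp add: power_divide power_mult_distrib power2_eq_square)
  finally have "\<delta> (point_add W P Q) = of_int p * (r / (of_int p * (of_int i * s * t))) ^ 2" .
  moreover have "r / (of_int p * (of_int i * s * t)) \<noteq> 0" using r(1) p0 i0 P(2) Q(2) by simp
  ultimately show ?thesis
    unfolding descent_classes_def p_def using A1 A2 E.add_closed[OF P(1) Q(1)] by blast
qed

lemma finite_classes: "finite B \<Longrightarrow> finite (descent_classes B)"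
  unfolding descent_classes_def by simp

lemma card_classes_le: "finite B \<Longrightarrow> card (descent_classes B) \<le> 2 ^ card B"
  unfolding card_Pow[symmetric] by (rule card_mono) (auto simp: descent_classes_def)

text \<open>By closure under symmetric difference, A and its translate by \<open>{v}\<close> never
  both occur, since otherwise \<open>{v}\<close> would. So at most half of all subsets
  occur.\<close>

lemma card_classes_missing:
  assumes B: "finite B" "0 \<notin> B" and v: "v \<in> B" "squarefree v" "\<not> descent_soluble a b v"
  shows "card (descent_classes B) \<le> 2 ^ (card B - 1)"
proof -
  have "{v} \<notin> descent_classes B"
  proof
    assume "{v} \<in> descent_classes B"
    then obtain P s where "on_curve W P" "s \<noteq> 0" "\<delta> P = of_int v * s ^ 2"
      unfolding descent_classes_def by auto
    from two_descent_soluble[OF this(1) v(2) this(2,3)] v(3) show False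
      unfolding descent_soluble_def by blast
  qed
  define f where "f = (\<lambda>A. sym_diff A {v})"
  have inj: "inj_on f (descent_classes B)" unfolding f_def inj_on_def by (auto split: if_splits)
  have "f ` descent_classes B \<inter> descent_classes B = {}"
  proof (rule ccontr)
    assume "f ` descent_classes B \<inter> descent_classes B \<noteq> {}"
    then obtain A where A: "A \<in> descent_classes B" "sym_diff A {v} \<in> descent_classes B" by (auto simp: f_def)
    have "sym_diff A (sym_diff A {v}) = {v}" by auto
    then show False using classes_sym_diff[OF B A] \<open>{v} \<notin> descent_classes B\<close> by simp
  qed
  moreover have "f ` descent_classes B \<union> descent_classes B \<subseteq> Pow B" using v(1) by (auto simp: f_def descent_classes_def)
  ultimately have "card (f ` descent_classes B) + card (descent_classes B) \<le> card (Pow B)"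
    using B(1) by (metis card_Un_disjoint card_mono finite_Pow_iff finite_classes finite_imageI)
  then have "2 * card (descent_classes B) \<le> 2 ^ card B" using card_image[OF inj] B(1) by (simp add: card_Pow)
  moreover have "card B > 0" using B(1) v(1) by (auto simp: card_gt_0_iff)
  then have "(2 :: nat) ^ card B = 2 * 2 ^ (card B - 1)" by (simp flip: power_Suc)
  ultimately show ?thesis by simp
qed

text \<open>\<open>B\<close> must offer a generator for every prime and sign that can occur; -1 may
  be left out when negative d are insoluble.\<close>

lemma descent_boundI:
  assumes S: "finite S" "\<And>q. prime q \<Longrightarrow> q dvd b \<Longrightarrow> q \<in> S"
    and B: "finite B" "S \<subseteq> B" "- 1 \<in> B \<or> (\<forall>d<0. \<not> descent_soluble a b d)"
    and card: "card (descent_classes B) \<le> n"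
  shows "descent_bound n"
proof -
  have cover: "\<exists>A. A \<in> descent_classes B \<and> (\<exists>s. s \<noteq> 0 \<and> \<delta> P = of_int (prod_set A) * s ^ 2)" if P: "on_curve W P" for P
  proof -
    obtain d s where d: "squarefree d" "s \<noteq> 0" "\<delta> P = of_int d * s ^ 2"
      using rat_squarefree[OF E.two_descent_nonzero[of P]] by metis
    obtain M N e where sol: "coprime M e" "d * N ^ 2 = d ^ 2 * M ^ 4 + a * d * M ^ 2 * e ^ 2 + b * e ^ 4"
      using two_descent_soluble[OF P d] by blast
    define A where "A = prime_factors d \<union> (if d < 0 then {- 1} else {})"
    have "prime_factors d \<subseteq> S"
    proof
      fix q assume "q \<in> prime_factors d"
      then have "prime q" "q dvd d" by (auto simp: prime_factors_dvd)
      then show "q \<in> S" using S(2) quartic_no_prime_factor[OF sol(2,1) d(1)] by blast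
    qed
    moreover have "d < 0 \<Longrightarrow> - 1 \<in> B" using B(3) sol unfolding descent_soluble_def by blast
    ultimately have "A \<subseteq> B" using B(2) by (auto simp: A_def)
    moreover have "d = prod_set A" unfolding A_def by (rule prod_primes_squarefree[OF d(1)])
    ultimately show ?thesis using P d(2,3) unfolding descent_classes_def by blast
  qed
  define c where "c P = (SOME A. A \<in> descent_classes B \<and> (\<exists>s. s \<noteq> 0 \<and> \<delta> P = of_int (prod_set A) * s ^ 2))" for P
  have c: "c P \<in> descent_classes B \<and> (\<exists>s. s \<noteq> 0 \<and> \<delta> P = of_int (prod_set (c P)) * s ^ 2)" if "on_curve W P" for P
    unfolding c_def using cover[OF that] by (rule someI_ex)
  have sub: "c ` {P. on_curve W P} \<subseteq> descent_classes B" using c by blast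
  have "\<exists>s. s \<noteq> 0 \<and> \<delta> P * \<delta> Q = s ^ 2" if PQ: "on_curve W P" "on_curve W Q" "c P = c Q" for P Q
  proof -
    obtain s t where s: "s \<noteq> 0" "\<delta> P = of_int (prod_set (c P)) * s ^ 2" and t: "t \<noteq> 0" "\<delta> Q = of_int (prod_set (c P)) * t ^ 2"
      using c[OF PQ(1)] c[OF PQ(2)] PQ(3) by auto
    have "\<delta> P * \<delta> Q = (of_int (prod_set (c P)) * s * t) ^ 2" unfolding s(2) t(2) by (simp add: power2_eq_square)
    moreover have "of_int (prod_set (c P)) * s * t \<noteq> 0"
    proof
      assume "of_int (prod_set (c P)) * s * t = 0"
      then have "\<delta> P = 0" using s t by auto
      then show False using E.two_descent_nonzero by blast
    qed
    ultimately show ?thesis by blast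
  qed
  moreover have "card (c ` {P. on_curve W P}) \<le> n"
    using card_mono[OF finite_classes[OF B(1)] sub] card by simp
  moreover have "finite (c ` {P. on_curve W P})" using sub finite_classes[OF B(1)] by (rule finite_subset)
  ultimately show ?thesis unfolding descent_bound_def by blast
qed

end

section \<open>Insoluble quartics\<close>

lemma odd_square_mod_8:
  fixes x :: int
  assumes "odd x"
  obtains j where "x ^ 2 = 8 * j + 1"
proof -
  obtain k where k: "x = 2 * k + 1" using assms by (rule oddE)
  have "even (k * (k + 1))" by simp
  then obtain j where "k * (k + 1) = 2 * j" by (rule evenE)
  then have "x ^ 2 = 8 * j + 1" unfolding k by (simp add: power2_eq_square algebra_simps)
  then show thesis by (rule that)
qed

lemma odd_fourth_mod_8:
  fixes x :: int
  assumes "odd x"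
  obtains j where "x ^ 4 = 8 * j + 1"
proof -
  have "odd (x ^ 2)" using assms by simp
  then obtain j where "(x ^ 2) ^ 2 = 8 * j + 1" by (rule odd_square_mod_8)
  then show thesis using that by simp
qed

text \<open>The class 2 in type VIII with k = 2. N is even, hence so is M^4 + c M^2 e^2 - e^4, which
  for odd c requires M and e both even.\<close>

lemma insoluble_2:
  assumes "odd c"
  shows "\<not> descent_soluble (2 * c) (- 4) 2"
  unfolding descent_soluble_def
proof clarify
  fix M N e :: int
  assume c: "coprime M e" and eq: "2 * N ^ 2 = 2 ^ 2 * M ^ 4 + 2 * c * 2 * M ^ 2 * e ^ 2 + - 4 * e ^ 4"
  have N: "N ^ 2 = 2 * (M ^ 4 + c * M ^ 2 * e ^ 2 - e ^ 4)" using eq by simp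
  then have "even (N ^ 2)" by simp
  then obtain n where n: "N = 2 * n" by (auto elim: evenE)
  have "M ^ 4 + c * M ^ 2 * e ^ 2 - e ^ 4 = 2 * n ^ 2" using N unfolding n by (simp add: power2_eq_square)
  then have "even (M ^ 4 + c * M ^ 2 * e ^ 2 - e ^ 4)" by simp
  then have "even M" "even e" using assms by auto
  with c show False by (auto dest: coprime_common_divisor)
qed

text \<open>The class -1 on the dual curve in type X. For odd M, N^2 + M^4 is 2 modulo 8 although
  divisible by 4; for even M, division by 4 makes p congruent to an odd square modulo 4.\<close>

lemma insoluble_minus_1_p3:
  assumes "p mod 4 = 3"
  shows "\<not> descent_soluble (- 4 * c) (- 4 * p) (- 1)"
  unfolding descent_soluble_def
proof clarify
  fix M N e :: int
  assume c: "coprime M e"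
    and eq: "- 1 * N ^ 2 = (- 1) ^ 2 * M ^ 4 + - 4 * c * - 1 * M ^ 2 * e ^ 2 + - 4 * p * e ^ 4"
  have eq: "N ^ 2 + M ^ 4 = 4 * (p * e ^ 4 - c * M ^ 2 * e ^ 2)" using eq by (simp add: algebra_simps)
  show False
  proof (cases "even M")
    case False
    then obtain j where j: "M ^ 4 = 8 * j + 1" by (rule odd_fourth_mod_8)
    have "even (N ^ 2 + M ^ 4)" unfolding eq by simp
    then have "odd N" using False by simp
    then obtain i where i: "N ^ 2 = 8 * i + 1" by (rule odd_square_mod_8)
    have "4 dvd (8 * i + 1) + (8 * j + 1)" unfolding i[symmetric] j[symmetric] eq by simp
    then show False by presburger
  next
    case True
    then have e: "odd e" using c by (auto dest: coprime_common_divisor)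
    have "even (N ^ 2 + M ^ 4)" unfolding eq by simp
    then have "even N" using True by simp
    then obtain n m where nm: "N = 2 * n" "M = 2 * m" using True by (auto elim!: evenE)
    define t where "t = c * m ^ 2 * e ^ 2 + m ^ 4"
    have eq2: "n ^ 2 = p * e ^ 4 - 4 * t"
      using eq unfolding nm t_def by (simp add: algebra_simps)
    obtain j where j: "e ^ 4 = 8 * j + 1" using e by (rule odd_fourth_mod_8)
    have "odd p" using assms by presburger
    then have "odd (n ^ 2)" unfolding eq2 using e by simp
    then have "odd n" by simp
    then obtain i where i: "n ^ 2 = 8 * i + 1" by (rule odd_square_mod_8)
    have "p = 4 * (2 * i + t - 2 * (p * j)) + 1"
      using eq2 unfolding i j by (simp add: algebra_simps)
    then show False using assms by presburger
  qed
qed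

text \<open>The class -1 in type XVI. For odd M, N^2 + M^4 is 2 modulo 8, but odd c makes it
  divisible by 4; for even M, the odd number e^2 (c M^2 + e^2) would be even.\<close>

lemma insoluble_minus_1_twice:
  assumes "odd c"
  shows "\<not> descent_soluble (2 * c) (- 2) (- 1)"
  unfolding descent_soluble_def
proof clarify
  fix M N e :: int
  assume c: "coprime M e"
    and eq: "- 1 * N ^ 2 = (- 1) ^ 2 * M ^ 4 + 2 * c * - 1 * M ^ 2 * e ^ 2 + - 2 * e ^ 4"
  have eq: "N ^ 2 + M ^ 4 = 2 * (e ^ 2 * (c * M ^ 2 + e ^ 2))" using eq
    by (simp add: algebra_simps power2_eq_square power4_eq_xxxx)
  show False
  proof (cases "even M")
    case False
    then obtain j where j: "M ^ 4 = 8 * j + 1" by (rule odd_fourth_mod_8)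
    have "even (N ^ 2 + M ^ 4)" unfolding eq by simp
    then have "odd N" using False by simp
    then obtain i where i: "N ^ 2 = 8 * i + 1" by (rule odd_square_mod_8)
    have "even (e ^ 2 * (c * M ^ 2 + e ^ 2))" using False assms by simp
    then obtain t where "e ^ 2 * (c * M ^ 2 + e ^ 2) = 2 * t" by (rule evenE)
    then have "(8 * i + 1) + (8 * j + 1) = 4 * t" using eq unfolding i j by simp
    then show False by presburger
  next
    case True
    then have e: "odd e" using c by (auto dest: coprime_common_divisor)
    have "even (N ^ 2 + M ^ 4)" unfolding eq by simp
    then have "even N" using True by simp
    then obtain n m where nm: "N = 2 * n" "M = 2 * m" using True by (auto elim!: evenE)
    have "2 * (2 * (n ^ 2 + 4 * m ^ 4)) = 2 * (e ^ 2 * (c * M ^ 2 + e ^ 2))"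
      using eq unfolding nm by (simp add: algebra_simps)
    then have "even (e ^ 2 * (c * M ^ 2 + e ^ 2))" by (metis dvd_triv_left mult_left_cancel zero_neq_numeral)
    then show False using e True by simp
  qed
qed

text \<open>The class -1 in type XVII. For odd M, N^2 + M^4 is 2 modulo 8, while the other side is
  divisible by 4 if e is even and, as c is odd, is 6 modulo 8 if e is odd. For even M, e would be
  even too.\<close>

lemma insoluble_minus_1_four:
  assumes "odd c"
  shows "\<not> descent_soluble (4 * c) (- 2) (- 1)"
  unfolding descent_soluble_def
proof clarify
  fix M N e :: int
  assume c: "coprime M e"
    and eq: "- 1 * N ^ 2 = (- 1) ^ 2 * M ^ 4 + 4 * c * - 1 * M ^ 2 * e ^ 2 + - 2 * e ^ 4"
  have eq: "N ^ 2 + M ^ 4 = 4 * (c * M ^ 2 * e ^ 2) + 2 * e ^ 4" using eq by (simp add: algebra_simps)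
  show False
  proof (cases "even M")
    case False
    then obtain j where j: "M ^ 4 = 8 * j + 1" by (rule odd_fourth_mod_8)
    have "even (N ^ 2 + M ^ 4)" unfolding eq by simp
    then have "odd N" using False by simp
    then obtain i where i: "N ^ 2 = 8 * i + 1" by (rule odd_square_mod_8)
    show False
    proof (cases "even e")
      case True
      then obtain t where "e = 2 * t" by (rule evenE)
      then have "(8 * i + 1) + (8 * j + 1) = 4 * (c * M ^ 2 * e ^ 2 + 8 * t ^ 4)" using eq unfolding i j by simp
      then have "4 dvd (8 * i + 1) + (8 * j + 1)" by simp
      then show False by presburger
    next
      case e: False
      then have "odd (c * M ^ 2 * e ^ 2)" using False assms by simp
      then obtain t where t: "c * M ^ 2 * e ^ 2 = 2 * t + 1" by (rule oddE)
      obtain r where r: "e ^ 4 = 8 * r + 1" using e by (rule odd_fourth_mod_8)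
      have "(8 * i + 1) + (8 * j + 1) = 4 * (2 * t + 1) + 2 * (8 * r + 1)" using eq unfolding i j t r .
      then show False by presburger
    qed
  next
    case True
    then have e: "odd e" using c by (auto dest: coprime_common_divisor)
    have "even (N ^ 2 + M ^ 4)" unfolding eq by simp
    then have "even N" using True by simp
    then obtain n m where nm: "N = 2 * n" "M = 2 * m" using True by (auto elim!: evenE)
    have "e ^ 4 = 2 * (n ^ 2 + 4 * m ^ 4 - c * M ^ 2 * e ^ 2)"
      using eq unfolding nm by (simp add: algebra_simps)
    then have "even (e ^ 4)" by simp
    then show False using e by simp
  qed
qed

text \<open>The class 2 on the dual curve in type XVII, with w = p. Repeated halving forces M even
  and e odd, and leaves n^2 congruent to w e^4 modulo 8, so that w would be 1 modulo 8.\<close>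

lemma insoluble_2_dual:
  assumes "w mod 8 = 3"
  shows "\<not> descent_soluble (- 8 * c) (8 * w) 2"
  unfolding descent_soluble_def
proof clarify
  fix M N e :: int
  assume c: "coprime M e"
    and eq: "2 * N ^ 2 = 2 ^ 2 * M ^ 4 + - 8 * c * 2 * M ^ 2 * e ^ 2 + 8 * w * e ^ 4"
  have N: "N ^ 2 = 2 * (M ^ 4 - 4 * (c * M ^ 2 * e ^ 2) + 2 * (w * e ^ 4))" using eq by simp
  then have "even (N ^ 2)" by simp
  then obtain n where n: "N = 2 * n" by (auto elim: evenE)
  have M4: "M ^ 4 = 2 * (n ^ 2 + 2 * (c * M ^ 2 * e ^ 2) - w * e ^ 4)" using N unfolding n by simp
  then have "even (M ^ 4)" by simp
  then have M: "even M" by simp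
  then obtain m where m: "M = 2 * m" by (rule evenE)
  have e: "odd e" using M c by (auto dest: coprime_common_divisor)
  have eq2: "n ^ 2 = 8 * (m ^ 4 - c * m ^ 2 * e ^ 2) + w * e ^ 4"
    using M4 unfolding m by (simp add: algebra_simps)
  obtain j where j: "e ^ 4 = 8 * j + 1" using e by (rule odd_fourth_mod_8)
  have "odd w" using assms by presburger
  then have "odd (n ^ 2)" unfolding eq2 using e by simp
  then have "odd n" by simp
  then obtain i where i: "n ^ 2 = 8 * i + 1" by (rule odd_square_mod_8)
  define t where "t = i - (m ^ 4 - c * m ^ 2 * e ^ 2) - w * j"
  have "w = 8 * t + 1" using eq2 unfolding i j t_def by (simp add: algebra_simps)
  then show False using assms by simp
qed

text \<open>The class -1 on the dual curve in types XVIII, with w = -1, and XIX, with w = p^k. As 8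
  divides N^2 + M^4, M is even; then halving makes w e^4 even, although e is odd.\<close>

lemma insoluble_minus_1_dual:
  assumes "odd w"
  shows "\<not> descent_soluble (8 * u) (8 * w) (- 1)"
  unfolding descent_soluble_def
proof clarify
  fix M N e :: int
  assume c: "coprime M e"
    and eq: "- 1 * N ^ 2 = (- 1) ^ 2 * M ^ 4 + 8 * u * - 1 * M ^ 2 * e ^ 2 + 8 * w * e ^ 4"
  have eq: "N ^ 2 + M ^ 4 = 8 * (u * M ^ 2 * e ^ 2 - w * e ^ 4)" using eq by (simp add: algebra_simps)
  show False
  proof (cases "even M")
    case False
    then obtain j where j: "M ^ 4 = 8 * j + 1" by (rule odd_fourth_mod_8)
    have "even (N ^ 2 + M ^ 4)" unfolding eq by simp
    then have "odd N" using False by simp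
    then obtain i where i: "N ^ 2 = 8 * i + 1" by (rule odd_square_mod_8)
    have "8 dvd (8 * i + 1) + (8 * j + 1)" unfolding i[symmetric] j[symmetric] eq by simp
    then show False by presburger
  next
    case True
    then have e: "odd e" using c by (auto dest: coprime_common_divisor)
    have "even (N ^ 2 + M ^ 4)" unfolding eq by simp
    then have "even N" using True by simp
    then obtain n m where nm: "N = 2 * n" "M = 2 * m" using True by (auto elim!: evenE)
    have eq2: "n ^ 2 = 2 * (4 * (u * m ^ 2 * e ^ 2) - w * e ^ 4 - 2 * m ^ 4)"
      using eq unfolding nm by (simp add: algebra_simps)
    then have "even (n ^ 2)" by simp
    then obtain i where i: "n = 2 * i" by (auto elim: evenE)
    have "w * e ^ 4 = 2 * (2 * (u * m ^ 2 * e ^ 2) - m ^ 4 - i ^ 2)"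
      using eq2 unfolding i by (simp add: power2_eq_square)
    then have "even (w * e ^ 4)" by simp
    then show False using e assms by simp
  qed
qed

text \<open>The class p on the dual curve in type XIX with a > 0. After cancelling p, an odd M gives
  p congruent to 1 modulo 8, and an even M makes w e^4 even.\<close>

lemma insoluble_p_dual:
  assumes p: "p \<noteq> 0" "odd p" "p mod 8 \<noteq> 1" and w: "odd w"
  shows "\<not> descent_soluble (8 * u) (8 * p * w) p"
  unfolding descent_soluble_def
proof clarify
  fix M N e :: int
  assume c: "coprime M e"
    and eq: "p * N ^ 2 = p ^ 2 * M ^ 4 + 8 * u * p * M ^ 2 * e ^ 2 + 8 * p * w * e ^ 4"
  have "p * N ^ 2 = p * (p * M ^ 4 + 8 * (u * M ^ 2 * e ^ 2 + w * e ^ 4))"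
    using eq by (simp add: algebra_simps power2_eq_square)
  then have eq: "N ^ 2 = p * M ^ 4 + 8 * (u * M ^ 2 * e ^ 2 + w * e ^ 4)" using p(1) mult_left_cancel by blast
  show False
  proof (cases "even M")
    case False
    then obtain j where j: "M ^ 4 = 8 * j + 1" by (rule odd_fourth_mod_8)
    have "odd (N ^ 2)" unfolding eq using False p(2) by simp
    then have "odd N" by simp
    then obtain i where i: "N ^ 2 = 8 * i + 1" by (rule odd_square_mod_8)
    define t where "t = i - p * j - (u * M ^ 2 * e ^ 2 + w * e ^ 4)"
    have "p = 8 * t + 1" using eq unfolding i j t_def by (simp add: algebra_simps)
    then show False using p(3) by simp
  next
    case True
    then have e: "odd e" using c by (auto dest: coprime_common_divisor)
    have "even (N ^ 2)" unfolding eq using True by simp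
    then have "even N" by simp
    then obtain n m where nm: "N = 2 * n" "M = 2 * m" using True by (auto elim!: evenE)
    have eq2: "n ^ 2 = 2 * (2 * p * m ^ 4 + 4 * (u * m ^ 2 * e ^ 2) + w * e ^ 4)"
      using eq unfolding nm by (simp add: algebra_simps)
    then have "even (n ^ 2)" by simp
    then obtain i where i: "n = 2 * i" by (auto elim: evenE)
    have "w * e ^ 4 = 2 * (i ^ 2 - p * m ^ 4 - 2 * (u * m ^ 2 * e ^ 2))"
      using eq2 unfolding i by (simp add: power2_eq_square)
    then have "even (w * e ^ 4)" by simp
    then show False using e w by simp
  qed
qed

section \<open>From excluded classes to a bound for the rank\<close>

context integral_cubic
begin

lemma descent_bound_full:
  assumes S: "finite S" "\<And>q. q \<in> S \<Longrightarrow> prime q" "\<And>q. prime q \<Longrightarrow> q dvd b \<Longrightarrow> q \<in> S"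
  shows "descent_bound (2 ^ (card S + 1))"
    and "v \<in> insert (- 1) S \<Longrightarrow> \<not> descent_soluble a b v \<Longrightarrow> descent_bound (2 ^ card S)"
proof -
  have neg: "- 1 \<notin> S" using S(2) prime_ge_0_int[of "- 1"] by auto
  have card: "card (insert (- 1) S) = card S + 1" using neg S(1) by simp
  have B: "finite (insert (- 1) S)" "0 \<notin> insert (- 1) S" using S(1) S(2)[of 0] by auto
  show "descent_bound (2 ^ (card S + 1))"
    by (rule descent_boundI[OF S(1,3) B(1)]) (use card_classes_le[OF B(1)] card in auto)
  assume v: "v \<in> insert (- 1) S" "\<not> descent_soluble a b v"
  have "squarefree v" using v(1) S(2) by (auto intro: squarefree_prime)
  from card_classes_missing[OF B v(1) this v(2)] card
  have "card (descent_classes (insert (- 1) S)) \<le> 2 ^ card S" by simp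
  then show "descent_bound (2 ^ card S)"
    by (intro descent_boundI[OF S(1,3) B(1)]) auto
qed

lemma descent_bound_positive:
  assumes S: "finite S" "\<And>q. q \<in> S \<Longrightarrow> prime q" "\<And>q. prime q \<Longrightarrow> q dvd b \<Longrightarrow> q \<in> S"
    and pos: "\<forall>d<0. \<not> descent_soluble a b d"
  shows "descent_bound (2 ^ card S)"
    and "v \<in> S \<Longrightarrow> \<not> descent_soluble a b v \<Longrightarrow> descent_bound (2 ^ (card S - 1))"
proof -
  have B: "0 \<notin> S" using S(2)[of 0] by auto
  show "descent_bound (2 ^ card S)"
    by (rule descent_boundI[OF S(1,3) S(1)]) (use card_classes_le[OF S(1)] pos in auto)
  assume v: "v \<in> S" "\<not> descent_soluble a b v"
  have "squarefree v" using v(1) S(2) by (auto intro: squarefree_prime)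
  from card_classes_missing[OF S(1) B v(1) this v(2)]
  show "descent_bound (2 ^ (card S - 1))"
    using pos by (intro descent_boundI[OF S(1,3) S(1)]) auto
qed

text \<open>For the dual curve the expression a^2 - 4 b becomes 16 b. If it is negative for one of
  the curves, that curve is positive; if b and a^2 - 4 b are both positive, the sign of a decides,
  since passing to the dual reverses it.\<close>

lemma one_positive:
  "(\<forall>d<0. \<not> descent_soluble a b d) \<or> (\<forall>d<0. \<not> descent_soluble (- 2 * a) (a ^ 2 - 4 * b) d)"
proof -
  interpret D: integral_cubic "- 2 * a" "a ^ 2 - 4 * b" by (rule dual)
  have "(- 2 * a) ^ 2 - 4 * (a ^ 2 - 4 * b) = 16 * b" by (simp add: power2_eq_square)
  then show ?thesis
    using not_soluble_negative D.not_soluble_negative b_nonzero disc_nonzero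
    by (cases "b < 0"; cases "a ^ 2 - 4 * b < 0"; cases "a \<le> 0") auto
qed

abbreviation W' where "W' \<equiv> curve (of_int (- 2 * a) :: rat) (of_int (a ^ 2 - 4 * b))"

lemma W'_eq: "W' = curve (- 2 * of_int a) ((of_int a) ^ 2 - 4 * of_int b)"
  by simp

lemma isogeny_hom: "isogeny (of_int b) \<in> hom (point_group W) (point_group W')"
  unfolding W'_eq hom_def point_group_def
  by (simp add: E.isogeny_on_curve[simplified] E.isogeny_add[simplified])

lemma dual_isogeny_hom: "E.dual_isogeny \<in> hom (point_group W') (point_group W)"
  unfolding W'_eq hom_def point_group_def
  by (simp add: E.dual_isogeny_on_curve[simplified] E.dual_isogeny_add[simplified])

text \<open>If there were k + 1 independent points, the descent inequality would give 2^(k + 1) * 4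
  \<le> n n'.\<close>

lemma rank_le:
  assumes tors: "\<And>x. on_curve W (Affine x 0) \<Longrightarrow> x = 0"
    and n: "descent_bound n" and n': "integral_cubic.descent_bound (- 2 * a) (a ^ 2 - 4 * b) n'"
    and less: "n * n' < 2 ^ Suc k * 4"
  shows "group_rank (point_group W) \<le> enat k"
proof -
  interpret D: integral_cubic "- 2 * a" "a ^ 2 - 4 * b" by (rule dual)
  obtain c :: "rat point \<Rightarrow> int set" where c: "finite (c ` {P. on_curve W P})" "card (c ` {P. on_curve W P}) \<le> n"
    "\<forall>P Q. on_curve W P \<longrightarrow> on_curve W Q \<longrightarrow> c P = c Q \<longrightarrow> (\<exists>s. s \<noteq> 0 \<and> \<delta> P * \<delta> Q = s ^ 2)"
    using n unfolding descent_bound_def by blast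
  obtain c' :: "rat point \<Rightarrow> int set" where c': "finite (c' ` {P. on_curve D.W P})" "card (c' ` {P. on_curve D.W P}) \<le> n'"
    "\<forall>P Q. on_curve D.W P \<longrightarrow> on_curve D.W Q \<longrightarrow> c' P = c' Q \<longrightarrow> (\<exists>s. s \<noteq> 0 \<and> D.\<delta> P * D.\<delta> Q = s ^ 2)"
    using n' unfolding D.descent_bound_def by blast
  have DC: "of_int (- 2 * a) = - 2 * (of_int a :: rat)" "of_int (a ^ 2 - 4 * b) = (of_int a) ^ 2 - 4 * (of_int b :: rat)"
    by simp_all
  let ?G = "point_group W" and ?H = "point_group D.W"
  have carr: "carrier ?G = {P. on_curve W P}" "carrier ?H = {P. on_curve D.W P}" by (simp_all add: point_group_def)
  have mult: "x \<otimes>\<^bsub>?G\<^esub> y = point_add W x y" "x \<otimes>\<^bsub>?H\<^esub> y = point_add D.W x y"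
     "\<one>\<^bsub>?G\<^esub> = Infinity" "\<one>\<^bsub>?H\<^esub> = Infinity" for x y
    by (simp_all add: point_group_def)
  interpret G: comm_group ?G by (rule E.point_group_comm_group)
  interpret H: comm_group ?H by (rule D.E.point_group_comm_group)
  note invG = E.inv_point_group and invH = D.E.inv_point_group
  obtain K where K: "\<forall>P. on_curve W P \<longrightarrow> point_height P ^ 4 \<le> K * point_height (point_add W P P)"
    using point_height_double by blast
  interpret T: two_isogeny_descent ?G ?H "isogeny (of_int b)" E.dual_isogeny "Affine 0 0" "Affine 0 0"
    c c' point_height K
  proof unfold_locales
    show "isogeny (of_int b) \<in> hom ?G ?H" by (rule isogeny_hom)
    show "E.dual_isogeny \<in> hom ?H ?G" by (rule dual_isogeny_hom)
    show "E.dual_isogeny (isogeny (of_int b) x) = x \<otimes>\<^bsub>?G\<^esub> x" if "x \<in> carrier ?G" for x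
      using that E.dual_isogeny_isogeny by (simp only: carr mult mem_Collect_eq)
    show "Affine 0 0 \<in> carrier ?G" "Affine 0 0 \<in> carrier ?H" unfolding carr by simp_all
    show "Affine 0 0 \<noteq> \<one>\<^bsub>?G\<^esub>" "isogeny (of_int b) (Affine 0 0) = \<one>\<^bsub>?H\<^esub>"
      "E.dual_isogeny (Affine 0 0) = \<one>\<^bsub>?G\<^esub>" 
      unfolding mult by (simp_all add: E.dual_isogeny_def)
    \<comment> \<open>A preimage of (0, 0) would have ordinate 0 and nonzero abscissa, which
      \<open>tors\<close> excludes.\<close>
    show "Affine 0 0 \<notin> isogeny (of_int b) ` carrier ?G"
    proof
      assume "Affine 0 0 \<in> isogeny (of_int b) ` carrier ?G"
      then obtain P where P: "on_curve W P" "isogeny (of_int b) P = Affine 0 0" by (auto simp: carr)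
      then obtain x y where xy: "P = Affine x y" by (cases P) auto
      then have "x \<noteq> 0" "y = 0" using P(2) by (auto split: if_splits)
      then show False using tors[of x] P(1) xy by simp
    qed
    show "finite (c ` carrier ?G)" "finite (c' ` carrier ?H)" using c(1) c'(1) unfolding carr by this
    show "x \<otimes>\<^bsub>?G\<^esub> inv\<^bsub>?G\<^esub> y \<in> E.dual_isogeny ` carrier ?H"
      if h: "x \<in> carrier ?G" "y \<in> carrier ?G" "c x = c y" for x y
    proof -
      have xy: "on_curve W x" "on_curve W y" "on_curve W (opposite y)" using h by (simp_all add: carr)
      obtain s where s: "s \<noteq> 0" "\<delta> x * \<delta> y = s ^ 2" using c(3) xy h(3) by blast
      obtain r where r: "r \<noteq> 0" "\<delta> x * \<delta> (opposite y) * \<delta> (point_add W x (opposite y)) = r ^ 2"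
        using E.two_descent_add[OF xy(1,3)] by blast
      have "\<delta> (point_add W x (opposite y)) = (r / s) ^ 2"
        using r s by (simp add: power_divide field_simps)
      moreover have "r / s \<noteq> 0" using r s by simp
      ultimately obtain R where R: "on_curve D.W R" "E.dual_isogeny R = point_add W x (opposite y)"
        using E.dual_isogeny_surj[OF E.add_closed[OF xy(1,3)]] unfolding DC by blast
      show ?thesis unfolding mult invG[OF xy(2)] carr
        by (simp only: R(2)[symmetric] R(1) imageI mem_Collect_eq)
    qed
    show "x \<otimes>\<^bsub>?H\<^esub> inv\<^bsub>?H\<^esub> y \<in> isogeny (of_int b) ` carrier ?G"
      if h: "x \<in> carrier ?H" "y \<in> carrier ?H" "c' x = c' y" for x y
    proof -
      have xy: "on_curve D.W x" "on_curve D.W y" "on_curve D.W (opposite y)"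
        using h by (simp_all only: carr mem_Collect_eq D.E.on_curve_opposite)
      obtain s where s: "s \<noteq> 0" "D.\<delta> x * D.\<delta> y = s ^ 2" using c'(3) xy h(3) by blast
      obtain r where r: "r \<noteq> 0" "D.\<delta> x * D.\<delta> (opposite y) * D.\<delta> (point_add D.W x (opposite y)) = r ^ 2"
        using D.E.two_descent_add[OF xy(1,3)] by blast
      have "D.\<delta> (point_add D.W x (opposite y)) = r ^ 2 / s ^ 2"
        using r(2) s unfolding D.E.two_descent_opposite s(2) by (metis nonzero_mult_div_cancel_left power_not_zero)
      then have "D.\<delta> (point_add D.W x (opposite y)) = (r / s) ^ 2" unfolding power_divide .
      moreover have "r / s \<noteq> 0" using r s by simp
      ultimately obtain R where R: "on_curve W R" "isogeny (of_int b) R = point_add D.W x (opposite y)"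
        using E.isogeny_surj[of "point_add D.W x (opposite y)" "r / s"] D.E.add_closed[OF xy(1,3)]
        unfolding DC by blast
      show ?thesis unfolding mult invH[OF xy(2)] carr
        by (simp only: R(2)[symmetric] R(1) imageI mem_Collect_eq)
    qed
    show "finite {x \<in> carrier ?G. point_height x \<le> B}" for B
      using finite_point_height[of "of_int a" "of_int b" B] by (simp add: carr)
    show "\<exists>k. \<forall>x\<in>carrier ?G. point_height (x \<otimes>\<^bsub>?G\<^esub> q) \<le> k * point_height x ^ 2"
      if "q \<in> carrier ?G" for q
      using point_height_translate[of q] that by (simp add: carr mult)
    show "point_height x ^ 4 \<le> K * point_height (x \<otimes>\<^bsub>?G\<^esub> x)" if "x \<in> carrier ?G" for x
      using K that by (simp add: carr mult)
  qed
  show ?thesis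
    unfolding group_rank_def
  proof (rule SUP_least)
    fix S assume "S \<in> {S. finite S \<and> S \<subseteq> carrier ?G \<and> int_independent ?G S}"
    then have "2 ^ card S * 4 \<le> card (c ` carrier ?G) * card (c' ` carrier ?H)"
      by (intro T.rank_bound) auto
    also have "\<dots> \<le> n * n'" using c(2) c'(2) unfolding carr by (rule mult_le_mono)
    also note less
    finally have "(2 :: nat) ^ card S < 2 ^ Suc k" by simp
    then have "card S < Suc k" by (simp only: power_strict_increasing_iff one_less_numeral_iff semiring_norm)
    then show "enat (card S) \<le> enat k" by simp
  qed
qed

text \<open>Each isogeny has a kernel killed by 2 and so gives one inequality.\<close>

lemma group_rank_dual: "group_rank (point_group W) = group_rank (point_group W')"
proof (rule antisym)
  interpret D: integral_cubic "- 2 * a" "a ^ 2 - 4 * b" by (rule dual)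
  note groups = E.point_group_comm_group D.E.point_group_comm_group
  show "group_rank (point_group W) \<le> group_rank (point_group W')"
    by (rule group_rank_mono[OF groups isogeny_hom]) (simp add: point_group_def E.isogeny_kernel)
  show "group_rank (point_group W') \<le> group_rank (point_group W)"
  proof (rule group_rank_mono[OF groups(2,1) dual_isogeny_hom])
    fix P assume "P \<in> carrier (point_group W')" "E.dual_isogeny P = \<one>\<^bsub>point_group W\<^esub>"
    then show "P \<otimes>\<^bsub>point_group W'\<^esub> P = \<one>\<^bsub>point_group W'\<^esub>"
      using E.dual_isogeny_kernel[of P] unfolding W'_eq by (simp add: point_group_def)
  qed
qed

end

section \<open>The twenty types\<close>

text \<open>The description denotes a root because exactly one of s and -s qualifies: for odd s one
  of them is 1 modulo 4 and the other is 3.\<close>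

lemma signed_sqrt_square: "signed_sqrt (s ^ 2) ^ 2 = s ^ 2"
proof -
  have "\<exists>!r. r ^ 2 = s ^ 2 \<and> (if odd (s ^ 2) then [r = 1] (mod 4) else 0 \<le> r)"
  proof (cases "odd s")
    case True
    then have "s mod 4 = 1 \<or> s mod 4 = 3" by presburger
    then show ?thesis
    proof
      assume "s mod 4 = 1"
      moreover from this have "(- s) mod 4 \<noteq> 1" by presburger
      ultimately show ?thesis using True by (intro ex1I[of _ s]) (auto simp: cong_def power2_eq_iff)
    next
      assume "s mod 4 = 3"
      moreover from this have "(- s) mod 4 = 1" by presburger
      ultimately show ?thesis using True by (intro ex1I[of _ "- s"]) (auto simp: cong_def power2_eq_iff)
    qed
  next
    case False
    then show ?thesis by (intro ex1I[of _ "\<bar>s\<bar>"]) (auto simp: power2_eq_iff)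
  qed
  from theI'[OF this] show ?thesis unfolding signed_sqrt_def by blast
qed

lemma integral_cubic_two_torsion_curve:
  assumes "elliptic_curve (two_torsion_curve a b)"
  shows "integral_cubic a b"
proof -
  have "wdisc (two_torsion_curve a b) = of_int (16 * b ^ 2 * (a ^ 2 - 4 * b))"
    by (simp add: wdisc_def wb2_def wb4_def wb6_def wb8_def two_torsion_curve_def algebra_simps
        power2_eq_square power3_eq_cube)
  then have "16 * b ^ 2 * (a ^ 2 - 4 * b) \<noteq> 0" using assms unfolding elliptic_curve_def by (metis of_int_0)
  then show ?thesis by unfold_locales auto
qed

context integral_cubic
begin

text \<open>Otherwise the point would be a third element of the 2-torsion, besides infinity and (0,
  0).\<close>

lemma two_torsion_unique:
  assumes iso: "(point_group W)\<lparr>carrier := torsion_points 2 W\<rparr> \<cong> integer_mod_group 2"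
    and x: "on_curve W (Affine x 0)"
  shows "x = 0"
proof (rule ccontr)
  assume "x \<noteq> 0"
  obtain h where "bij_betw h (torsion_points 2 W) (carrier (integer_mod_group 2))"
    using iso unfolding is_iso_def iso_def by auto
  then have "card (torsion_points 2 W) = card (carrier (integer_mod_group 2))" by (rule bij_betw_same_card)
  then have card: "card (torsion_points 2 W) = 2" by (simp add: carrier_integer_mod_group)
  have "P [^]\<^bsub>point_group W\<^esub> (2 :: nat) = point_add W (point_add W Infinity P) P" for P
    by (simp add: numeral_2_eq_2 nat_pow_def) (simp add: point_group_def)
  then have tors: "torsion_points 2 W = {P. on_curve W P \<and> point_add W P P = Infinity}"
    unfolding torsion_points_def by (simp add: point_group_def)
  have "{Infinity, Affine 0 0, Affine x 0} \<subseteq> torsion_points 2 W" unfolding tors using x by auto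
  moreover have "finite (torsion_points 2 W)" using card by (simp add: card_ge_0_finite)
  ultimately have "card {Infinity, Affine 0 0, Affine x 0} \<le> 2" using card by (metis card_mono)
  then show False using \<open>x \<noteq> 0\<close> by simp
qed

text \<open>On one of the two curves -1 contributes nothing, so the product of the two image sizes
  is at most 2^(card S + card S' + 1) \<le> 8. This settles every type in case (1).\<close>

lemma rank_le_1_of_prime_sets:
  assumes tors: "\<And>x. on_curve W (Affine x 0) \<Longrightarrow> x = 0"
    and S: "finite S" "\<And>q. q \<in> S \<Longrightarrow> prime q" "\<And>q. prime q \<Longrightarrow> q dvd b \<Longrightarrow> q \<in> S"
    and S': "finite S'" "\<And>q. q \<in> S' \<Longrightarrow> prime q" "\<And>q. prime q \<Longrightarrow> q dvd a ^ 2 - 4 * b \<Longrightarrow> q \<in> S'"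
    and card: "card S + card S' \<le> 2"
  shows "group_rank (point_group W) \<le> enat 1"
proof -
  interpret D: integral_cubic "- 2 * a" "a ^ 2 - 4 * b" by (rule dual)
  have "(2 :: nat) ^ (card S + card S') \<le> 2 ^ 2" using card by (intro power_increasing) auto
  then have less: "(2 :: nat) ^ card S * 2 ^ (card S' + 1) < 2 ^ Suc 1 * 4"
    "(2 :: nat) ^ (card S + 1) * 2 ^ card S' < 2 ^ Suc 1 * 4"
    by (simp_all add: power_add)
  from one_positive show ?thesis
  proof
    assume "\<forall>d<0. \<not> descent_soluble a b d"
    then show ?thesis
      by (intro rank_le[OF tors descent_bound_positive(1)[OF S] D.descent_bound_full(1)[OF S'] less(1)])
  next
    assume "\<forall>d<0. \<not> descent_soluble (- 2 * a) (a ^ 2 - 4 * b) d"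
    then show ?thesis
      by (intro rank_le[OF tors descent_bound_full(1)[OF S] D.descent_bound_positive(1)[OF S'] less(2)])
  qed
qed

end

text \<open>Up to sign, b and a^2 - 4 b are products of powers of 2 and p. Where three primes occur,
  counted over both curves, the bound for n n' is 16 and one class has to be excluded; in type XVII
  two are, which brings the rank down to 0.\<close>

lemma rank_le_of_type:
  fixes p k :: nat and a b \<alpha> :: int
  assumes p: "prime p" "29 \<le> p"
    and cub: "integral_cubic a b"
    and tors: "\<And>x. on_curve (curve (of_int a) (of_int b :: rat)) (Affine x 0) \<Longrightarrow> x = 0"
    and \<alpha>: "\<alpha> ^ 2 = type_square T p k" and par: "type_params T p k \<alpha> a b"
  shows "T \<in> {Type_I, Type_II, Type_III, Type_IV, Type_V, Type_VI, Type_VII, Type_XI, Type_XIII, Type_XV} \<or>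
     T = Type_VIII \<and> k = 2 \<or> T = Type_X \<or>
     T = Type_XII \<and> k = 2 \<and> (\<nexists>x::int. [x ^ 4 = - 64] (mod int p)) \<or>
     T = Type_XVI \<or>
     T = Type_XVII \<and> k = 1 \<and> [p = 3] (mod 8) \<or>
     T = Type_XVIII \<and> k = 1 \<or>
     T = Type_XIX \<and> \<not> [p = 1] (mod 8)
     \<Longrightarrow> group_rank (point_group (curve (of_int a) (of_int b :: rat))) \<le> enat 1" (is "?cases \<Longrightarrow> ?rank1")
    and "T = Type_XVII \<Longrightarrow> k = 1 \<Longrightarrow> [p = 3] (mod 8) \<Longrightarrow>
      group_rank (point_group (curve (of_int a) (of_int b :: rat))) \<le> enat 0"
proof -
  define P where "P = int p"
  interpret integral_cubic a b by (rule cub)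
  interpret D: integral_cubic "- 2 * a" "a ^ 2 - 4 * b" by (rule dual)
  have P: "prime P" "odd P" "P > 2" "P \<noteq> 0"
    using p prime_odd_nat[of p] by (auto simp: P_def)
  have mod8: "[p = n] (mod 8) \<longleftrightarrow> P mod 8 = int n" if "n < 8" for n
  proof -
    have "P mod 8 = int (p mod 8)" by (simp add: P_def zmod_int)
    then show ?thesis using that by (simp only: of_nat_eq_iff cong_def mod_less)
  qed
  \<comment> \<open>The conclusions for exponent 0 let one statement serve pure powers of 2, pure
    powers of P, and units.\<close>
  have cov: "q \<in> {2, P}" "i = 0 \<Longrightarrow> q = P" "j = 0 \<Longrightarrow> q = 2" "i = 0 \<Longrightarrow> j = 0 \<Longrightarrow> False"
    if "prime q" "q dvd c" "c dvd 2 ^ i * P ^ j" for q c :: int and i j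
  proof -
    have "q dvd 2 ^ i * P ^ j" using that(2,3) by (rule dvd_trans)
    then have "q dvd 2 ^ i \<or> q dvd P ^ j" using that(1) prime_dvd_mult_iff by blast
    moreover have "m > 0 \<and> q dvd r" if "q dvd r ^ m" for r m
      using that \<open>prime q\<close> prime_dvd_power[of q r m] by (cases "m = 0") auto
    ultimately have "i > 0 \<and> q dvd 2 \<or> j > 0 \<and> q dvd P" by blast
    then have "i > 0 \<and> q = 2 \<or> j > 0 \<and> q = P"
      using primes_dvd_imp_eq[OF that(1), of 2] primes_dvd_imp_eq[OF that(1) P(1)] by auto
    then show "q \<in> {2, P}" "i = 0 \<Longrightarrow> q = P" "j = 0 \<Longrightarrow> q = 2" "i = 0 \<Longrightarrow> j = 0 \<Longrightarrow> False" by auto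
  qed
  have primes: "q \<in> {2} \<Longrightarrow> prime q" "q \<in> {P} \<Longrightarrow> prime q" "q \<in> {2, P} \<Longrightarrow> prime q" for q using P(1) by auto
  have cov2: "q \<in> {2}" if "prime q" "q dvd c" "c dvd 2 ^ i" for q c :: int and i
    using cov(3)[of q c i 0] that by simp
  have covP: "q \<in> {P}" if "prime q" "q dvd c" "c dvd P ^ j" for q c :: int and j
    using cov(2)[of q c 0 j] that by simp
  have card2: "card {2, P} = 2" using P(3) by simp
  \<comment> \<open>The three patterns settled by counting primes: b and a^2 - 4 b divide powers of
    different primes, in either order, or b is a unit.\<close>
  have gen1: ?rank1 if d: "b dvd 2 ^ i" "a ^ 2 - 4 * b dvd P ^ j" for i j
    by (rule rank_le_1_of_prime_sets[OF tors _ primes(1) cov2[OF _ _ d(1)] _ primes(2) covP[OF _ _ d(2)]]) auto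
  have gen2: ?rank1 if d: "b dvd P ^ i" "a ^ 2 - 4 * b dvd 2 ^ j" for i j
    by (rule rank_le_1_of_prime_sets[OF tors _ primes(2) covP[OF _ _ d(1)] _ primes(1) cov2[OF _ _ d(2)]]) auto
  have gen3: ?rank1 if d: "b dvd 1" "a ^ 2 - 4 * b dvd 2 ^ i * P ^ j" for i j
  proof (rule rank_le_1_of_prime_sets[OF tors _ _ _ _ primes(3) cov(1)[OF _ _ d(2)]])
    show "q \<in> {}" if "prime q" "q dvd b" for q
      using that d(1) dvd_trans[of q b 1] by auto
  qed (use card2 in auto)
  have k4: "(4 :: int) * 2 ^ (k - 2) = 2 ^ k" if k: "k \<ge> 2"
  proof -
    obtain m where "k = 2 + m" using le_Suc_ex[OF k] by blast
    then show ?thesis by (simp add: power_add)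
  qed
  have dual_pos: "\<forall>d<0. \<not> descent_soluble (- 2 * a) (a ^ 2 - 4 * b) d" if "b < 0"
    using D.not_soluble_negative that by (auto simp: power2_eq_square)
  have pos: "\<forall>d<0. \<not> descent_soluble a b d" if "a ^ 2 - 4 * b < 0"
    using not_soluble_negative that by auto
  have XVII: "group_rank (point_group W) \<le> enat 0"
    if T: "T = Type_XVII" and k: "k = 1" and p3: "[p = 3] (mod 8)"
  proof -
    have "\<alpha> ^ 2 = (P - 1) div 2" using \<alpha> T k by (simp add: P_def)
    then have Pa: "P = 2 * \<alpha> ^ 2 + 1" using P(2) by presburger
    obtain c where c: "a = 4 * c" "c ^ 2 = \<alpha> ^ 2"
      using par T by (cases "a = 4 * \<alpha>") (auto intro: that[of \<alpha>] that[of "- \<alpha>"])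
    have b: "b = - 2" using par T by simp
    have b': "a ^ 2 - 4 * b = 8 * P" unfolding b c(1) Pa c(2)[symmetric] by (simp add: power2_eq_square)
    have P3: "P mod 8 = 3" using mod8[of 3] p3 by simp
    have "odd c"
    proof
      assume "even c"
      then obtain t where "c = 2 * t" by (rule evenE)
      then have "P = 8 * t ^ 2 + 1" unfolding Pa c(2)[symmetric] by (simp add: power2_eq_square)
      then show False using P3 by simp
    qed
    have dv: "b dvd 2 ^ 1" unfolding b by simp
    have n: "descent_bound (2 ^ card {2 :: int})"
      by (rule descent_bound_full(2)[OF _ primes(1) cov2[OF _ _ dv], of "- 1"])
        (use insoluble_minus_1_four[OF \<open>odd c\<close>] in \<open>auto simp: b c(1)\<close>)
    have dv': "a ^ 2 - 4 * b dvd 2 ^ 3 * P ^ 1" unfolding b' by simp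
    have "\<not> descent_soluble (- 2 * a) (a ^ 2 - 4 * b) 2"
      using insoluble_2_dual[OF P3, of c] unfolding b' by (simp add: c(1))
    then have n': "D.descent_bound (2 ^ (card {2, P} - 1))"
      by (intro D.descent_bound_positive(2)[OF _ primes(3) cov(1)[OF _ _ dv'], of 2] dual_pos)
        (auto simp: b' b)
    \<comment> \<open>n n' = 2 * 2 < 8: -1 is excluded on E, and 2 on the dual curve, which is
      already positive.\<close>
    show ?thesis using rank_le[OF tors n n', of 0] card2 by simp
  qed
  then show "T = Type_XVII \<Longrightarrow> k = 1 \<Longrightarrow> [p = 3] (mod 8) \<Longrightarrow>
      group_rank (point_group (curve (of_int a) (of_int b :: rat))) \<le> enat 0" .
  assume ?cases
  then consider "T \<in> {Type_I, Type_II, Type_III, Type_IV, Type_V}" | "T \<in> {Type_VI, Type_XI}"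
    | "T \<in> {Type_VII, Type_XIII, Type_XV}" | "T = Type_VIII" "k = 2" | "T = Type_X"
    | "T = Type_XII" "k = 2" "\<nexists>x::int. [x ^ 4 = - 64] (mod int p)" | "T = Type_XVI"
    | "T = Type_XVII" "k = 1" "[p = 3] (mod 8)" | "T = Type_XVIII" "k = 1"
    | "T = Type_XIX" "\<not> [p = 1] (mod 8)" by blast
  then show ?rank1
  proof cases
    case 1
    have k: "k \<ge> 2" and bk: "b = 2 ^ (k - 2) \<or> b = - (2 ^ (k - 2))" and a2: "a ^ 2 = \<alpha> ^ 2"
      using 1 par by auto
    have "b dvd 2 ^ (k - 2)" using bk by auto
    \<comment> \<open>4 b equals 2^k up to sign and cancels the power of 2 in \<alpha>^2; the value
      -p belongs to type V.\<close>
    moreover have "a ^ 2 - 4 * b = P \<or> a ^ 2 - 4 * b = - P"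
      unfolding a2 using 1 par \<alpha> k4[OF k] by (auto simp: P_def)
    then have "a ^ 2 - 4 * b dvd P ^ 1" by auto
    ultimately show ?thesis by (rule gen1)
  next
    case 2
    have b: "b = - 1" and a2: "a ^ 2 = 4 * \<alpha> ^ 2" using 2 par by (auto simp: power2_eq_square)
    \<comment> \<open>The value is 8 p^k in type XI, but 4 p in type VI, whose equation involves no
      exponent k.\<close>
    have "a ^ 2 - 4 * b dvd 2 ^ 3 * P ^ k \<or> a ^ 2 - 4 * b dvd 2 ^ 3 * P ^ 1"
      unfolding a2 using 2 \<alpha> b by (auto simp: P_def intro!: mult_dvd_mono)
    then show ?thesis using gen3 b by fastforce
  next
    case 3
    have a2: "a ^ 2 = 4 * \<alpha> ^ 2" using 3 par by (auto simp: power2_eq_square)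
    have "b dvd P ^ k \<or> b dvd P ^ 1" using 3 par by (auto simp: P_def)
    \<comment> \<open>The values are -4 in type VII, 8 in type XIII and -8 in type XV.\<close>
    moreover have "a ^ 2 - 4 * b dvd 2 ^ 3" unfolding a2 using 3 \<alpha> par by (auto simp: P_def)
    ultimately show ?thesis using gen2 by blast
  next
    case 4
    have \<alpha>2: "\<alpha> ^ 2 = P - 4" using \<alpha> 4 by (simp add: P_def)
    obtain c where c: "a = 2 * c" "c ^ 2 = \<alpha> ^ 2"
      using par 4 by (cases "a = 2 * \<alpha>") (auto intro: that[of \<alpha>] that[of "- \<alpha>"])
    have b: "b = - 4" using par 4 by simp
    have b': "a ^ 2 - 4 * b = 4 * P" unfolding b c(1) power_mult_distrib c(2) \<alpha>2 by simp
    have "odd (c ^ 2)" unfolding c(2) \<alpha>2 using P(2) by simp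
    then have "odd c" by simp
    have dv: "b dvd 2 ^ 2" unfolding b by simp
    have n: "descent_bound (2 ^ card {2 :: int})"
      by (rule descent_bound_full(2)[OF _ primes(1) cov2[OF _ _ dv], of 2])
        (use insoluble_2[OF \<open>odd c\<close>] in \<open>auto simp: b c(1)\<close>)
    have dv': "a ^ 2 - 4 * b dvd 2 ^ 2 * P ^ 1" unfolding b' by simp
    have n': "D.descent_bound (2 ^ card {2, P})"
      by (rule D.descent_bound_positive(1)[OF _ primes(3) cov(1)[OF _ _ dv'] dual_pos]) (simp_all add: b)
    show ?thesis using rank_le[OF tors n n', of 1] card2 by simp
  next
    case 5
    have \<alpha>2: "\<alpha> ^ 2 = 2 ^ k - P" using \<alpha> 5 by (simp add: P_def)
    have k: "k \<ge> 2" and b: "b = 2 ^ k" using par 5 by auto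
    obtain c where c: "a = 2 * c" "c ^ 2 = \<alpha> ^ 2"
      using par 5 by (cases "a = 2 * \<alpha>") (auto intro: that[of \<alpha>] that[of "- \<alpha>"])
    have b': "a ^ 2 - 4 * b = - 4 * P" unfolding b c(1) power_mult_distrib c(2) \<alpha>2 by simp
    have "odd (c ^ 2)" unfolding c(2) \<alpha>2 using P(2) k by simp
    then have "odd c" by simp
    then obtain j where j: "c ^ 2 = 8 * j + 1" by (rule odd_square_mod_8)
    \<comment> \<open>p is a multiple of 4 minus an odd square, hence 3 modulo 4.\<close>
    have "P = 4 * 2 ^ (k - 2) - (8 * j + 1)" using \<alpha>2 c(2) j k4[OF k] by simp
    then have P3: "P mod 4 = 3" by presburger
    have dv: "b dvd 2 ^ k" unfolding b by simp
    have n: "descent_bound (2 ^ card {2 :: int})"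
      by (rule descent_bound_positive(1)[OF _ primes(1) cov2[OF _ _ dv] pos]) (use P(3) in \<open>simp_all add: b'\<close>)
    have dv': "a ^ 2 - 4 * b dvd 2 ^ 2 * P ^ 1" unfolding b' by simp
    have "\<not> descent_soluble (- 2 * a) (a ^ 2 - 4 * b) (- 1)"
      using insoluble_minus_1_p3[OF P3, of c] unfolding b' by (simp add: c(1))
    then have n': "D.descent_bound (2 ^ card {2, P})"
      by (intro D.descent_bound_full(2)[OF _ primes(3) cov(1)[OF _ _ dv'], of "- 1"])
        (auto simp: b')
    show ?thesis using rank_le[OF tors n n', of 1] card2 by simp
  next
    case 6
    \<comment> \<open>This case is empty: \<open>\<alpha>\<close> is a square root of \<open>-1\<close> modulo \<open>p\<close>, and \<open>(1 + \<alpha>)^4 = -4\<close>.\<close>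
    have \<alpha>2: "\<alpha> ^ 2 = 2 * P ^ 2 - 1" using \<alpha> 6 by (simp add: P_def)
    have "[(2 * (1 + \<alpha>)) ^ 4 = - 64] (mod P)"
    proof -
      have "(2 * (1 + \<alpha>)) ^ 4 - - 64 = 16 * (\<alpha> ^ 2 + 1) * (\<alpha> ^ 2 + 4 * \<alpha> + 5)"
        by (simp add: algebra_simps power2_eq_square power4_eq_xxxx)
      also have "\<alpha> ^ 2 + 1 = P * (2 * P)" using \<alpha>2 by (simp add: power2_eq_square)
      finally have "P dvd (2 * (1 + \<alpha>)) ^ 4 - - 64" by simp
      then show ?thesis by (simp only: cong_iff_dvd_diff)
    qed
    then show ?thesis using 6(3) by (auto simp: P_def)
  next
    case 7
    have \<alpha>2: "\<alpha> ^ 2 = P - 2" using \<alpha> 7 by (simp add: P_def)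
    obtain c where c: "a = 2 * c" "c ^ 2 = \<alpha> ^ 2"
      using par 7 by (cases "a = 2 * \<alpha>") (auto intro: that[of \<alpha>] that[of "- \<alpha>"])
    have b: "b = - 2" using par 7 by simp
    have b': "a ^ 2 - 4 * b = 4 * P" unfolding b c(1) power_mult_distrib c(2) \<alpha>2 by simp
    have "odd (c ^ 2)" unfolding c(2) \<alpha>2 using P(2) by simp
    then have "odd c" by simp
    have dv: "b dvd 2 ^ 1" unfolding b by simp
    have n: "descent_bound (2 ^ card {2 :: int})"
      by (rule descent_bound_full(2)[OF _ primes(1) cov2[OF _ _ dv], of "- 1"])
        (use insoluble_minus_1_twice[OF \<open>odd c\<close>] in \<open>auto simp: b c(1)\<close>)
    have dv': "a ^ 2 - 4 * b dvd 2 ^ 2 * P ^ 1" unfolding b' by simp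
    have n': "D.descent_bound (2 ^ card {2, P})"
      by (rule D.descent_bound_positive(1)[OF _ primes(3) cov(1)[OF _ _ dv'] dual_pos]) (simp_all add: b)
    show ?thesis using rank_le[OF tors n n', of 1] card2 by simp
  next
    case 8
    have "enat 0 \<le> enat 1" by simp
    with XVII[OF 8] show ?thesis by (rule order_trans)
  next
    case 9
    have "\<alpha> ^ 2 = (P - 1) div 2" using \<alpha> 9 by (simp add: P_def)
    then have Pa: "P = 2 * \<alpha> ^ 2 + 1" using P(2) by presburger
    obtain c where c: "a = 4 * c" "c ^ 2 = \<alpha> ^ 2"
      using par 9 by (cases "a = 4 * \<alpha>") (auto intro: that[of \<alpha>] that[of "- \<alpha>"])
    have b: "b = 2 * P" using par 9 by (simp add: P_def)
    have b': "a ^ 2 - 4 * b = 8 * - 1" unfolding b c(1) Pa c(2)[symmetric] by (simp add: power2_eq_square)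
    have dv: "b dvd 2 ^ 1 * P ^ 1" unfolding b by simp
    have n: "descent_bound (2 ^ card {2, P})"
      by (rule descent_bound_positive(1)[OF _ primes(3) cov(1)[OF _ _ dv] pos]) (simp_all add: b')
    have dv': "a ^ 2 - 4 * b dvd 2 ^ 3" unfolding b' by simp
    have "\<not> descent_soluble (- 2 * a) (a ^ 2 - 4 * b) (- 1)"
      using insoluble_minus_1_dual[of "- 1" "- c"] unfolding b' by (simp add: c(1))
    then have n': "D.descent_bound (2 ^ card {2 :: int})"
      by (intro D.descent_bound_full(2)[OF _ primes(1) cov2[OF _ _ dv'], of "- 1"])
        (auto simp: b')
    show ?thesis using rank_le[OF tors n n', of 1] card2 by simp
  next
    case 10
    have k: "k \<in> {1, 2}" and b: "b = 2" using par 10 by auto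
    have "\<alpha> ^ 2 = (P ^ k + 1) div 2" using \<alpha> 10 by (simp add: P_def)
    moreover have oddk: "odd (P ^ k)" using P(2) by simp
    moreover have "x = 2 * y - 1" if "y = (x + 1) div 2" "odd x" for x y :: int using that by presburger
    ultimately have Pa: "P ^ k = 2 * \<alpha> ^ 2 - 1" by blast
    obtain c where c: "a = 4 * c" "c ^ 2 = \<alpha> ^ 2"
      using par 10 by (cases "a = 4 * \<alpha>") (auto intro: that[of \<alpha>] that[of "- \<alpha>"])
    have b': "a ^ 2 - 4 * b = 8 * P ^ k" unfolding b c(1) Pa c(2)[symmetric] by (simp add: power2_eq_square)
    have P1: "P mod 8 \<noteq> 1" using mod8[of 1] 10 by simp
    show ?thesis
    \<comment> \<open>b and a^2 - 4 b are both positive here, so the sign of a tells which curve is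
      positive. On the dual curve, -1 is the excluded class if E is the positive one, and p
      otherwise.\<close>
    proof (cases "a \<le> 0")
      case True
      have dv: "b dvd 2 ^ 1" unfolding b by simp
      have n: "descent_bound (2 ^ card {2 :: int})"
        by (rule descent_bound_positive(1)[OF _ primes(1) cov2[OF _ _ dv]])
          (use not_soluble_negative True in \<open>auto simp: b\<close>)
      have dv': "a ^ 2 - 4 * b dvd 2 ^ 3 * P ^ k" unfolding b' by simp
      have "\<not> descent_soluble (- 2 * a) (a ^ 2 - 4 * b) (- 1)"
        using insoluble_minus_1_dual[OF oddk, of "- c"] unfolding b' by (simp add: c(1))
      then have n': "D.descent_bound (2 ^ card {2, P})"
        by (intro D.descent_bound_full(2)[OF _ primes(3) cov(1)[OF _ _ dv'], of "- 1"])
          (auto simp: b')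
      show ?thesis using rank_le[OF tors n n', of 1] card2 by simp
    next
      case False
      have dv: "b dvd 2 ^ 1" unfolding b by simp
      have n: "descent_bound (2 ^ (card {2 :: int} + 1))"
        by (rule descent_bound_full(1)[OF _ primes(1) cov2[OF _ _ dv]]) (auto simp: b)
      have dpos: "\<forall>d<0. \<not> descent_soluble (- 2 * a) (a ^ 2 - 4 * b) d"
        using D.not_soluble_negative False P(3) unfolding b' by auto
      have Pk: "P ^ k = P * P ^ (k - 1)" using k by (auto simp: power2_eq_square)
      have dv': "a ^ 2 - 4 * b dvd 2 ^ 3 * P ^ k" unfolding b' by simp
      have "\<not> descent_soluble (- 2 * a) (a ^ 2 - 4 * b) P"
        using insoluble_p_dual[OF P(4,2) P1, of "P ^ (k - 1)" "- c"] P(2) unfolding b' Pk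
        by (simp add: c(1) mult.assoc)
      then have n': "D.descent_bound (2 ^ (card {2, P} - 1))"
        by (intro D.descent_bound_positive(2)[OF _ primes(3) cov(1)[OF _ _ dv'], of P] dpos)
          (auto simp: b')
      show ?thesis using rank_le[OF tors n n', of 1] card2 by simp
    qed
  qed
qed

theorem theorem3p2:
  fixes p k :: nat and T :: pair_type and E E' :: "rat weierstrass"
  assumes "Factorial_Ring.prime p" and "29 \<le> p"
    and "pair_of_type T p k E E'"
  shows "group_rank (point_group E) = group_rank (point_group E') \<and>
    (T \<in> {Type_I, Type_II, Type_III, Type_IV, Type_V, Type_VI, Type_VII, Type_XI, Type_XIII, Type_XV} \<or>
     T = Type_VIII \<and> k = 2 \<or>
     T = Type_X \<or>
     T = Type_XII \<and> k = 2 \<and> (\<nexists>x::int. [x ^ 4 = - 64] (mod int p)) \<or>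
     T = Type_XVI \<or>
     T = Type_XVII \<and> k = 1 \<and> [p = 3] (mod 8) \<or>
     T = Type_XVIII \<and> k = 1 \<or>
     T = Type_XIX \<and> \<not> [p = 1] (mod 8)
     \<longrightarrow> group_rank (point_group E) \<le> 1) \<and>
    (T = Type_XVII \<and> k = 1 \<and> [p = 3] (mod 8) \<longrightarrow> group_rank (point_group E) = 0)"
proof -
  obtain a b s where sq: "type_square T p k = s ^ 2"
    and par: "type_params T p k (signed_sqrt (type_square T p k)) a b"
    and E: "E = two_torsion_curve a b" and E': "E' = two_torsion_curve (- 2 * a) (a ^ 2 - 4 * b)"
    and ell: "elliptic_curve E"
    and iso: "(point_group E)\<lparr>carrier := torsion_points 2 E\<rparr> \<cong> integer_mod_group 2"
    using assms(3) unfolding pair_of_type_def by blast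
  have cub: "integral_cubic a b" using ell unfolding E by (rule integral_cubic_two_torsion_curve)
  then interpret integral_cubic a b .
  have W: "E = W" "E' = W'" unfolding E E' two_torsion_curve_def by simp_all
  have \<alpha>: "signed_sqrt (type_square T p k) ^ 2 = type_square T p k"
    unfolding sq by (rule signed_sqrt_square)
  have tors: "x = 0" if "on_curve W (Affine x 0)" for x
    using two_torsion_unique iso that unfolding W by blast
  note aux = rank_le_of_type[OF assms(1,2) cub tors \<alpha> par]
  have "group_rank (point_group E) = 0" if "T = Type_XVII \<and> k = 1 \<and> [p = 3] (mod 8)"
    using aux(2) that unfolding W by (simp flip: zero_enat_def)
  moreover have "group_rank (point_group E) = group_rank (point_group E')"
    unfolding W by (rule group_rank_dual)
  ultimately show ?thesis using aux(1) unfolding W one_enat_def by blast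
qed

end
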